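(* There is no pl-realizable $16_4$-configuration.
   Context: A $16_4$-configuration is a simple matroid $M$ of rank $3$ on $16$ elements (called points) such that every line (rank-2 flat) of $M$ contains at most $4$ points, and each point is contained in exactly $4$ lines that have exactly $4$ points. An arrangement of pseudolines is a finite family of simple closed non-contractible curves in the real projective plane, any two of which meet in exactly one point, where they cross transversally. A $16_4$-configuration $M$ is pl-realizable (realizable with pseudolines) if there is an arrangement of pseudolines having exactly the incidences prescribed by $M$: the arrangement consists of $16$ pseudolines labelled by the elements of $M$, and a set of these pseudolines has a common point if and only if the corresponding set of elements has rank at most $2$ in $M$. By the Folkman-Lawrence representation theorem this is equivalent to $M$ being orientable (i.e. $M$ is the underlying matroid of an oriented matroid). *)

theory Defs
  imports "HOL-Analysis.Analysis"
begin

section \<open>Matroids on a finite ground set\<close>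

definition matroid :: "'a set \<Rightarrow> ('a set \<Rightarrow> bool) \<Rightarrow> bool" where
  "matroid E indep \<longleftrightarrow>
     finite E \<and>
     (\<forall>X. indep X \<longrightarrow> X \<subseteq> E) \<and>
     indep {} \<and>
     (\<forall>X Y. indep Y \<longrightarrow> X \<subseteq> Y \<longrightarrow> indep X) \<and>
     (\<forall>X Y. indep X \<longrightarrow> indep Y \<longrightarrow> card X < card Y \<longrightarrow> (\<exists>e\<in>Y - X. indep (insert e X)))"

definition matroid_rank :: "('a set \<Rightarrow> bool) \<Rightarrow> 'a set \<Rightarrow> nat" where
  "matroid_rank indep X = Max (card ` {J. J \<subseteq> X \<and> indep J})"

definition simple_matroid :: "'a set \<Rightarrow> ('a set \<Rightarrow> bool) \<Rightarrow> bool" where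
  "simple_matroid E indep \<longleftrightarrow>
     matroid E indep \<and> (\<forall>x\<in>E. indep {x}) \<and> (\<forall>x\<in>E. \<forall>y\<in>E. x \<noteq> y \<longrightarrow> indep {x, y})"

definition flat :: "'a set \<Rightarrow> ('a set \<Rightarrow> bool) \<Rightarrow> 'a set \<Rightarrow> bool" where
  "flat E indep F \<longleftrightarrow>
     F \<subseteq> E \<and> (\<forall>e\<in>E - F. matroid_rank indep F < matroid_rank indep (insert e F))"

definition matroid_line :: "'a set \<Rightarrow> ('a set \<Rightarrow> bool) \<Rightarrow> 'a set \<Rightarrow> bool" where
  "matroid_line E indep F \<longleftrightarrow> flat E indep F \<and> matroid_rank indep F = 2"

definition configuration_16_4 :: "'a set \<Rightarrow> ('a set \<Rightarrow> bool) \<Rightarrow> bool" where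
  "configuration_16_4 E indep \<longleftrightarrow>
     simple_matroid E indep \<and>
     matroid_rank indep E = 3 \<and>
     card E = 16 \<and>
     (\<forall>F. matroid_line E indep F \<longrightarrow> card F \<le> 4) \<and>
     (\<forall>x\<in>E. card {F. matroid_line E indep F \<and> x \<in> F \<and> card F = 4} = 4)"


section \<open>The real projective plane\<close>

text \<open>Points are the lines through the origin of \<open>\<real>\<^sup>3\<close>; the topology is the quotient
  topology from the punctured space, see \<open>quotient_map_proj\<close> below.\<close>

typedef rp2 = "{span {v} |v :: real^3. v \<noteq> 0}"
proof -
  have "axis 1 1 \<noteq> (0 :: real^3)" by (simp add: axis_eq_0_iff)
  then show ?thesis by blast
qed

definition proj :: "real^3 \<Rightarrow> rp2" where
  "proj v = Abs_rp2 (span {v})"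

instantiation rp2 :: topological_space
begin

definition open_rp2 :: "rp2 set \<Rightarrow> bool" where
  "open_rp2 U \<longleftrightarrow> open {v. v \<noteq> 0 \<and> proj v \<in> U}"

instance
proof
  have "{v :: real^3. v \<noteq> 0} = - {0}" by auto
  then show "open (UNIV :: rp2 set)"
    unfolding open_rp2_def by (simp add: open_Compl)
next
  fix S T :: "rp2 set"
  assume "open S" "open T"
  moreover have "{v. v \<noteq> 0 \<and> proj v \<in> S \<inter> T} =
      {v. v \<noteq> 0 \<and> proj v \<in> S} \<inter> {v. v \<noteq> 0 \<and> proj v \<in> T}" by auto
  ultimately show "open (S \<inter> T)"
    unfolding open_rp2_def by (simp add: open_Int)
next
  fix K :: "rp2 set set"
  assume "\<forall>S\<in>K. open S"
  moreover have "{v. v \<noteq> 0 \<and> proj v \<in> \<Union>K} = (\<Union>S\<in>K. {v. v \<noteq> 0 \<and> proj v \<in> S})" by auto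
  ultimately show "open (\<Union>K)"
    unfolding open_rp2_def by auto
qed

end

lemma proj_eq_iff:
  assumes "v \<noteq> 0" "w \<noteq> 0"
  shows "proj v = proj w \<longleftrightarrow> (\<exists>c. c \<noteq> 0 \<and> w = c *\<^sub>R v)"
proof -
  have "span {u} \<in> {span {v} |v :: real^3. v \<noteq> 0}" if "u \<noteq> 0" for u :: "real^3"
    using that by blast
  then have "proj v = proj w \<longleftrightarrow> span {v} = span {w}"
    unfolding proj_def using assms by (intro Abs_rp2_inject)
  also have "\<dots> \<longleftrightarrow> (\<exists>c. c \<noteq> 0 \<and> w = c *\<^sub>R v)"
  proof
    assume "span {v} = span {w}"
    then have "w \<in> span {v}" using span_base[of w "{w}"] by blast
    then obtain c where "w = c *\<^sub>R v" unfolding span_singleton by blast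
    with assms show "\<exists>c. c \<noteq> 0 \<and> w = c *\<^sub>R v" by (intro exI[of _ c]) auto
  next
    assume "\<exists>c. c \<noteq> 0 \<and> w = c *\<^sub>R v"
    then obtain c where c: "c \<noteq> 0" "w = c *\<^sub>R v" by blast
    then have "v = inverse c *\<^sub>R w" by simp
    with c have "w \<in> span {v}" "v \<in> span {w}"
      unfolding span_singleton by blast+
    then show "span {v} = span {w}"
      by (intro subset_antisym span_minimal subspace_span) simp_all
  qed
  finally show ?thesis .
qed

lemma quotient_map_proj: "quotient_map (top_of_set (- {0})) euclidean proj"
proof -
  have "p \<in> proj ` (- {0})" for p
  proof (cases p)
    case (Abs_rp2 y)
    then obtain v :: "real^3" where "v \<noteq> 0" "y = span {v}" by blast
    with Abs_rp2(1) have "p = proj v" by (simp only: proj_def)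
    with \<open>v \<noteq> 0\<close> show ?thesis by (intro image_eqI[of _ _ v]) auto
  qed
  then have surj: "proj ` (- {0}) = UNIV" by (intro UNIV_eq_I[symmetric])
  have "openin (top_of_set (- {0})) {v \<in> - {0}. proj v \<in> U} \<longleftrightarrow> open U" for U
  proof -
    have eq: "{v \<in> - {0}. proj v \<in> U} = {v. v \<noteq> 0 \<and> proj v \<in> U}"
      by (intro Collect_cong) simp
    have "open (- {0 :: real^3})"
      by (intro open_Compl closed_singleton)
    moreover have "{v. v \<noteq> 0 \<and> proj v \<in> U} \<subseteq> - {0}"
      by (intro subsetI) simp
    ultimately show ?thesis
      by (simp only: eq open_rp2_def openin_open_eq simp_thms)
  qed
  with surj show ?thesis
    by (simp only: quotient_map_def topspace_euclidean_subtopology topspace_euclidean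
        open_openin[symmetric] simp_thms)
qed


section \<open>Arrangements of pseudolines\<close>

definition pseudoline :: "rp2 set \<Rightarrow> bool" where
  "pseudoline L \<longleftrightarrow>
     (\<exists>g. simple_path g \<and> pathfinish g = pathstart g \<and> path_image g = L \<and>
          \<not> (\<exists>a. homotopic_loops UNIV g (\<lambda>_. a)))"

text \<open>Curves are only assumed continuous, so transversality is topological: near the point,
  the two curves look like the two coordinate axes of the plane at the origin.\<close>

definition cross_at :: "rp2 \<Rightarrow> rp2 set \<Rightarrow> rp2 set \<Rightarrow> bool" where
  "cross_at p A B \<longleftrightarrow>
     (\<exists>U f g. open U \<and> p \<in> U \<and> homeomorphism U (UNIV :: (real \<times> real) set) f g \<and>
        f p = (0, 0) \<and>
        f ` (A \<inter> U) = {z. snd z = 0} \<and>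
        f ` (B \<inter> U) = {z. fst z = 0})"

definition pseudoline_arrangement :: "'a set \<Rightarrow> ('a \<Rightarrow> rp2 set) \<Rightarrow> bool" where
  "pseudoline_arrangement E L \<longleftrightarrow>
     finite E \<and>
     (\<forall>e\<in>E. pseudoline (L e)) \<and>
     (\<forall>e\<in>E. \<forall>f\<in>E. e \<noteq> f \<longrightarrow> (\<exists>p. L e \<inter> L f = {p} \<and> cross_at p (L e) (L f)))"

definition pl_realizable :: "'a set \<Rightarrow> ('a set \<Rightarrow> bool) \<Rightarrow> bool" where
  "pl_realizable E indep \<longleftrightarrow>
     (\<exists>L. pseudoline_arrangement E L \<and>
          (\<forall>S\<subseteq>E. (\<exists>p. \<forall>e\<in>S. p \<in> L e) \<longleftrightarrow> matroid_rank indep S \<le> 2))"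

end

theory Submission
  imports Defs
begin

text \<open>Every pseudoline lifts to a closed curve on the sphere that is invariant under the antipodal map.  By a winding
  argument no component of the complement of such a curve meets its antipode, so there is an odd sign function that is
  constant on these components.  Two lifted curves meet in an antipodal pair of points, which cuts either of them into
  two arcs with opposite signs; these signs alone carry the whole proof.

  A cell is recorded by its sign vector.  Adding the curves one at a time creates at least as many new cells as there
  are points on the new curve, which gives the Euler inequality \<open>F \<ge> 2 + E - V\<close>; the cyclic order of the lines
  around a vertex is read off from any line that avoids it.

  With sixteen curves of four fourfold points each, few cells can fail to be triangles.  A wall joining two double points
  cannot have triangles on both sides, and in a quadrilateral at most two such walls have a triangle behind them.
  Counting the corners at double points then excludes triple points.  Without triple points every
  line carries four fourfold and three double points, hence at least two fourfold points whose two neighbours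
  on the line have different multiplicity.  Around a fourfold point, whose eight neighbours would alternate
  between double and fourfold points if all cells were triangles with one double corner, this forces exceptional
  cells, and there are not enough of them.\<close>

section \<open>Lifting pseudolines to the sphere\<close>

text \<open>Continuous curves give no control over the shape of the regions they cut out, so no
  region is ever used. What survives the lift is the number \<open>\<tau> e f\<close>, the place on
  the circle \<open>e\<close> where the positive side of \<open>f\<close> begins, together with the
  fact that the sign of \<open>f\<close> at a common point of two circles can be read along either.
  Only a lower bound for the number of cells is proved; it suffices because that number enters every
  later estimate with the favourable sign. The decisive conflict is one of parity. In an alternating
  cycle of eight rays opposite rays have the same type, whereas four fourfold and three double
  points cannot alternate around a closed line of seven. All counts are made on the sphere and
  double the projective ones: once triple points are gone there are 48 double and 32 fourfold
  vertices, 448 pairs of a cell and a wall, and at least 146 cells, so the numbers of walls exceed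
  three by at most 10 in total. The constants of the two discharging inequalities are chosen to be
  tight at the extremal cells; the final comparison is 128 against 120.\<close>

lemma odd_curve_separates_antipodes:
  fixes c :: "real \<Rightarrow> real^3" and x :: "real^3"
  assumes cont: "continuous_on {0..2} c" and odd: "\<And>t. c (t + 1) = - c t"
    and sph: "range c \<subseteq> sphere 0 1" and img: "range c = c ` {0..2}"
    and x: "norm x = 1"
  shows "\<not> connected_component (sphere 0 1 - range c) x (- x)"
proof
  assume conn: "connected_component (sphere 0 1 - range c) x (- x)"
  define S where "S = sphere (0::real^3) 1 - range c"
  have cpt: "compact (range c)"
    unfolding img by (intro compact_continuous_image cont) auto
  have xS: "x \<in> S" "- x \<in> S"
    using conn connected_component_in unfolding S_def by blast+
  have "openin (top_of_set (sphere 0 1)) S"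
    unfolding S_def Diff_eq by (intro openin_open_Int open_Compl compact_imp_closed cpt)
  moreover have "locally path_connected (sphere (0::real^3) 1)"
    by (simp add: locally_path_connected_sphere)
  ultimately have lpc: "locally path_connected S"
    by (rule locally_open_subset[rotated])
  have "path_component S x (- x)"
    using conn path_component_eq_connected_component[OF lpc] unfolding S_def by metis
  then obtain \<gamma>0 where \<gamma>0: "path \<gamma>0" "path_image \<gamma>0 \<subseteq> S" "pathstart \<gamma>0 = x" "pathfinish \<gamma>0 = - x"
    unfolding path_component_def by blast
  have xx: "x \<bullet> x = 1" using x by (simp add: norm_eq_1)
  have "x \<noteq> - x"
  proof
    assume "x = - x"
    then have "x \<bullet> x = - (x \<bullet> x)" by (metis inner_minus_left)
    with xx show False by simp
  qed
  \<comment> \<open>An arc, being injective, is at \<open>x\<close> only at time 0, so the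
    projection from \<open>x\<close> below is defined on the rest of it.\<close>
  from path_contains_arc[OF \<gamma>0(1,3,4) this] obtain \<gamma> where
    "arc \<gamma>" "path_image \<gamma> \<subseteq> path_image \<gamma>0" "pathstart \<gamma> = x" "pathfinish \<gamma> = - x" .
  with \<gamma>0(2) have \<gamma>: "arc \<gamma>" "path_image \<gamma> \<subseteq> S" "pathstart \<gamma> = x" "pathfinish \<gamma> = - x"
    by auto
  obtain a where a: "a \<noteq> 0" "a \<bullet> x = 0"
    using orthogonal_to_vector_exists[of x] by (auto simp: orthogonal_def inner_commute)
  define p where "p = sgn a"
  define q where "q = cross3 x p"
  have pp: "p \<bullet> p = 1" "p \<bullet> x = 0"
    using a by (auto simp: p_def sgn_div_norm power2_norm_eq_inner[symmetric] power2_eq_square)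
  have par: "(y \<bullet> p)\<^sup>2 + (y \<bullet> q)\<^sup>2 + (y \<bullet> x)\<^sup>2 = y \<bullet> y" for y
  proof -
    have "(norm q)\<^sup>2 = 1"
      using norm_cross[of x p] pp xx by (simp add: q_def power2_norm_eq_inner inner_commute)
    then have "(norm (cross3 y q))\<^sup>2 = y \<bullet> y - (y \<bullet> q)\<^sup>2"
      using norm_cross[of y q] by (simp add: power2_norm_eq_inner)
    moreover have "cross3 y q = (y \<bullet> p) *\<^sub>R x - (y \<bullet> x) *\<^sub>R p"
      unfolding q_def by (rule Lagrange)
    moreover have "(norm ((y \<bullet> p) *\<^sub>R x - (y \<bullet> x) *\<^sub>R p))\<^sup>2 = (y \<bullet> p)\<^sup>2 + (y \<bullet> x)\<^sup>2"
      unfolding power2_norm_eq_inner using pp xx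
      by (simp add: inner_diff inner_commute[of x p] power2_eq_square)
    ultimately show ?thesis by simp
  qed
  define P where "P y = Complex (y \<bullet> p) (y \<bullet> q)" for y
  have contP: "continuous_on A P" for A unfolding P_def Complex_eq by (intro continuous_intros)
  have Pneg: "P (- y) = - P y" for y by (simp add: P_def complex_eq_iff)
  have normP: "(norm (P y))\<^sup>2 = y \<bullet> y - (y \<bullet> x)\<^sup>2" for y
    using par[of y] by (simp add: P_def cmod_power2)
  \<comment> \<open>Stereographic projection from \<open>x\<close> to the plane spanned by
    \<open>p\<close> and \<open>q\<close>: \<open>- x\<close> goes to 0 and \<open>x\<close> to
    infinity. The arc then joins 0 to infinity outside the projected curve \<open>K\<close>, so
    \<open>K\<close> does not wind around 0, while oddness forces it to wind.\<close>
  define h where "h y = P y / of_real (1 - y \<bullet> x)" for y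
  have nz: "1 - y \<bullet> x > 0" if "norm y = 1" "y \<noteq> x" for y
  proof -
    have "y \<bullet> x \<le> 1" using norm_cauchy_schwarz[of y x] that x by simp
    moreover have "y \<bullet> x \<noteq> 1" using norm_cauchy_schwarz_eq[of y x] that x by simp
    ultimately show ?thesis by simp
  qed
  have normh: "(norm (h y))\<^sup>2 * (1 - y \<bullet> x) = 1 + y \<bullet> x" if "norm y = 1" "y \<noteq> x" for y
  proof -
    have "y \<bullet> y = 1" using that by (simp add: norm_eq_1)
    moreover have "norm (h y) = norm (P y) / (1 - y \<bullet> x)"
      unfolding h_def norm_divide norm_of_real using nz[OF that] by simp
    ultimately have "(norm (h y))\<^sup>2 = (1 - (y \<bullet> x)\<^sup>2) / (1 - y \<bullet> x)\<^sup>2"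
      using normP[of y] by (simp add: power_divide)
    also have "1 - (y \<bullet> x)\<^sup>2 = (1 + y \<bullet> x) * (1 - y \<bullet> x)" by (simp add: power2_eq_square algebra_simps)
    finally show ?thesis using nz[OF that] by (simp add: power2_eq_square)
  qed
  have injh: "y = z" if "norm y = 1" "y \<noteq> x" "norm z = 1" "z \<noteq> x" "h y = h z" for y z
  proof -
    have "(1 + y \<bullet> x) * (1 - z \<bullet> x) = (1 + z \<bullet> x) * (1 - y \<bullet> x)"
      using normh[OF that(1,2)] normh[OF that(3,4)] that(5) by (metis mult.assoc mult.commute)
    then have yz: "y \<bullet> x = z \<bullet> x" by (simp add: algebra_simps)
    then have "P y = P z" using that nz[OF that(3,4)] by (auto simp: h_def complex_eq_iff)
    then have "(y - z) \<bullet> p = 0" "(y - z) \<bullet> q = 0" "(y - z) \<bullet> x = 0"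
      using yz by (auto simp: P_def inner_diff_left)
    then have "(y - z) \<bullet> (y - z) = 0" using par[of "y - z"] by simp
    then show ?thesis by simp
  qed
  have conth: "continuous_on A h" if A: "A \<subseteq> sphere 0 1 - {x}" for A
    unfolding h_def
  proof (intro continuous_on_divide contP continuous_on_of_real continuous_intros ballI)
    fix y assume "y \<in> A"
    then have "1 - y \<bullet> x > 0" using A by (intro nz) auto
    then show "complex_of_real (1 - y \<bullet> x) \<noteq> 0" unfolding of_real_eq_0_iff by simp
  qed
  define K where "K = h ` range c"
  have x_nin: "x \<notin> range c" "- x \<notin> range c" using xS by (auto simp: S_def)
  have ct: "norm (c t) = 1" "c t \<noteq> x" "c t \<noteq> - x" for t
    using subsetD[OF sph rangeI[of c t]] x_nin rangeI[of c t] by (simp, metis, metis)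
  have csub: "range c \<subseteq> sphere 0 1 - {x}" using ct by auto
  have cK: "compact K" unfolding K_def by (intro compact_continuous_image conth csub cpt)
  have hne: "h y \<noteq> 0" if "norm y = 1" "y \<noteq> x" "y \<noteq> - x" for y
  proof
    assume "h y = 0"
    then have "1 + y \<bullet> x = 0" using normh[OF that(1,2)] by simp
    then have "y \<bullet> (- x) = norm y * norm (- x)" using that x by simp
    then show False using norm_cauchy_schwarz_eq[of y "- x"] that x by simp
  qed
  have K0: "0 \<notin> K"
  proof
    assume "0 \<in> K"
    then obtain t where "h (c t) = 0" unfolding K_def by auto
    with hne[OF ct] show False by blast
  qed
  have h0: "h (- x) = 0" unfolding h_def P_def using pp xx
    by (simp add: complex_eq_iff q_def inner_commute dot_cross_self)
  have \<gamma>S: "\<gamma> t \<in> S" if "t \<in> {0..1}" for t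
    using \<gamma>(2) that unfolding path_image_def by blast
  have \<gamma>n: "norm (\<gamma> t) = 1" "\<gamma> t \<notin> range c" if "t \<in> {0..1}" for t
    using \<gamma>S[OF that] unfolding S_def by simp_all
  have \<gamma>x: "\<gamma> t \<noteq> x" if t: "t \<in> {0<..1}" for t
  proof
    assume "\<gamma> t = x"
    then have "\<gamma> t = \<gamma> 0" using \<gamma>(3) by (simp add: pathstart_def)
    moreover have "inj_on \<gamma> {0..1}" using \<gamma>(1) by (simp add: arc_def)
    ultimately show False using t by (auto dest: inj_onD[of _ _ t 0])
  qed
  have c\<gamma>: "continuous_on {0..1} \<gamma>" using \<gamma>(1) by (simp add: arc_def path_def)
  have "\<gamma> ` {0<..1} \<subseteq> sphere 0 1 - {x}"
  proof (rule image_subsetI)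
    fix t :: real assume "t \<in> {0<..1}"
    then show "\<gamma> t \<in> sphere 0 1 - {x}" using \<gamma>n(1)[of t] \<gamma>x[of t] by simp
  qed
  then have "connected (h ` \<gamma> ` {0<..1})"
    by (intro connected_continuous_image conth continuous_on_subset[OF c\<gamma>]) auto
  moreover have "0 \<in> h ` \<gamma> ` {0<..1}"
  proof -
    have "h (\<gamma> 1) = 0" using \<gamma>(4) h0 by (simp add: pathfinish_def)
    moreover have "h (\<gamma> 1) \<in> h ` \<gamma> ` {0<..1}" by (intro imageI) simp
    ultimately show ?thesis by simp
  qed
  moreover have "h ` \<gamma> ` {0<..1} \<subseteq> - K"
  proof -
    have "h (\<gamma> t) \<noteq> h (c s)" if "t \<in> {0<..1}" for s t
      using injh[of "\<gamma> t" "c s"] \<gamma>n[of t] \<gamma>x[of t] ct[of s] that by auto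
    then show ?thesis unfolding K_def by (simp add: image_image image_subset_iff image_iff)
  qed
  ultimately have sub: "h ` \<gamma> ` {0<..1} \<subseteq> connected_component_set (- K) 0"
    by (intro connected_component_maximal)
  have "\<not> bounded (connected_component_set (- K) 0)"
  proof
    assume "bounded (connected_component_set (- K) 0)"
    then have "bounded (h ` \<gamma> ` {0<..1})" using sub bounded_subset by blast
    then obtain B where "\<forall>z \<in> h ` \<gamma> ` {0<..1}. norm z \<le> B"
      unfolding bounded_iff by blast
    then have B: "norm (h (\<gamma> t)) \<le> B" if "t \<in> {0<..1}" for t
      using that by blast
    \<comment> \<open>The bound \<open>B\<close> on \<open>h\<close>, cleared of denominators by
      \<open>normh\<close>. At time 0 the arc is at \<open>x\<close>, where \<open>u\<close> equals
      2.\<close>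
    define u where "u t = (1 + \<gamma> t \<bullet> x) - B\<^sup>2 * (1 - \<gamma> t \<bullet> x)" for t
    have "u t \<le> 0" if t: "t \<in> {0<..<1}" for t
    proof -
      have t': "norm (\<gamma> t) = 1" "\<gamma> t \<noteq> x" using \<gamma>n \<gamma>x t by auto
      have "(norm (h (\<gamma> t)))\<^sup>2 \<le> B\<^sup>2" using B[of t] t by (intro power_mono) auto
      then have "(norm (h (\<gamma> t)))\<^sup>2 * (1 - \<gamma> t \<bullet> x) \<le> B\<^sup>2 * (1 - \<gamma> t \<bullet> x)"
        using nz[OF t'] by (intro mult_right_mono) auto
      then show ?thesis using normh[OF t'] by (simp add: u_def)
    qed
    moreover have "continuous_on (closure {0<..<1}) u"
      unfolding u_def by (intro continuous_intros) (simp_all add: c\<gamma>)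
    ultimately have "u 0 \<le> 0"
      by (intro continuous_le_on_closure[of "{0<..<1}" u 0 0]) auto
    moreover have "\<gamma> 0 = x" using \<gamma>(3) by (simp add: pathstart_def)
    ultimately show False by (simp add: u_def xx)
  qed
  \<comment> \<open>Since 0 lies in the unbounded component, the radial projection of
    \<open>K\<close> to the unit circle is inessential and hence has a continuous logarithm.\<close>
  then obtain a where "homotopic_with_canon (\<lambda>x. True) K (sphere 0 1) (\<lambda>z. inverse (norm (z - 0)) *\<^sub>R (z - 0)) (\<lambda>x. a)"
    using Borsuk_map_essential_bounded_component[OF cK K0] by blast
  then have "homotopic_with_canon (\<lambda>x. True) K (- {0}) (\<lambda>z. inverse (norm (z - 0)) *\<^sub>R (z - 0)) (\<lambda>x. a)"
    by (rule homotopic_with_subset_right) auto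
  then obtain g where g: "continuous_on K g" "\<And>z. z \<in> K \<Longrightarrow> inverse (norm z) *\<^sub>R z = exp (g z)"
    using inessential_eq_continuous_logarithm[of K] by (metis (no_types, lifting) diff_zero)
  define \<phi> where "\<phi> t = g (h (c t))" for t
  have hK: "h (c t) \<in> K" for t by (simp add: K_def)
  have c\<phi>: "continuous_on {0..2} \<phi>"
    unfolding \<phi>_def
    by (intro continuous_on_compose2[OF g(1)] continuous_on_compose2[OF conth[OF csub] cont] image_subsetI hK rangeI)
  have c0: "1 - c t \<bullet> x > 0" for t using nz[OF ct(1,2)] .
  \<comment> \<open>The positive denominator of \<open>h\<close> cancels on normalizing and leaves
    the linear map \<open>P\<close>. This is why \<open>exp (\<phi> t)\<close> changes sign from
    \<open>t\<close> to \<open>t + 1\<close> although \<open>h\<close> itself is not odd.\<close>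
  have exp\<phi>: "exp (\<phi> t) = inverse (norm (P (c t))) *\<^sub>R P (c t)" for t
  proof -
    define b where "b = 1 - c t \<bullet> x"
    have "b > 0" unfolding b_def by (rule c0)
    moreover have "h (c t) = inverse b *\<^sub>R P (c t)"
      by (simp add: h_def b_def scaleR_conv_of_real divide_inverse mult.commute)
    ultimately have "inverse (norm (h (c t))) *\<^sub>R h (c t) = inverse (norm (P (c t))) *\<^sub>R P (c t)"
      by simp
    then show ?thesis
      using g(2)[OF hK[of t]] by (simp only: \<phi>_def)
  qed
  have Pne: "P (c t) \<noteq> 0" for t
    using hK[of t] K0 by (auto simp: h_def)
  have exp_odd: "exp (\<phi> (t + 1) - \<phi> t) = -1" for t
  proof -
    have "exp (\<phi> (t + 1)) = - exp (\<phi> t)" by (simp add: exp\<phi> odd Pneg)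
    then show ?thesis by (simp add: exp_diff)
  qed
  have c2: "c 2 = c 0" using odd[of 0] odd[of 1] by simp
  \<comment> \<open>The increment of the angle over a half turn must be an odd multiple of pi, but
    its values at 0 and 1 are opposite because \<open>c 2 = c 0\<close>, so by continuity it
    vanishes somewhere.\<close>
  define r where "r t = Im (\<phi> (t + 1) - \<phi> t)" for t
  have "continuous_on {0..1} r"
    unfolding r_def by (intro continuous_intros continuous_on_compose2[OF c\<phi>]) auto
  have "r 1 = - r 0" using c2 by (simp add: r_def \<phi>_def)
  have "\<exists>t. r t = 0"
  proof (cases "r 0 \<le> 0")
    case True
    with \<open>continuous_on {0..1} r\<close> \<open>r 1 = - r 0\<close> show ?thesis using IVT'[of r 0 0 1] by force
  next
    case False
    with \<open>continuous_on {0..1} r\<close> \<open>r 1 = - r 0\<close> show ?thesis using IVT2'[of r 1 0 0] by force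
  qed
  then obtain t where "r t = 0" by blast
  then have "exp (\<phi> (t + 1) - \<phi> t) = of_real (exp (Re (\<phi> (t + 1) - \<phi> t)))"
    by (simp add: r_def exp_eq_polar)
  then have "complex_of_real (exp (Re (\<phi> (t + 1) - \<phi> t))) = complex_of_real (-1)"
    using exp_odd by simp
  then have "exp (Re (\<phi> (t + 1) - \<phi> t)) = -1" by (simp only: of_real_eq_iff)
  moreover have "exp (Re (\<phi> (t + 1) - \<phi> t)) > 0" by (rule exp_gt_zero)
  ultimately show False by linarith
qed

section \<open>The double cover of the projective plane\<close>

text \<open>The lifting theorems for covering spaces require a normed codomain, so the projective plane is
  replaced by its image under the Veronese embedding.\<close>

definition veronese :: "real^3 \<Rightarrow> real^3^3" where
  "veronese v = (\<chi> i j. v $ i * v $ j)"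

text \<open>For a unit vector the matrix is the orthogonal projection onto the line that it spans.
  Applying it to a vector not orthogonal to that line recovers the line, which is how the map is
  inverted below.\<close>

lemma veronese_mult: "veronese v *v w = (v \<bullet> w) *\<^sub>R v"
  by (simp add: veronese_def vec_eq_iff matrix_vector_mult_def inner_vec_def sum_distrib_left sum_distrib_right mult_ac)

lemma veronese_uminus [simp]: "veronese (- v) = veronese v"
  by (simp add: veronese_def)

lemma veronese_eq_iff:
  assumes "norm v = 1" "norm w = 1"
  shows "veronese v = veronese w \<longleftrightarrow> w = v \<or> w = - v"
proof
  assume "veronese v = veronese w"
  then have "(v \<bullet> v) *\<^sub>R v = (w \<bullet> v) *\<^sub>R w" by (metis veronese_mult)
  then have *: "v = (w \<bullet> v) *\<^sub>R w" using assms by (simp add: norm_eq_1)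
  then have "norm v = \<bar>w \<bullet> v\<bar> * norm w" by (metis norm_scaleR)
  then have "\<bar>w \<bullet> v\<bar> = \<bar>1\<bar>" using assms by simp
  then have "w \<bullet> v = 1 \<or> w \<bullet> v = -1" by (simp only: abs_eq_iff)
  with * show "w = v \<or> w = - v" by (metis add.inverse_inverse scaleR_minus_left scaleR_one)
qed auto

lemma continuous_on_veronese: "continuous_on A veronese"
  unfolding veronese_def by (intro continuous_intros)

text \<open>A neighbourhood of \<open>veronese a\<close> is evenly covered by the open hemispheres
  around \<open>a\<close> and \<open>- a\<close>. The inverse on a sheet sends a matrix
  \<open>M\<close> to the normalized vector \<open>M *v a\<close>, with the sign of the
  sheet.\<close>

lemma covering_space_veronese:
  "covering_space (sphere 0 1) veronese (veronese ` sphere 0 1)"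
  unfolding covering_space_def
proof (intro conjI ballI continuous_on_veronese refl)
  fix x assume "x \<in> veronese ` sphere 0 1"
  then obtain a where a: "norm a = 1" "x = veronese a" by auto
  define U where "U s = {v \<in> sphere 0 1. s * (v \<bullet> a) > 0}" for s :: real
  define T where "T = veronese ` {v \<in> sphere 0 1. v \<bullet> a \<noteq> 0}"
  have aa: "a \<bullet> a = 1" using a by (simp add: norm_eq_1)
  have "compact {v \<in> sphere 0 1. v \<bullet> a = 0}"
    using compact_Int_closed[OF compact_sphere[of "0::real^3" 1] closed_hyperplane[of a 0]]
    by (simp add: Int_def inner_commute)
  then have cl: "closed (veronese ` {v \<in> sphere 0 1. v \<bullet> a = 0})"
    by (intro compact_imp_closed compact_continuous_image continuous_on_veronese)
  have mem: "veronese v \<in> veronese ` {v \<in> sphere 0 1. P v} \<longleftrightarrow> P v"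
    if "norm v = 1" "P (- v) \<longleftrightarrow> P v" for v P
  proof
    assume "veronese v \<in> veronese ` {v \<in> sphere 0 1. P v}"
    then obtain w where "norm w = 1" "P w" "veronese v = veronese w" by auto
    then show "P v" using veronese_eq_iff[of v w] that by auto
  next
    assume "P v"
    with that show "veronese v \<in> veronese ` {v \<in> sphere 0 1. P v}" by (intro imageI) simp
  qed
  have memT: "veronese v \<in> T \<longleftrightarrow> v \<bullet> a \<noteq> 0" if "norm v = 1" for v
    unfolding T_def using mem[OF that, of "\<lambda>v. v \<bullet> a \<noteq> 0"] by simp
  have memK: "veronese v \<in> veronese ` {v \<in> sphere 0 1. v \<bullet> a = 0} \<longleftrightarrow> v \<bullet> a = 0" if "norm v = 1" for v
    using mem[OF that, of "\<lambda>v. v \<bullet> a = 0"] by simp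
  have Tsub: "T \<subseteq> veronese ` sphere 0 1" unfolding T_def by auto
  have "T = veronese ` sphere 0 1 \<inter> - veronese ` {v \<in> sphere 0 1. v \<bullet> a = 0}"
  proof (intro equalityI subsetI IntI ComplI)
    fix M assume M: "M \<in> T"
    then show MS: "M \<in> veronese ` sphere 0 1" using Tsub by blast
    assume "M \<in> veronese ` {v \<in> sphere 0 1. v \<bullet> a = 0}"
    then obtain v where v: "norm v = 1" "v \<bullet> a = 0" "M = veronese v" by auto
    then show False using M memT[OF v(1)] by simp
  next
    fix M assume M: "M \<in> veronese ` sphere 0 1 \<inter> - veronese ` {v \<in> sphere 0 1. v \<bullet> a = 0}"
    then obtain v where v: "norm v = 1" "M = veronese v" by auto
    then show "M \<in> T" using M memT[OF v(1)] memK[OF v(1)] by simp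
  qed
  then have oT: "openin (top_of_set (veronese ` sphere 0 1)) T"
    using cl by (simp only:) (intro openin_open_Int open_Compl)
  have oU: "openin (top_of_set (sphere 0 1)) (U s)" for s
  proof -
    have "U s = sphere 0 1 \<inter> {v. s * (v \<bullet> a) > 0}" unfolding U_def by auto
    moreover have "open {v. s * (v \<bullet> a) > 0}" by (intro open_Collect_less continuous_intros)
    ultimately show ?thesis by (simp add: openin_open_Int)
  qed
  have hom: "\<exists>q. homeomorphism (U s) T veronese q" if s: "s = 1 \<or> s = -1" for s :: real
  proof -
    define q where "q M = (s / norm (M *v a)) *\<^sub>R (M *v a)" for M :: "real^3^3"
    have qv: "q (veronese v) = (s * sgn (v \<bullet> a)) *\<^sub>R v" if "norm v = 1" for v
      using that by (simp add: q_def veronese_mult sgn_real_def)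
    have qv': "q (veronese v) = v \<or> q (veronese v) = - v" if "norm v = 1" "v \<bullet> a \<noteq> 0" for v
      using s that by (auto simp: qv sgn_real_def)
    have TE: "\<exists>v. norm v = 1 \<and> v \<bullet> a \<noteq> 0 \<and> M = veronese v" if "M \<in> T" for M
      using that unfolding T_def by auto
    have cm: "continuous_on A (\<lambda>M :: real^3^3. M *v a)" for A
      unfolding matrix_vector_mult_def by (intro continuous_intros)
    have "homeomorphism (U s) T veronese q"
    proof (rule homeomorphismI)
      show "continuous_on (U s) veronese" by (rule continuous_on_veronese)
      have "M *v a \<noteq> 0" if "M \<in> T" for M
        using TE[OF that] by (auto simp: veronese_mult)
      then show "continuous_on T q"
        unfolding q_def by (intro continuous_intros cm) simp
      show "veronese ` U s \<subseteq> T"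
      proof (rule image_subsetI)
        fix v assume "v \<in> U s"
        then have "norm v = 1" "v \<bullet> a \<noteq> 0" unfolding U_def by auto
        then show "veronese v \<in> T" using memT by blast
      qed
      have "q M \<in> U s" if "M \<in> T" for M
        using TE[OF that] s unfolding U_def by (auto simp: qv sgn_real_def)
      then show "q ` T \<subseteq> U s" by blast
      show "q (veronese v) = v" if "v \<in> U s" for v
        using that s unfolding U_def by (auto simp: qv sgn_real_def)
      show "veronese (q M) = M" if "M \<in> T" for M
      proof -
        from TE[OF that] obtain v where v: "norm v = 1" "v \<bullet> a \<noteq> 0" "M = veronese v" by blast
        from qv'[OF v(1,2)] show ?thesis unfolding v(3) by (elim disjE) simp_all
      qed
    qed
    then show ?thesis by blast
  qed
  show "\<exists>T. x \<in> T \<and> openin (top_of_set (veronese ` sphere 0 1)) T \<and>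
     (\<exists>v. \<Union>v = sphere 0 1 \<inter> veronese -` T \<and> (\<forall>u\<in>v. openin (top_of_set (sphere 0 1)) u) \<and>
        pairwise disjnt v \<and> (\<forall>u\<in>v. \<exists>q. homeomorphism u T veronese q))"
  proof (intro exI[of _ T] exI[of _ "{U 1, U (-1)}"] conjI)
    show "x \<in> T" unfolding T_def a(2) by (rule imageI) (use a aa in auto)
    show "openin (top_of_set (veronese ` sphere 0 1)) T" by (rule oT)
    show "\<Union> {U 1, U (- 1)} = sphere 0 1 \<inter> veronese -` T"
    proof (intro equalityI subsetI)
      fix v assume "v \<in> \<Union> {U 1, U (- 1)}"
      then have "norm v = 1" "v \<bullet> a \<noteq> 0" unfolding U_def by auto
      then show "v \<in> sphere 0 1 \<inter> veronese -` T" using memT[of v] by simp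
    next
      fix v assume "v \<in> sphere 0 1 \<inter> veronese -` T"
      then have "norm v = 1" "v \<bullet> a \<noteq> 0" using memT[of v] by auto
      then show "v \<in> \<Union> {U 1, U (- 1)}" unfolding U_def by auto
    qed
    show "\<forall>u\<in>{U 1, U (- 1)}. openin (top_of_set (sphere 0 1)) u" using oU by blast
    have "U 1 \<inter> U (- 1) = {}" unfolding U_def by auto
    then show "pairwise disjnt {U 1, U (- 1)}" by (simp add: pairwise_insert disjnt_def Int_commute)
    show "\<forall>u\<in>{U 1, U (- 1)}. \<exists>q. homeomorphism u T veronese q" using hom by blast
  qed
qed

lemma proj_eq_sphere_iff:
  assumes "norm v = 1" "norm w = 1"
  shows "proj v = proj w \<longleftrightarrow> w = v \<or> w = - v"
proof -
  have "v \<noteq> 0" "w \<noteq> 0" using assms by auto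
  then have "proj v = proj w \<longleftrightarrow> (\<exists>c. c \<noteq> 0 \<and> w = c *\<^sub>R v)" by (rule proj_eq_iff)
  also have "\<dots> \<longleftrightarrow> w = v \<or> w = - v"
  proof
    assume "\<exists>c. c \<noteq> 0 \<and> w = c *\<^sub>R v"
    then obtain c where c: "w = c *\<^sub>R v" by blast
    then have "norm w = \<bar>c\<bar> * norm v" by (metis norm_scaleR)
    then have "\<bar>c\<bar> = \<bar>1\<bar>" using assms by simp
    then have "c = 1 \<or> c = -1" by (simp only: abs_eq_iff)
    with c show "w = v \<or> w = - v" by auto
  qed (metis scaleR_minus_left scaleR_one zero_neq_neg_one zero_neq_one)
  finally show ?thesis .
qed

lemma proj_uminus: "norm v = 1 \<Longrightarrow> proj (- v) = proj v"
  using proj_eq_sphere_iff[of v "- v"] by simp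

lemma ex_unit_vector_proj: "\<exists>v. norm v = 1 \<and> proj v = p"
proof (cases p)
  case (Abs_rp2 y)
  then obtain v :: "real^3" where v: "v \<noteq> 0" "y = span {v}" by blast
  with Abs_rp2(1) have "p = proj v" by (simp only: proj_def)
  moreover have "proj v = proj (sgn v)"
    using v by (subst proj_eq_iff) (auto simp: sgn_div_norm intro!: exI[of _ "inverse (norm v)"])
  ultimately show ?thesis using v by (intro exI[of _ "sgn v"]) (simp add: norm_sgn)
qed

lemma continuous_on_proj: "A \<subseteq> - {0} \<Longrightarrow> continuous_on A proj"
  by (rule continuous_on_subset[of "- {0}"])
    (use quotient_imp_continuous_map[OF quotient_map_proj] in simp_all)

definition rp2_embed :: "rp2 \<Rightarrow> real^3^3" where
  "rp2_embed p = veronese (SOME v. norm v = 1 \<and> proj v = p)"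

lemma rp2_embed_proj: assumes "norm v = 1" shows "rp2_embed (proj v) = veronese v"
proof -
  define w where "w = (SOME w. norm w = 1 \<and> proj w = proj v)"
  have "norm w = 1 \<and> proj w = proj v" unfolding w_def by (rule someI_ex) (use assms in blast)
  then have "veronese w = veronese v" using assms veronese_eq_iff[of w v] proj_eq_sphere_iff[of w v] by simp
  then show ?thesis by (simp add: rp2_embed_def w_def)
qed

text \<open>Continuity on the quotient is tested on the punctured space, where the map becomes
  \<open>veronese\<close> after normalization.\<close>

lemma continuous_on_rp2_embed: "continuous_on UNIV rp2_embed"
proof (subst continuous_on_open_vimage[OF open_UNIV], intro allI impI)
  fix B :: "(real^3^3) set" assume "open B"
  have eq: "{v. v \<noteq> 0 \<and> proj v \<in> rp2_embed -` B} = (\<lambda>v. veronese (sgn v)) -` B \<inter> (- {0})"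
  proof -
    have "rp2_embed (proj v) = veronese (sgn v)" if "v \<noteq> 0" for v
    proof -
      have "proj v = proj (sgn v)"
        using that by (subst proj_eq_iff) (auto simp: sgn_div_norm intro!: exI[of _ "inverse (norm v)"])
      then show ?thesis using that by (simp add: rp2_embed_proj norm_sgn)
    qed
    then show ?thesis by auto
  qed
  have "continuous_on (- {0}) (\<lambda>v. veronese (sgn v))"
    unfolding sgn_div_norm by (rule continuous_on_compose2[OF continuous_on_veronese[of UNIV]]) (auto intro!: continuous_intros)
  then have "open ((\<lambda>v. veronese (sgn v)) -` B \<inter> (- {0}))"
    using \<open>open B\<close> continuous_on_open_vimage[OF open_Compl[OF closed_singleton[of "0 :: real^3"]], of "\<lambda>v. veronese (sgn v)"] by blast
  then show "open (rp2_embed -` B \<inter> UNIV)" unfolding open_rp2_def eq[symmetric] by simp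
qed

text \<open>If the lift closed up, it would contract on the simply connected sphere, and projecting
  the contraction would make the pseudoline null-homotopic. Hence it ends at the antipode, the only
  other unit vector over the starting point.\<close>

lemma pseudoline_lift:
  assumes "pseudoline L"
  obtains g h where "simple_path g" "path_image g = L" "path h" "h ` {0..1} \<subseteq> sphere 0 1"
    "\<And>t. t \<in> {0..1} \<Longrightarrow> proj (h t) = g t" "h 1 = - h 0"
proof -
  obtain g where g: "simple_path g" "pathfinish g = pathstart g" "path_image g = L"
     "\<not> (\<exists>a. homotopic_loops UNIV g (\<lambda>_. a))"
    using assms unfolding pseudoline_def by blast
  have pg: "path g" using g(1) by (simp add: simple_path_imp_path)
  have "path (rp2_embed \<circ> g)"
    using pg by (intro path_continuous_image continuous_on_subset[OF continuous_on_rp2_embed]) auto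
  moreover have "path_image (rp2_embed \<circ> g) \<subseteq> veronese ` sphere 0 1"
  proof -
    have "rp2_embed p \<in> veronese ` sphere 0 1" for p
      using ex_unit_vector_proj[of p] rp2_embed_proj by fastforce
    then show ?thesis unfolding path_image_def by auto
  qed
  ultimately obtain h where h: "path h" "path_image h \<subseteq> sphere 0 1"
    "\<And>t. t \<in> {0..1} \<Longrightarrow> veronese (h t) = (rp2_embed \<circ> g) t"
    using covering_space_lift_path[OF covering_space_veronese] by blast
  have h1: "norm (h t) = 1" if "t \<in> {0..1}" for t
    using h(2) that unfolding path_image_def by (simp add: image_subset_iff)
  have hp: "proj (h t) = g t" if t: "t \<in> {0..1}" for t
  proof -
    obtain w where w: "norm w = 1" "proj w = g t" using ex_unit_vector_proj by blast
    then have "veronese (h t) = veronese w" using h(3)[OF t] rp2_embed_proj[of w] by simp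
    then have "proj (h t) = proj w" using w h1[OF t] veronese_eq_iff[of "h t" w] proj_eq_sphere_iff[of "h t" w] by simp
    with w show ?thesis by simp
  qed
  have "proj (h 0) = proj (h 1)" using g(2) by (simp add: hp pathstart_def pathfinish_def)
  then have h01: "h 1 = h 0 \<or> h 1 = - h 0" using proj_eq_sphere_iff[of "h 0" "h 1"] h1 by simp
  have "h 1 \<noteq> h 0"
  proof
    assume "h 1 = h 0"
    moreover have "simply_connected (sphere (0::real^3) 1)" by (rule simply_connected_sphere) simp
    moreover define a where "a = h 0"
    ultimately have a: "homotopic_loops (sphere 0 1) h (linepath a a)"
      unfolding simply_connected_eq_contractible_loop_any using h h1[of 0]
      by (simp add: pathstart_def pathfinish_def)
    have "homotopic_loops UNIV (proj \<circ> h) (proj \<circ> linepath a a)"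
      using a by (intro homotopic_loops_continuous_image[OF a] continuous_on_proj) auto
    moreover have "proj \<circ> linepath a a = (\<lambda>_. proj a)" by (simp add: fun_eq_iff linepath_refl)
    moreover have "homotopic_loops UNIV g (proj \<circ> h)"
      using pg g(2) hp by (intro homotopic_loops_eq) auto
    ultimately show False using g(4) homotopic_loops_trans by metis
  qed
  with h01 have hm: "h 1 = - h 0" by simp
  have hs: "h ` {0..1} \<subseteq> sphere 0 1" using h(2) by (simp add: path_image_def)
  show ?thesis by (rule that[OF g(1) g(3) h(1) hs hp hm])
qed

section \<open>Odd parametrizations of period two\<close>

lemma odd_shift_int:
  fixes c :: "real \<Rightarrow> 'a::group_add"
  assumes "\<And>t. c (t + 1) = - c t"
  shows "c (t + of_int k) = (if even k then c t else - c t)"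
proof (induction k rule: int_induct[where k=0])
  case (step1 i)
  have "c (t + of_int (i + 1)) = c ((t + of_int i) + 1)" by (simp add: add.assoc)
  then show ?case using step1 assms by simp
next
  case (step2 i)
  have "t + of_int i = (t + of_int (i - 1)) + 1" by simp
  then have "c (t + of_int i) = c ((t + of_int (i - 1)) + 1)" by (rule arg_cong)
  then have "c (t + of_int i) = - c (t + of_int (i - 1))" by (simp only: assms)
  then have "c (t + of_int (i - 1)) = - c (t + of_int i)" by simp
  then show ?case using step2 by simp
qed simp

text \<open>The lift covers half of a closed curve and its antipodal copy the other half, so the
  parametrization is extended by oddness. Simplicity of the pseudoline fixes a parameter up to an
  integer, and an odd integer would lead to the antipode.\<close>

lemma pseudoline_parametrization:
  assumes "pseudoline L"
  obtains c :: "real \<Rightarrow> real^3" where "continuous_on {0..2} c" "\<And>t. c (t + 1) = - c t"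
    "\<And>s t. c s = c t \<Longrightarrow> \<exists>k::int. s = t + 2 * of_int k"
    "range c = {x. norm x = 1 \<and> proj x \<in> L}"
proof -
  obtain g h where gh: "simple_path g" "path_image g = L" "path h" "h ` {0..1} \<subseteq> sphere 0 1"
    "\<And>t. t \<in> {0..1} \<Longrightarrow> proj (h t) = g t" "h 1 = - h 0"
    using pseudoline_lift[OF assms] by metis
  have h1: "norm (h t) = 1" if "t \<in> {0..1}" for t using gh(4) that by (simp add: image_subset_iff)
  define c where "c t = (if even \<lfloor>t\<rfloor> then h (frac t) else - h (frac t))" for t
  have odd: "c (t + 1) = - c t" for t by (simp add: c_def frac_1_eq)
  have c01: "c t = h t" if "t \<in> {0..1}" for t
  proof (cases "t = 1")
    case True then show ?thesis using gh(6) by (simp add: c_def)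
  next
    case False
    then have "\<lfloor>t\<rfloor> = 0" using that by (intro floor_eq_iff[THEN iffD2]) auto
    then show ?thesis by (simp add: c_def frac_def)
  qed
  have c12: "c t = - h (t - 1)" if "t \<in> {1..2}" for t
    using c01[of "t - 1"] odd[of "t - 1"] that by simp
  have ch: "continuous_on {0..1} h" using gh(3) by (simp add: path_def)
  have "continuous_on ({0..1} \<union> {1..2}) c"
  proof (intro continuous_on_closed_Un closed_atLeastAtMost)
    show "continuous_on {0..1} c" by (rule continuous_on_eq[OF ch]) (simp add: c01)
    have "continuous_on {1..2} (\<lambda>t. - h (t - 1))"
      by (intro continuous_intros continuous_on_compose2[OF ch]) auto
    then show "continuous_on {1..2} c" by (rule continuous_on_eq) (simp add: c12)
  qed
  moreover have "{0..1} \<union> {1..2} = {0..2::real}" by auto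
  ultimately have cont: "continuous_on {0..2} c" by simp
  have fr: "frac t \<in> {0..1}" for t :: real using frac_lt_1[of t] by simp
  have nc: "norm (c t) = 1" for t using h1[OF fr] by (simp add: c_def)
  have pc: "proj (c t) = g (frac t)" for t
    using h1[OF fr] gh(5)[OF fr] by (simp add: c_def proj_uminus)
  have inj: "\<exists>k::int. s = t + 2 * of_int k" if st: "c s = c t" for s t
  proof -
    have "g (frac s) = g (frac t)" using st pc by metis
    then have "frac s = frac t"
      using gh(1) fr[of s] fr[of t] frac_lt_1[of s] frac_lt_1[of t] unfolding simple_path_def loop_free_def by fastforce
    then have s: "s = t + of_int (\<lfloor>s\<rfloor> - \<lfloor>t\<rfloor>)" by (simp add: frac_def)
    then have "c s = (if even (\<lfloor>s\<rfloor> - \<lfloor>t\<rfloor>) then c t else - c t)"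
      using odd_shift_int[of c t "\<lfloor>s\<rfloor> - \<lfloor>t\<rfloor>", OF odd] by simp
    moreover have "c t \<noteq> - c t"
    proof
      assume "c t = - c t"
      then have "c t \<bullet> c t = - (c t \<bullet> c t)" by (metis inner_minus_left)
      then show False using nc[of t] by (simp add: norm_eq_1)
    qed
    ultimately have "even (\<lfloor>s\<rfloor> - \<lfloor>t\<rfloor>)" using st by (auto split: if_splits)
    then obtain k where "\<lfloor>s\<rfloor> - \<lfloor>t\<rfloor> = 2 * k" by (rule evenE)
    with s show ?thesis by (intro exI[of _ k]) simp
  qed
  have ran: "range c = {x. norm x = 1 \<and> proj x \<in> L}"
  proof (intro equalityI subsetI)
    fix x assume "x \<in> range c"
    then show "x \<in> {x. norm x = 1 \<and> proj x \<in> L}"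
      using nc pc fr gh(2) by (auto simp: path_image_def)
  next
    fix x assume "x \<in> {x. norm x = 1 \<and> proj x \<in> L}"
    then obtain t where t: "t \<in> {0..1}" "proj x = g t" "norm x = 1"
      using gh(2) by (auto simp: path_image_def)
    then have "x = c t \<or> x = - c t"
      using proj_eq_sphere_iff[of "c t" x] nc[of t] c01[of t] gh(5)[of t] by simp
    then show "x \<in> range c" using odd[of t] by (metis rangeI)
  qed
  show ?thesis by (rule that[OF cont odd inj ran])
qed

text \<open>One component is selected from every antipodal pair. The selection \<open>Q x\<close> is
  made from an unordered pair, so that \<open>x\<close> and \<open>- x\<close> get the same one, and
  \<open>sep\<close> makes the two components distinct.\<close>

lemma odd_locally_constant_sign:
  fixes S :: "(real^3) set"
  assumes sym: "\<And>x. x \<in> S \<Longrightarrow> - x \<in> S"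
    and sep: "\<And>x. x \<in> S \<Longrightarrow> \<not> connected_component S x (- x)"
  obtains \<sigma> :: "real^3 \<Rightarrow> real" where "\<And>x. x \<in> S \<Longrightarrow> \<sigma> x = 1 \<or> \<sigma> x = -1"
    "\<And>x. x \<in> S \<Longrightarrow> \<sigma> (- x) = - \<sigma> x" "\<And>x y. connected_component S x y \<Longrightarrow> \<sigma> x = \<sigma> y"
proof -
  define K where "K x = connected_component_set S x" for x
  define Q where "Q x = (SOME A. A \<in> {K x, K (- x)})" for x
  define \<sigma> where "\<sigma> x = (if K x = Q x then 1 else - 1 :: real)" for x
  have Q: "Q x = K x \<or> Q x = K (- x)" for x
    using someI[of "\<lambda>A. A \<in> {K x, K (- x)}" "K x"] unfolding Q_def by simp
  have Qm: "Q (- x) = Q x" for x unfolding Q_def by (simp add: insert_commute)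
  have neg: "connected_component S (- x) (- y)" if "connected_component S x y" for x y
  proof -
    obtain T where "connected T" "T \<subseteq> S" "x \<in> T" "y \<in> T"
      using \<open>connected_component S x y\<close> unfolding connected_component_def by blast
    moreover have "connected (uminus ` T)"
      by (intro connected_continuous_image continuous_intros) fact
    ultimately show ?thesis unfolding connected_component_def using sym
      by (intro exI[of _ "uminus ` T"]) auto
  qed
  have Kne: "K x \<noteq> K (- x)" if "x \<in> S" for x
    using sep[OF that] sym[OF that] connected_component_refl[of "- x" S] unfolding K_def by blast
  show ?thesis
  proof (rule that[of \<sigma>])
    show "\<sigma> (- x) = - \<sigma> x" if "x \<in> S" for x
      using Q[of x] Kne[OF that] by (auto simp: \<sigma>_def Qm)
    fix x y assume xy: "connected_component S x y"
    then have "K x = K y" "K (- x) = K (- y)"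
      using connected_component_eq[of y S x] connected_component_eq[of "- y" S "- x"] neg[OF xy]
      unfolding K_def by simp_all
    then show "\<sigma> x = \<sigma> y" by (simp add: \<sigma>_def Q_def)
  qed (simp add: \<sigma>_def)
qed

text \<open>The sign of \<open>sin (pi * x)\<close>.\<close>

definition sg :: "real \<Rightarrow> real" where
  "sg x = (if x \<in> \<int> then 0 else if even \<lfloor>x\<rfloor> then 1 else - 1)"

text \<open>The passage from topology to numbers. Between two successive meetings with
  \<open>f\<close>, which are one half turn apart, the circle \<open>e\<close> stays in a connected
  part of the complement of \<open>f\<close>, so the sign of \<open>f\<close> is constant there, and
  oddness makes it alternate. One number per ordered pair of circles thus determines all signs along
  them.\<close>

lemma pseudoline_arrangement_lift:
  assumes "pseudoline_arrangement E L"
  obtains c :: "'a \<Rightarrow> real \<Rightarrow> real^3" and \<sigma> :: "'a \<Rightarrow> real^3 \<Rightarrow> real" and \<tau> :: "'a \<Rightarrow> 'a \<Rightarrow> real"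
  where "\<And>e t. e \<in> E \<Longrightarrow> c e (t + 1) = - c e t"
    "\<And>e s t. e \<in> E \<Longrightarrow> c e s = c e t \<Longrightarrow> \<exists>k::int. s = t + 2 * of_int k"
    "\<And>e. e \<in> E \<Longrightarrow> range (c e) = {x. norm x = 1 \<and> proj x \<in> L e}"
    "\<And>e f t. e \<in> E \<Longrightarrow> f \<in> E \<Longrightarrow> e \<noteq> f \<Longrightarrow> \<sigma> f (c e t) = sg (t - \<tau> e f)"
    "\<And>e x. e \<in> E \<Longrightarrow> norm x = 1 \<Longrightarrow> \<sigma> e x = 0 \<longleftrightarrow> x \<in> range (c e)"
proof -
  define Q where "Q e c \<longleftrightarrow> continuous_on {0..2} c \<and> (\<forall>t. c (t + 1) = - c t) \<and>
      (\<forall>s t. c s = c t \<longrightarrow> (\<exists>k::int. s = t + 2 * of_int k)) \<and>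
      range c = {x. norm x = 1 \<and> proj x \<in> L e}" for e and c :: "real \<Rightarrow> real^3"
  have "\<forall>e\<in>E. \<exists>c. Q e c"
  proof
    fix e assume e: "e \<in> E"
    have "pseudoline (L e)" using assms e unfolding pseudoline_arrangement_def by blast
    then show "\<exists>c. Q e c"
    proof (rule pseudoline_parametrization)
      fix c :: "real \<Rightarrow> real^3"
      assume "continuous_on {0..2} c" "\<And>t. c (t + 1) = - c t"
        "\<And>s t. c s = c t \<Longrightarrow> \<exists>k::int. s = t + 2 * of_int k" "range c = {x. norm x = 1 \<and> proj x \<in> L e}"
      then show ?thesis unfolding Q_def by (intro exI[of _ c]) simp
    qed
  qed
  from bchoice[OF this] obtain c where "\<forall>e\<in>E. Q e (c e)" by blast
  then have Q: "Q e (c e)" if "e \<in> E" for e using that by blast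
  have c: "\<And>e. e \<in> E \<Longrightarrow> continuous_on {0..2} (c e)"
    "\<And>e t. e \<in> E \<Longrightarrow> c e (t + 1) = - c e t"
    "\<And>e s t. e \<in> E \<Longrightarrow> c e s = c e t \<Longrightarrow> \<exists>k::int. s = t + 2 * of_int k"
    "\<And>e. e \<in> E \<Longrightarrow> range (c e) = {x. norm x = 1 \<and> proj x \<in> L e}"
    using Q unfolding Q_def by simp_all
  have shift: "c e (t + of_int k) = (if even k then c e t else - c e t)" if "e \<in> E" for e t k
    using odd_shift_int[of "c e"] c(2)[OF that] by blast
  define S where "S e = sphere (0::real^3) 1 - range (c e)" for e
  have Sneg: "- x \<in> S e" if e: "e \<in> E" and x: "x \<in> S e" for e x
    using x unfolding S_def c(4)[OF e] by (auto simp: proj_uminus)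
  have nconn: "\<not> connected_component (S e) x (- x)" if e: "e \<in> E" and x: "x \<in> S e" for e x
    unfolding S_def
  proof (rule odd_curve_separates_antipodes[OF c(1)[OF e] c(2)[OF e]])
    show "range (c e) \<subseteq> sphere 0 1" using c(4)[OF e] by auto
    show "norm x = 1" using x by (simp add: S_def)
    show "range (c e) = c e ` {0..2}"
    proof (intro equalityI subsetI)
      fix y assume "y \<in> range (c e)"
      then obtain t where t: "y = c e t" by blast
      define u where "u = t + of_int (- 2 * \<lfloor>t / 2\<rfloor>)"
      have "c e u = y" unfolding u_def t using shift[OF e, of t "- 2 * \<lfloor>t / 2\<rfloor>"] by simp
      moreover have "u \<in> {0..2}" 
      proof -
        have "2 * of_int \<lfloor>t / 2\<rfloor> \<le> t" "t < 2 * of_int \<lfloor>t / 2\<rfloor> + 2" by linarith+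
        then show ?thesis by (simp add: u_def)
      qed
      ultimately show "y \<in> c e ` {0..2}" by blast
    qed auto
  qed
  define R where "R e \<sigma> \<longleftrightarrow> (\<forall>x\<in>S e. \<sigma> x = 1 \<or> \<sigma> x = -1) \<and> (\<forall>x\<in>S e. \<sigma> (- x) = - \<sigma> x) \<and>
      (\<forall>x y. connected_component (S e) x y \<longrightarrow> \<sigma> x = \<sigma> y)" for e and \<sigma> :: "real^3 \<Rightarrow> real"
  have "\<forall>e\<in>E. \<exists>\<sigma>. R e \<sigma>"
  proof
    fix e assume e: "e \<in> E"
    show "\<exists>\<sigma>. R e \<sigma>"
    proof (rule odd_locally_constant_sign[of "S e", OF Sneg[OF e] nconn[OF e]])
      fix \<sigma> :: "real^3 \<Rightarrow> real"
      assume "\<And>x. x \<in> S e \<Longrightarrow> \<sigma> x = 1 \<or> \<sigma> x = -1" "\<And>x. x \<in> S e \<Longrightarrow> \<sigma> (- x) = - \<sigma> x"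
        "\<And>x y. connected_component (S e) x y \<Longrightarrow> \<sigma> x = \<sigma> y"
      then show ?thesis unfolding R_def by (intro exI[of _ \<sigma>]) simp
    qed
  qed
  from bchoice[OF this] obtain \<sigma>0 where "\<forall>e\<in>E. R e (\<sigma>0 e)" by blast
  then have R: "R e (\<sigma>0 e)" if "e \<in> E" for e using that by blast
  have \<sigma>0: "\<And>e x. e \<in> E \<Longrightarrow> x \<in> S e \<Longrightarrow> \<sigma>0 e x = 1 \<or> \<sigma>0 e x = -1"
    "\<And>e x. e \<in> E \<Longrightarrow> x \<in> S e \<Longrightarrow> \<sigma>0 e (- x) = - \<sigma>0 e x"
    "\<And>e x y. e \<in> E \<Longrightarrow> connected_component (S e) x y \<Longrightarrow> \<sigma>0 e x = \<sigma>0 e y"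
    using R unfolding R_def by blast+
  define \<sigma> where "\<sigma> e x = (if x \<in> range (c e) then 0 else \<sigma>0 e x)" for e x
  have "\<exists>u. \<forall>t. \<sigma> f (c e t) = sg (t - u)" if ef: "e \<in> E" "f \<in> E" "e \<noteq> f" for e f
  proof -
    obtain p where p: "L e \<inter> L f = {p}" using assms ef unfolding pseudoline_arrangement_def by blast
    obtain x where "norm x = 1" "proj x = p" using ex_unit_vector_proj by blast
    then have "x \<in> range (c e)" using c(4)[OF ef(1)] p by blast
    then obtain u0 where "x = c e u0" by blast
    define t0 where "t0 = frac u0"
    have nrm: "norm (c e t) = 1" for t
      using rangeI[of "c e" t] unfolding c(4)[OF ef(1)] by simp
    have "u0 = t0 + of_int \<lfloor>u0\<rfloor>" by (simp add: t0_def frac_def)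
    then have "x = c e t0 \<or> x = - c e t0"
      using shift[OF ef(1), of t0 "\<lfloor>u0\<rfloor>"] \<open>x = c e u0\<close> by (auto split: if_splits)
    then have pt0: "proj (c e t0) = p" 
      using \<open>proj x = p\<close> proj_uminus[OF nrm[of t0]] by (elim disjE) (simp_all only:)
    have t0: "0 \<le> t0" "t0 < 1" by (auto simp: t0_def frac_lt_1)
    have zero: "c e t \<in> range (c f) \<longleftrightarrow> t - t0 \<in> \<int>" for t
    proof -
      have "c e t \<in> range (c f) \<longleftrightarrow> proj (c e t) = p"
      proof -
        have "c e t \<in> range (c f) \<longleftrightarrow> proj (c e t) \<in> L f"
          unfolding c(4)[OF ef(2)] using nrm by simp
        moreover have "proj (c e t) \<in> L e"
          using rangeI[of "c e" t] unfolding c(4)[OF ef(1)] by simp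
        ultimately show ?thesis using p by blast
      qed
      also have "\<dots> \<longleftrightarrow> c e t = c e t0 \<or> c e t = - c e t0"
        unfolding pt0[symmetric] using proj_eq_sphere_iff[OF nrm nrm, of t0 t] by metis
      also have "\<dots> \<longleftrightarrow> c e t = c e t0 \<or> c e t = c e (t0 + 1)" by (simp add: c(2)[OF ef(1)])
      also have "\<dots> \<longleftrightarrow> t - t0 \<in> \<int>"
      proof
        assume "c e t = c e t0 \<or> c e t = c e (t0 + 1)"
        then have "(\<exists>k::int. t = t0 + 2 * of_int k) \<or> (\<exists>k::int. t = t0 + 1 + 2 * of_int k)"
          using c(3)[OF ef(1)] by blast
        then show "t - t0 \<in> \<int>"
        proof (elim disjE exE)
          fix k :: int assume "t = t0 + 2 * of_int k"
          then have "t - t0 = of_int (2 * k)" by simp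
          then show ?thesis by (simp only: Ints_of_int)
        next
          fix k :: int assume "t = t0 + 1 + 2 * of_int k"
          then have "t - t0 = of_int (1 + 2 * k)" by simp
          then show ?thesis by (simp only: Ints_of_int)
        qed
      next
        assume "t - t0 \<in> \<int>"
        then obtain k where "t - t0 = of_int k" by (elim Ints_cases)
        then have "t = t0 + of_int k" by simp
        then show "c e t = c e t0 \<or> c e t = c e (t0 + 1)"
          using shift[OF ef(1), of t0 k] c(2)[OF ef(1), of t0] by (auto split: if_splits)
      qed
      finally show ?thesis .
    qed
    have noint: "t - t0 \<notin> \<int>" if "t \<in> {t0<..<t0+1}" for t
    proof
      assume "t - t0 \<in> \<int>"
      then obtain k where k: "t - t0 = of_int k" by (elim Ints_cases)
      with that have "0 < k" "k < 1" by auto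
      then show False by simp
    qed
    have inS: "c e t \<in> S f" if "t - t0 \<notin> \<int>" for t
      using that zero nrm by (simp add: S_def)
    have con: "connected (c e ` {t0<..<t0+1})"
      by (intro connected_continuous_image continuous_on_subset[OF c(1)[OF ef(1)]]) (use t0 in auto)
    have sub: "c e ` {t0<..<t0+1} \<subseteq> S f" using inS noint by blast
    define s where "s = \<sigma>0 f (c e (t0 + 1/2))"
    have const: "\<sigma>0 f (c e t) = s" if "t \<in> {t0<..<t0+1}" for t
    proof -
      have "c e (t0 + 1/2) \<in> c e ` {t0<..<t0+1}" by (intro imageI) simp
      moreover have "c e t \<in> c e ` {t0<..<t0+1}" using that by (rule imageI)
      ultimately have "connected_component (S f) (c e t) (c e (t0 + 1/2))"
        unfolding connected_component_def using con sub by blast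
      then show ?thesis unfolding s_def by (rule \<sigma>0(3)[OF ef(2)])
    qed
    have s: "s = 1 \<or> s = -1"
      unfolding s_def by (rule \<sigma>0(1)[OF ef(2) inS[OF noint]]) simp
    have val: "\<sigma> f (c e t) = s * sg (t - t0)" for t
    proof (cases "t - t0 \<in> \<int>")
      case True
      then show ?thesis using zero by (simp add: \<sigma>_def sg_def)
    next
      case False
      define k where "k = \<lfloor>t - t0\<rfloor>"
      define t' where "t' = t - of_int k"
      have "t' \<noteq> t0" using False by (auto simp: t'_def)
      then have t': "t' \<in> {t0<..<t0+1}"

        unfolding t'_def k_def greaterThanLessThan_iff by linarith
      have "c e t = (if even k then c e t' else - c e t')"
        using shift[OF ef(1), of t' k] by (simp add: t'_def)
      then have "\<sigma>0 f (c e t) = (if even k then s else - s)"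
        using const[OF t'] \<sigma>0(2)[OF ef(2) inS[OF noint[OF t']]] by auto
      then show ?thesis using False zero by (auto simp: \<sigma>_def sg_def k_def)
    qed
    have sg1: "sg (x - 1) = - sg x" for x by (auto simp: sg_def)
    show ?thesis
    proof (cases "s = 1")
      case True then show ?thesis using val by auto
    next
      \<comment> \<open>The unknown orientation is absorbed by moving the zero one half turn
        on.\<close>
      case False
      then have "\<sigma> f (c e t) = sg (t - (t0 + 1))" for t
        using val[of t] s sg1[of "t - t0"] by (simp add: algebra_simps)
      then show ?thesis by blast
    qed
  qed
  then have "\<forall>e f. \<exists>u. e \<in> E \<and> f \<in> E \<and> e \<noteq> f \<longrightarrow> (\<forall>t. \<sigma> f (c e t) = sg (t - u))"
    by blast
  then have "\<exists>\<tau>. \<forall>e f. e \<in> E \<and> f \<in> E \<and> e \<noteq> f \<longrightarrow> (\<forall>t. \<sigma> f (c e t) = sg (t - \<tau> e f))"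
    by (simp only: choice_iff)
  then obtain \<tau> where "\<And>e f t. e \<in> E \<Longrightarrow> f \<in> E \<Longrightarrow> e \<noteq> f \<Longrightarrow> \<sigma> f (c e t) = sg (t - \<tau> e f)"
    by blast
  moreover have "\<sigma> e x = 0 \<longleftrightarrow> x \<in> range (c e)" if "e \<in> E" "norm x = 1" for e x
    using \<sigma>0(1)[OF that(1), of x] that(2) by (auto simp: \<sigma>_def S_def)
  ultimately show ?thesis using c(2,3,4) by (intro that)
qed

section \<open>Sign patterns along a circle\<close>

text \<open>The one-sided limits of \<^const>\<open>sg\<close> from the right and from the left.\<close>

definition sgr :: "real \<Rightarrow> real" where
  "sgr x = (if even \<lfloor>x\<rfloor> then 1 else - 1)"

definition sgl :: "real \<Rightarrow> real" where
  "sgl x = - sgr (- x)"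

lemma sgr_cases: "sgr x = 1 \<or> sgr x = - 1"
  by (simp add: sgr_def)

lemma sgr_add_int: "sgr (x + of_int k) = (if even k then sgr x else - sgr x)"
  by (simp add: sgr_def)

lemma sg_nonint: "x \<notin> \<int> \<Longrightarrow> sg x = sgr x"
  by (simp add: sg_def sgr_def)

lemma sgl_int: "x \<in> \<int> \<Longrightarrow> sgl x = - sgr x"
  by (auto simp: sgl_def sgr_def elim!: Ints_cases)

text \<open>Right continuity decides the form: an integer at \<open>x\<close> is harmless, one at
  \<open>y\<close> is not.\<close>

lemma sgr_const:
  assumes "x \<le> y" "\<And>z. x < z \<Longrightarrow> z \<le> y \<Longrightarrow> z \<notin> \<int>"
  shows "sgr y = sgr x"
proof -
  have "\<lfloor>x\<rfloor> \<le> \<lfloor>y\<rfloor>" using assms(1) by (rule floor_mono)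
  moreover have "\<not> \<lfloor>x\<rfloor> < \<lfloor>y\<rfloor>"
  proof
    assume "\<lfloor>x\<rfloor> < \<lfloor>y\<rfloor>"
    then have "x < of_int \<lfloor>y\<rfloor>" by linarith
    then show False using assms(2)[of "of_int \<lfloor>y\<rfloor>"] by simp
  qed
  ultimately show ?thesis by (simp add: sgr_def)
qed

lemma sgl_eq_sgr:
  assumes "x < y" "\<And>z. x < z \<Longrightarrow> z < y \<Longrightarrow> z \<notin> \<int>"
  shows "sgl y = sgr x"
proof -
  have "\<lfloor>- y\<rfloor> = - \<lfloor>x\<rfloor> - 1"
  proof -
    have "\<not> of_int (\<lfloor>x\<rfloor> + 1) < y"
    proof
      assume *: "of_int (\<lfloor>x\<rfloor> + 1) < y"
      have "x < of_int (\<lfloor>x\<rfloor> + 1)" by linarith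
      from assms(2)[OF this *] show False by (metis Ints_of_int)
    qed
    then show ?thesis using assms(1) by linarith
  qed
  then show ?thesis by (simp add: sgl_def sgr_def)
qed

lemma sgl_nonint: "x \<notin> \<int> \<Longrightarrow> sgl x = sgr x"
proof -
  assume x: "x \<notin> \<int>"
  then have "x \<noteq> of_int \<lfloor>x\<rfloor>" by (metis Ints_of_int)
  then have "\<lfloor>- x\<rfloor> = - \<lfloor>x\<rfloor> - 1" by linarith
  then show ?thesis by (simp add: sgl_def sgr_def)
qed

section \<open>Enumerating the crossings on a circle\<close>

lemma periodic_set_int:
  fixes P :: "real set"
  assumes "\<And>x. x + 1 \<in> P \<longleftrightarrow> x \<in> P"
  shows "x + of_int k \<in> P \<longleftrightarrow> x \<in> P"
proof (induction k rule: int_induct[where k=0])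
  case (step1 i)
  then show ?case using assms[of "x + of_int i"] by (simp add: add.assoc)
next
  case (step2 i)
  have "x + of_int i = (x + of_int (i - 1)) + 1" by simp
  then have "x + of_int i \<in> P \<longleftrightarrow> x + of_int (i - 1) \<in> P" using assms by metis
  then show ?case using step2 by simp
qed simp

lemma periodic_enumeration:
  fixes P :: "real set"
  assumes per: "\<And>x. x + 1 \<in> P \<longleftrightarrow> x \<in> P" and fin: "finite (P \<inter> {0..<1})" and ne: "P \<noteq> {}"
    and d: "d = card (P \<inter> {0..<1})"
  shows "\<exists>pos :: int \<Rightarrow> real. 0 < d \<and> strict_mono pos \<and> range pos = P \<and> (\<forall>n. pos (n + int d) = pos n + 1)"
proof -
  note perk = periodic_set_int[OF per]
  define xs where "xs = sorted_list_of_set (P \<inter> {0..<1})"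
  have xs: "set xs = P \<inter> {0..<1}" "length xs = d" "sorted_wrt (<) xs"
    using fin by (auto simp: xs_def d)
  have frac: "frac x \<in> P \<inter> {0..<1}" if "x \<in> P" for x
    using perk[of x "- \<lfloor>x\<rfloor>"] that frac_lt_1[of x] by (simp add: frac_def)
  have d0: "0 < d"
    using ne frac fin unfolding d by (metis card_gt_0_iff empty_iff equals0I)
  define pos where "pos n = xs ! nat (n mod int d) + of_int (n div int d)" for n
  have idx: "nat (n mod int d) < d" for n using d0 by (simp add: nat_less_iff)
  have nth: "xs ! i \<in> P" "0 \<le> xs ! i" "xs ! i < 1" if "i < d" for i
    using nth_mem[of i xs] that xs by auto
  have mono: "pos n < pos m" if "n < m" for n m
  proof (cases "n div int d = m div int d")
    case True
    then have "n mod int d < m mod int d"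
      using that by (metis add_less_cancel_left div_mult_mod_eq)
    then have "nat (n mod int d) < nat (m mod int d)"
      using d0 by (subst nat_less_eq_zless) simp_all
    then show ?thesis using sorted_wrt_nth_less[OF xs(3)] idx[of m] xs(2) True by (simp add: pos_def)
  next
    case False
    then have "n div int d < m div int d" using zdiv_mono1[of n m "int d"] that d0 by simp
    then have "real_of_int (n div int d) + 1 \<le> real_of_int (m div int d)" by linarith
    then show ?thesis using nth[OF idx[of n]] nth[OF idx[of m]] by (simp add: pos_def)
  qed
  have "pos (n + int d) = pos n + 1" for n using d0 by (simp add: pos_def)
  moreover have "range pos = P"
  proof (intro equalityI subsetI)
    fix x assume "x \<in> range pos"
    then show "x \<in> P" using perk nth[OF idx] by (auto simp: pos_def)
  next
    fix x assume "x \<in> P"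
    then obtain i where i: "i < d" "xs ! i = frac x"
      using frac xs by (metis in_set_conv_nth)
    then have "pos (int i + int d * \<lfloor>x\<rfloor>) = x"
      using d0 by (simp add: pos_def frac_def)
    then show "x \<in> range pos" by (metis rangeI)
  qed
  ultimately show ?thesis using d0 mono by (intro exI[of _ pos]) (simp add: strict_mono_def)
qed

definition crossings :: "('a \<Rightarrow> real) \<Rightarrow> 'a set \<Rightarrow> real set" where
  "crossings u A = {t. \<exists>f\<in>A. t - u f \<in> \<int>}"

text \<open>Indexing by all integers unrolls the circle: the next crossing is always
  \<open>n + 1\<close>, a half turn is \<open>d\<close>, a full turn is \<open>2 * d\<close>, and
  equality of points becomes divisibility by \<open>2 * d\<close>.\<close>

definition is_enum :: "('a \<Rightarrow> real) \<Rightarrow> 'a set \<Rightarrow> (int \<Rightarrow> real) \<Rightarrow> nat \<Rightarrow> bool" where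
  "is_enum u A pos d \<longleftrightarrow> 0 < d \<and> strict_mono pos \<and> range pos = crossings u A \<and>
     (\<forall>n. pos (n + int d) = pos n + 1)"

lemma Int_minus_frac_iff: "t - u \<in> \<int> \<longleftrightarrow> frac t = frac (u::real)"
proof
  assume "t - u \<in> \<int>"
  then obtain k where "t - u = of_int k" by (elim Ints_cases)
  then have "t = u + of_int k" by simp
  then show "frac t = frac u" by (simp add: frac_def)
next
  assume "frac t = frac u"
  then have "t - u = of_int (\<lfloor>t\<rfloor> - \<lfloor>u\<rfloor>)" by (simp add: frac_def)
  then show "t - u \<in> \<int>" by (metis Ints_of_int)
qed

lemma crossings_unit: "crossings u A \<inter> {0..<1} = (\<lambda>f. frac (u f)) ` A"
proof (intro equalityI subsetI)
  fix t assume t: "t \<in> crossings u A \<inter> {0..<1}"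
  then obtain f where f: "f \<in> A" "frac t = frac (u f)"
    by (auto simp: crossings_def Int_minus_frac_iff)
  moreover have "frac t = t" using t by (simp add: frac_eq)
  ultimately show "t \<in> (\<lambda>f. frac (u f)) ` A" by (metis imageI)
next
  fix t assume "t \<in> (\<lambda>f. frac (u f)) ` A"
  then obtain f where f: "f \<in> A" "t = frac (u f)" by blast
  then have t: "0 \<le> t" "t < 1" by (simp_all add: frac_lt_1)
  then have "frac t = t" by (simp add: frac_eq)
  with f t show "t \<in> crossings u A \<inter> {0..<1}"
    by (auto simp: crossings_def Int_minus_frac_iff)
qed

lemma is_enum_exists:
  assumes "finite A" "A \<noteq> {}"
  shows "\<exists>pos. is_enum u A pos (card ((\<lambda>f. frac (u f)) ` A))"
  unfolding is_enum_def
proof (rule periodic_enumeration)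
  show "x + 1 \<in> crossings u A \<longleftrightarrow> x \<in> crossings u A" for x
    unfolding crossings_def Int_minus_frac_iff by (simp add: frac_1_eq)
  obtain a where "a \<in> A" using assms(2) by blast
  then have "u a \<in> crossings u A" by (auto simp: crossings_def intro!: bexI[of _ a])
  then show "crossings u A \<noteq> {}" by blast
qed (use assms(1) in \<open>auto simp: crossings_unit\<close>)

context
  fixes u :: "'a \<Rightarrow> real" and A pos d
  assumes en: "is_enum u A pos d"
begin

lemma enum_d: "0 < d" using en by (simp add: is_enum_def)

lemma enum_less_iff: "pos n < pos m \<longleftrightarrow> n < m" "pos n \<le> pos m \<longleftrightarrow> n \<le> m" "pos n = pos m \<longleftrightarrow> n = m"
proof -
  have "strict_mono pos" using en by (simp add: is_enum_def)
  then show "pos n < pos m \<longleftrightarrow> n < m" "pos n \<le> pos m \<longleftrightarrow> n \<le> m" "pos n = pos m \<longleftrightarrow> n = m"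
    by (simp_all add: strict_mono_less strict_mono_less_eq strict_mono_eq)
qed

lemma enum_shift: "pos (n + int d * k) = pos n + of_int k"
proof (induction k rule: int_induct[where k=0])
  case (step1 i)
  have "n + int d * (i + 1) = (n + int d * i) + int d" by (simp add: algebra_simps)
  then have "pos (n + int d * (i + 1)) = pos (n + int d * i) + 1" using en by (metis is_enum_def)
  then show ?case using step1 by simp
next
  case (step2 i)
  have "n + int d * i = (n + int d * (i - 1)) + int d" by (simp add: algebra_simps)
  then have "pos (n + int d * i) = pos (n + int d * (i - 1)) + 1" using en by (metis is_enum_def)
  then show ?case using step2 by simp
qed simp

lemma enum_crossing: "\<exists>f\<in>A. pos n - u f \<in> \<int>"
proof -
  have "pos n \<in> crossings u A" using en rangeI[of pos n] by (simp add: is_enum_def)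
  then show ?thesis by (simp add: crossings_def)
qed

lemma enum_crossingD: "f \<in> A \<Longrightarrow> t - u f \<in> \<int> \<Longrightarrow> \<exists>n. t = pos n"
proof -
  assume "f \<in> A" "t - u f \<in> \<int>"
  then have "t \<in> range pos" using en unfolding is_enum_def crossings_def by blast
  then show ?thesis by blast
qed

lemma enum_gap: "f \<in> A \<Longrightarrow> pos n < t \<Longrightarrow> t < pos (n + 1) \<Longrightarrow> t - u f \<notin> \<int>"
proof
  assume "f \<in> A" "pos n < t" "t < pos (n + 1)" "t - u f \<in> \<int>"
  with enum_crossingD obtain m where "t = pos m" by blast
  with \<open>pos n < t\<close> \<open>t < pos (n + 1)\<close> show False by (simp add: enum_less_iff)
qed

lemma enum_sgr: "f \<in> A \<Longrightarrow> pos n \<le> t \<Longrightarrow> t < pos (n + 1) \<Longrightarrow> sgr (t - u f) = sgr (pos n - u f)"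
proof (rule sgr_const)
  fix z assume a: "f \<in> A" "pos n \<le> t" "t < pos (n + 1)" and z: "pos n - u f < z" "z \<le> t - u f"
  then show "z \<notin> \<int>" using enum_gap[OF a(1), of n "z + u f"] by simp
qed simp

lemma enum_sgl: "f \<in> A \<Longrightarrow> pos n < t \<Longrightarrow> t \<le> pos (n + 1) \<Longrightarrow> sgl (t - u f) = sgr (pos n - u f)"
proof (rule sgl_eq_sgr)
  fix z assume a: "f \<in> A" "pos n < t" "t \<le> pos (n + 1)" and z: "pos n - u f < z" "z < t - u f"
  then show "z \<notin> \<int>" using enum_gap[OF a(1), of n "z + u f"] by simp
qed simp

lemma enum_locate: "\<exists>n. pos n \<le> t \<and> t < pos (n + 1)"
proof -
  define k where "k = \<lfloor>t - pos 0\<rfloor>"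
  define M where "M = {n \<in> {int d * k..int d * (k + 1)}. pos n \<le> t}"
  have lo: "pos (int d * k) \<le> t" using enum_shift[of 0 k] unfolding k_def by simp linarith
  have hi: "t < pos (int d * (k + 1))" using enum_shift[of 0 "k + 1"] unfolding k_def by simp linarith
  have "int d * k \<in> M" using lo by (simp add: M_def algebra_simps)
  moreover have finM: "finite M"
    by (rule finite_subset[of _ "{int d * k..int d * (k + 1)}"]) (auto simp: M_def)
  ultimately have "Max M \<in> M" by (intro Max_in) auto
  then have *: "int d * k \<le> Max M" "pos (Max M) \<le> t" "Max M \<le> int d * (k + 1)" by (auto simp: M_def)
  then have "Max M < int d * (k + 1)" using hi enum_less_iff(2) by (smt (verit))
  have "\<not> pos (Max M + 1) \<le> t"
  proof
    assume "pos (Max M + 1) \<le> t"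
    then have "Max M + 1 \<in> M" using * \<open>Max M < int d * (k + 1)\<close> by (simp add: M_def)
    then show False using Max_ge[OF finM] by force
  qed
  then show ?thesis using * by (intro exI[of _ "Max M"]) simp
qed

lemma enum_sgr_periodic: "sgr (pos (n + 2 * int d * k) - x) = sgr (pos n - x)"
proof -
  have "pos (n + 2 * int d * k) = pos n + of_int (2 * k)"
    using enum_shift[of n "2 * k"] by (simp add: mult_ac)
  then have "pos (n + 2 * int d * k) - x = (pos n - x) + of_int (2 * k)" by simp
  then show ?thesis by (simp only: sgr_add_int) simp
qed

text \<open>The line crossing at the far end of an arc separates that arc from all arcs of the following half circle.\<close>

lemma enum_distinct:
  assumes "\<forall>f\<in>A. sgr (pos n - u f) = sgr (pos m - u f)"
  shows "2 * int d dvd n - m"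
proof -
  define r where "r = (m - n) mod (2 * int d)"
  define m' where "m' = n + r"
  have rb: "0 \<le> r" "r < 2 * int d" using enum_d by (simp_all add: r_def)
  have "m = m' + 2 * int d * ((m - n) div (2 * int d))"
    using mult_div_mod_eq[of "2 * int d" "m - n"] unfolding m'_def r_def by linarith
  then have same: "sgr (pos n - u f) = sgr (pos m' - u f)" if "f \<in> A" for f
    using assms that enum_sgr_periodic by metis
  have "r = 0"
  proof (rule ccontr)
    assume "r \<noteq> 0"
    then have r0: "0 < r" using rb by simp
    \<comment> \<open>The sign of \<open>f\<close> jumps at its crossing \<open>x\<close> and was
      the opposite one throughout the preceding half turn.\<close>
    have key: False if h: "f \<in> A" "x - u f \<in> \<int>" "sgr (x - u f) = sgr (y - u f)" "x - 1 \<le> y" "y < x" for f x y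
    proof -
      obtain k where k: "x - u f = of_int k" using h(2) by (elim Ints_cases)
      then have "\<lfloor>y - u f\<rfloor> = k - 1" using h(4,5) by linarith
      then show False using h(3) k by (simp add: sgr_def split: if_splits)
    qed
    show False
    proof (cases "r \<le> int d")
      case True
      obtain f where f: "f \<in> A" "pos m' - u f \<in> \<int>" using enum_crossing by blast
      have "pos m' \<le> pos (n + int d * 1)" using True by (simp add: m'_def enum_less_iff)
      then have "pos m' - 1 \<le> pos n" using enum_shift[of n 1] by simp
      moreover have "pos n < pos m'" using r0 by (simp add: m'_def enum_less_iff)
      ultimately show False using key[OF f same[OF f(1), symmetric]] by simp
    next
      case False
      \<comment> \<open>Past the half turn the comparison runs the other way: \<open>n\<close> is
        replaced by its copy a full turn later, which has the same signs and lies at most half a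
        turn ahead of \<open>m'\<close>.\<close>
      have p2: "pos (n + int d * 2) = pos n + 2" using enum_shift[of n 2] by simp
      obtain f where f: "f \<in> A" "pos (n + int d * 2) - u f \<in> \<int>" using enum_crossing by blast
      have "sgr (pos (n + int d * 2) - u f) = sgr (pos m' - u f)"
        using enum_sgr_periodic[of n 1 "u f"] same[OF f(1)] by (simp add: mult_ac)
      moreover have "pos (n + int d * 1) \<le> pos m'" using False by (simp add: m'_def enum_less_iff)
      then have "pos (n + int d * 2) - 1 \<le> pos m'" using enum_shift[of n 1] p2 by simp
      moreover have "pos m' < pos (n + int d * 2)" using rb by (simp add: m'_def enum_less_iff)
      ultimately show False using key[OF f, of "pos m'"] by blast
    qed
  qed
  then have "2 * int d dvd m - n" unfolding r_def by (simp add: dvd_eq_mod_eq_0)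
  then show ?thesis by (subst dvd_diff_commute)
qed

end

text \<open>Of the sphere only the antipodal map remains, hence \<open>group_add\<close>. The
  function \<open>\<sigma>\<close> ties the rows of \<open>\<tau>\<close> together: where the
  circles \<open>e\<close> and \<open>k\<close> meet, the sign of a third circle \<open>f\<close>
  computed from \<open>\<tau> e f\<close> agrees with the one computed from
  \<open>\<tau> k f\<close>.\<close>

locale pseudocircles =
  fixes E :: "'a set" and c :: "'a \<Rightarrow> real \<Rightarrow> 'p::group_add"
    and \<sigma> :: "'a \<Rightarrow> 'p \<Rightarrow> real" and \<tau> :: "'a \<Rightarrow> 'a \<Rightarrow> real"
  assumes fin: "finite E"
    and c_add_1: "e \<in> E \<Longrightarrow> c e (t + 1) = - c e t"
    and c_eqD: "e \<in> E \<Longrightarrow> c e s = c e t \<Longrightarrow> \<exists>k::int. s = t + 2 * of_int k"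
    and \<sigma>_c: "e \<in> E \<Longrightarrow> f \<in> E \<Longrightarrow> e \<noteq> f \<Longrightarrow> \<sigma> f (c e t) = sg (t - \<tau> e f)"
    and on_iff: "e \<in> E \<Longrightarrow> f \<in> E \<Longrightarrow> e \<noteq> f \<Longrightarrow> c e t \<in> range (c f) \<longleftrightarrow> t - \<tau> e f \<in> \<int>"
begin

definition Z :: "'p \<Rightarrow> 'a set" where "Z x = {e \<in> E. x \<in> range (c e)}"
definition mult :: "'p \<Rightarrow> nat" where "mult x = card (Z x)"
definition V :: "'p set" where "V = {x. 2 \<le> mult x}"

lemma finite_Z [simp]: "finite (Z x)" using fin by (simp add: Z_def)

lemma c_int: "e \<in> E \<Longrightarrow> c e (t + of_int k) = (if even k then c e t else - c e t)"
  using odd_shift_int[of "c e"] c_add_1 by blast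

lemma c_neq_neg: "e \<in> E \<Longrightarrow> c e t \<noteq> - c e t"
proof
  assume e: "e \<in> E" and "c e t = - c e t"
  then have "c e (t + 1) = c e t" by (simp add: c_add_1)
  then obtain k :: int where "t + 1 = t + 2 * of_int k" using c_eqD[OF e] by blast
  then have "of_int (2 * k) = (of_int 1 :: real)" by simp
  then show False unfolding of_int_eq_iff by presburger
qed

lemma c_eq_iff: "e \<in> E \<Longrightarrow> c e s = c e t \<longleftrightarrow> (\<exists>k::int. s = t + of_int (2 * k))"
  using c_eqD[of e s t] c_int[of e t "2 * _"] by auto

lemma uminus_range_iff: "e \<in> E \<Longrightarrow> - x \<in> range (c e) \<longleftrightarrow> x \<in> range (c e)"
proof -
  assume e: "e \<in> E"
  have "- y \<in> range (c e)" if "y \<in> range (c e)" for y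
    using that c_add_1[OF e, symmetric] by auto
  from this[of x] this[of "- x"] show ?thesis by auto
qed

lemma Z_uminus [simp]: "Z (- x) = Z x" unfolding Z_def using uminus_range_iff by blast
lemma mult_uminus [simp]: "mult (- x) = mult x" by (simp add: mult_def)
lemma V_uminus_iff [simp]: "- x \<in> V \<longleftrightarrow> x \<in> V" by (simp add: V_def)

lemma meet_antipodal:
  assumes "e \<in> Z x" "e \<in> Z y" "f \<in> Z x" "f \<in> Z y" "e \<noteq> f"
  shows "y = x \<or> y = - x"
proof -
  have E: "e \<in> E" "f \<in> E" using assms by (auto simp: Z_def)
  obtain s t where st: "x = c e s" "y = c e t" using assms by (auto simp: Z_def)
  then have "s - \<tau> e f \<in> \<int>" "t - \<tau> e f \<in> \<int>"
    using assms on_iff[OF E assms(5)] by (auto simp: Z_def)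
  then have "(t - \<tau> e f) - (s - \<tau> e f) \<in> \<int>" by (rule Ints_diff[rotated])
  then obtain k where "(t - \<tau> e f) - (s - \<tau> e f) = of_int k" by (elim Ints_cases)
  then have "t = s + of_int k" by simp
  then show ?thesis using c_int[OF E(1), of s k] st by (auto split: if_splits)
qed

lemma V_D: assumes "x \<in> V" obtains e f where "e \<in> Z x" "f \<in> Z x" "e \<noteq> f"
proof -
  have "\<not> card (Z x) \<le> Suc 0" using assms by (simp add: V_def mult_def)
  then show ?thesis using that card_le_Suc0_iff_eq[OF finite_Z] by blast
qed

lemma V_I: assumes "e \<in> Z x" "f \<in> Z x" "e \<noteq> f" shows "x \<in> V"
proof -
  have "card {e, f} \<le> card (Z x)" using assms by (intro card_mono) auto
  then show ?thesis using assms by (simp add: V_def mult_def)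
qed

lemma finite_V [simp]: "finite V"
proof (rule finite_subset)
  show "V \<subseteq> (\<Union>e\<in>E. \<Union>f\<in>E. {c e (\<tau> e f), - c e (\<tau> e f)})"
  proof
    fix x assume "x \<in> V"
    then obtain e f where ef: "e \<in> Z x" "f \<in> Z x" "e \<noteq> f" by (rule V_D)
    then have E: "e \<in> E" "f \<in> E" by (auto simp: Z_def)
    have "e \<in> Z (c e (\<tau> e f))" "f \<in> Z (c e (\<tau> e f))"
      using E on_iff[OF E ef(3), of "\<tau> e f"] by (auto simp: Z_def)
    from meet_antipodal[OF this(1) ef(1) this(2) ef(2,3)] E
    show "x \<in> (\<Union>e\<in>E. \<Union>f\<in>E. {c e (\<tau> e f), - c e (\<tau> e f)})" by blast
  qed
qed (use fin in simp)

lemma enum_points: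
  assumes e: "e \<in> E" and A: "A \<subseteq> E - {e}" and en: "is_enum (\<tau> e) A pos d"
  shows "bij_betw (\<lambda>n. c e (pos n)) {0..<2 * int d} {x \<in> range (c e). Z x \<inter> A \<noteq> {}}"
    and "c e (pos n) = c e (pos m) \<longleftrightarrow> 2 * int d dvd n - m"
    and "c e (pos (n + int d)) = - c e (pos n)"
proof -
  note d = enum_d[OF en] and shift = enum_shift[OF en]
  show eq: "c e (pos n) = c e (pos m) \<longleftrightarrow> 2 * int d dvd n - m" for n m
  proof -
    have "c e (pos n) = c e (pos m) \<longleftrightarrow> (\<exists>k::int. pos n = pos (m + int d * (2 * k)))"
      by (simp only: c_eq_iff[OF e] shift)
    also have "\<dots> \<longleftrightarrow> (\<exists>k. n = m + int d * (2 * k))" by (simp only: enum_less_iff[OF en])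
    also have "\<dots> \<longleftrightarrow> 2 * int d dvd n - m" by (auto simp: dvd_def algebra_simps)
    finally show ?thesis .
  qed
  show "c e (pos (n + int d)) = - c e (pos n)" using shift[of n 1] c_add_1[OF e] by simp
  have on: "Z (c e t) \<inter> A \<noteq> {} \<longleftrightarrow> (\<exists>n. t = pos n)" for t
  proof
    assume "Z (c e t) \<inter> A \<noteq> {}"
    then obtain f where f: "f \<in> A" "c e t \<in> range (c f)" by (auto simp: Z_def)
    then have "t - \<tau> e f \<in> \<int>" using on_iff[OF e, of f t] A by auto
    then show "\<exists>n. t = pos n" using enum_crossingD[OF en f(1)] by blast
  next
    assume "\<exists>n. t = pos n"
    then obtain f where f: "f \<in> A" "t - \<tau> e f \<in> \<int>" using enum_crossing[OF en] by blast
    then have "c e t \<in> range (c f)" using on_iff[OF e, of f t] A by auto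
    then show "Z (c e t) \<inter> A \<noteq> {}" using f A by (auto simp: Z_def)
  qed
  show "bij_betw (\<lambda>n. c e (pos n)) {0..<2 * int d} {x \<in> range (c e). Z x \<inter> A \<noteq> {}}"
    unfolding bij_betw_def
  proof
    show "inj_on (\<lambda>n. c e (pos n)) {0..<2 * int d}"
    proof (rule inj_onI)
      fix n m assume nm: "n \<in> {0..<2 * int d}" "m \<in> {0..<2 * int d}" "c e (pos n) = c e (pos m)"
      then have "2 * int d dvd n - m" by (simp add: eq)
      moreover have "\<bar>n - m\<bar> < 2 * int d" using nm by auto
      ultimately show "n = m" using zdvd_not_zless[of "\<bar>n - m\<bar>" "2 * int d"] by auto
    qed
    show "(\<lambda>n. c e (pos n)) ` {0..<2 * int d} = {x \<in> range (c e). Z x \<inter> A \<noteq> {}}"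
    proof (intro equalityI subsetI)
      fix x assume "x \<in> {x \<in> range (c e). Z x \<inter> A \<noteq> {}}"
      then obtain t where t: "x = c e t" "Z (c e t) \<inter> A \<noteq> {}" by blast
      then obtain n where "t = pos n" using on by blast
      with t(1) have x: "x = c e (pos n)" by simp
      also have "\<dots> = c e (pos (n mod (2 * int d)))" by (simp only: eq) (simp add: dvd_minus_mod)
      finally show "x \<in> (\<lambda>n. c e (pos n)) ` {0..<2 * int d}" using d by simp
    qed (use on in blast)
  qed
qed

section \<open>Sign vectors and the Euler inequality\<close>

text \<open>The sign vectors of the cells cut out by the curves of \<open>A\<close>, indexed by a side \<open>s\<close> of the arc of \<open>e\<close> that
  begins at or contains the position \<open>p\<close>; coordinates outside \<open>A\<close> are set to \<open>0\<close>.\<close>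

definition TP :: "'a set \<Rightarrow> ('a \<Rightarrow> real) set" where
  "TP A = {T. \<exists>e\<in>A. \<exists>p s. (s = 1 \<or> s = - 1) \<and>
      T = (\<lambda>f. if f = e then s else if f \<in> A then sgr (p - \<tau> e f) else 0)}"

lemma TP_val: "T \<in> TP A \<Longrightarrow> f \<in> A \<Longrightarrow> T f = 1 \<or> T f = - 1"
proof -
  assume "T \<in> TP A" "f \<in> A"
  then obtain e p s where "s = 1 \<or> s = - 1" "T = (\<lambda>f. if f = e then s else if f \<in> A then sgr (p - \<tau> e f) else 0)"
    unfolding TP_def by blast
  with \<open>f \<in> A\<close> show ?thesis using sgr_cases[of "p - \<tau> e f"] by (cases "f = e") simp_all
qed

lemma TP_out: "T \<in> TP A \<Longrightarrow> f \<notin> A \<Longrightarrow> T f = 0"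
  by (auto simp: TP_def)

lemma finite_TP: "finite A \<Longrightarrow> finite (TP A)"
proof -
  assume A: "finite A"
  have "TP A \<subseteq> {T. \<forall>f. (f \<in> A \<longrightarrow> T f \<in> {- 1, 1}) \<and> (f \<notin> A \<longrightarrow> T f = 0)}"
    using TP_val TP_out by blast
  moreover have "finite {T. \<forall>f. (f \<in> A \<longrightarrow> T f \<in> {- 1, 1 :: real}) \<and> (f \<notin> A \<longrightarrow> T f = 0)}"
    by (rule finite_set_of_finite_funs) (use A in auto)
  ultimately show ?thesis by (rule finite_subset)
qed

text \<open>Every old cell is the restriction of a new one with \<open>e\<close> positive or
  negative, and restriction is injective on either class. The sign vector of an arc of
  \<open>e\<close> arises from both classes, and different arcs have different sign vectors by
  \<open>enum_distinct\<close>. Inclusion and exclusion then yields one additional cell for every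
  arc, and there are as many arcs as points.\<close>

lemma card_TP_insert:
  assumes A: "A \<subseteq> E" "A \<noteq> {}" and e: "e \<in> E" "e \<notin> A"
  shows "card (TP A) + card {x \<in> range (c e). Z x \<inter> A \<noteq> {}} \<le> card (TP (insert e A))"
proof -
  have finA: "finite A" using A fin finite_subset by blast
  obtain pos d where en: "is_enum (\<tau> e) A pos d" using is_enum_exists[OF finA A(2)] by blast
  have Ae: "A \<subseteq> E - {e}" using A e by auto
  define \<rho> where "\<rho> T = (\<lambda>f. if f \<in> A then T f else (0::real))" for T
  define X where "X p = (\<lambda>f. if f \<in> A then sgr (p - \<tau> e f) else 0)" for p
  define B where "B s = {T \<in> TP (insert e A). T e = s}" for s :: real
  have fB: "finite (B s)" for s using finite_TP[of "insert e A"] finA by (simp add: B_def)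
  have inj: "inj_on \<rho> (B s)" for s
  proof (rule inj_onI)
    fix T T' assume TT: "T \<in> B s" "T' \<in> B s" "\<rho> T = \<rho> T'"
    show "T = T'"
    proof
      fix f
      show "T f = T' f"
        using fun_cong[OF TT(3), of f] TT(1,2) TP_out[of T "insert e A" f] TP_out[of T' "insert e A" f]
        by (cases "f \<in> A"; cases "f = e") (auto simp: \<rho>_def B_def)
    qed
  qed
  have "TP A \<subseteq> \<rho> ` TP (insert e A)"
  proof
    fix T assume "T \<in> TP A"
    then obtain g p s where g: "g \<in> A" "s = 1 \<or> s = - 1"
      "T = (\<lambda>f. if f = g then s else if f \<in> A then sgr (p - \<tau> g f) else 0)"
      by (auto simp: TP_def)
    define T' where "T' = (\<lambda>f. if f = g then s else if f \<in> insert e A then sgr (p - \<tau> g f) else 0)"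
    have "T' \<in> TP (insert e A)" unfolding TP_def T'_def using g by blast
    moreover have "\<rho> T' = T" unfolding \<rho>_def T'_def g(3) using g(1) e by auto
    ultimately show "T \<in> \<rho> ` TP (insert e A)" by blast
  qed
  also have "TP (insert e A) \<subseteq> B 1 \<union> B (- 1)" using TP_val[of _ "insert e A" e] by (auto simp: B_def)
  finally have sub1: "TP A \<subseteq> \<rho> ` B 1 \<union> \<rho> ` B (- 1)" by (auto simp: image_Un)
  have XB: "X p \<in> \<rho> ` B s" if s: "s = 1 \<or> s = - 1" for p s
  proof -
    define T' where "T' = (\<lambda>f. if f = e then s else if f \<in> insert e A then sgr (p - \<tau> e f) else 0)"
    have "T' \<in> TP (insert e A)" unfolding TP_def T'_def using s by blast
    then have "T' \<in> B s" by (simp add: B_def T'_def)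
    moreover have "\<rho> T' = X p" using e(2) by (auto simp: \<rho>_def T'_def X_def)
    ultimately show ?thesis by (metis imageI)
  qed
  have injX: "inj_on (\<lambda>n. X (pos n)) {0..<2 * int d}"
  proof (rule inj_onI)
    fix n m assume nm: "n \<in> {0..<2 * int d}" "m \<in> {0..<2 * int d}" "X (pos n) = X (pos m)"
    have "\<forall>f\<in>A. sgr (pos n - \<tau> e f) = sgr (pos m - \<tau> e f)"
      using fun_cong[OF nm(3)] unfolding X_def by (metis (full_types))
    then have "2 * int d dvd n - m" by (rule enum_distinct[OF en])
    moreover have "\<bar>n - m\<bar> < 2 * int d" using nm by auto
    ultimately show "n = m" using zdvd_not_zless[of "\<bar>n - m\<bar>" "2 * int d"] by auto
  qed
  have "card {x \<in> range (c e). Z x \<inter> A \<noteq> {}} = card {0..<2 * int d}"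
    using bij_betw_same_card[OF enum_points(1)[OF e(1) Ae en]] by simp
  also have "\<dots> = card ((\<lambda>n. X (pos n)) ` {0..<2 * int d})" using card_image[OF injX] by simp
  also have "\<dots> \<le> card (\<rho> ` B 1 \<inter> \<rho> ` B (- 1))"
    using XB fB by (intro card_mono) auto
  finally have 1: "card {x \<in> range (c e). Z x \<inter> A \<noteq> {}} \<le> card (\<rho> ` B 1 \<inter> \<rho> ` B (- 1))" .
  have 2: "card (TP A) \<le> card (\<rho> ` B 1 \<union> \<rho> ` B (- 1))"
    using sub1 fB by (intro card_mono) auto
  have "card (\<rho> ` B 1) + card (\<rho> ` B (- 1)) = card (\<rho> ` B 1 \<union> \<rho> ` B (- 1)) + card (\<rho> ` B 1 \<inter> \<rho> ` B (- 1))"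
    using fB by (intro card_Un_Int) auto
  moreover have "card (\<rho> ` B 1) = card (B 1)" "card (\<rho> ` B (- 1)) = card (B (- 1))"
    using inj by (simp_all add: card_image)
  moreover have "card (B 1 \<union> B (- 1)) = card (B 1) + card (B (- 1))"
    using fB by (intro card_Un_disjoint) (auto simp: B_def)
  moreover have "card (B 1 \<union> B (- 1)) \<le> card (TP (insert e A))"
    using finite_TP[of "insert e A"] finA by (intro card_mono) (auto simp: B_def)
  ultimately show ?thesis using 1 2 by linarith
qed

text \<open>A new circle raises the summands of exactly those vertices where it meets the old ones,
  the points counted in \<open>card_TP_insert\<close>. Truncated subtraction lets vertices off
  \<open>A\<close> contribute 0. For \<open>A = E\<close> the sum is the number of edges minus the
  number of vertices, since a circle has as many arcs as vertices.\<close>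

lemma card_TP_ge:
  assumes "A \<subseteq> E" "A \<noteq> {}"
  shows "2 + (\<Sum>x\<in>V. card (Z x \<inter> A) - 1) \<le> card (TP A)"
proof -
  have "finite A" using assms fin finite_subset by blast
  then show ?thesis using assms(2,1)
  proof (induction A rule: finite_ne_induct)
    case (singleton e)
    define T where "T s = (\<lambda>f. if f = e then s else (0::real))" for s
    have "T s \<in> TP {e}" if "s = 1 \<or> s = - 1" for s
      unfolding TP_def T_def mem_Collect_eq using that
      by (intro bexI[of _ e] exI[of _ 0] exI[of _ s] conjI) auto
    moreover have "T 1 \<noteq> T (- 1)" by (auto simp: T_def fun_eq_iff)
    ultimately have "card {T 1, T (- 1)} \<le> card (TP {e})"
      by (intro card_mono finite_TP) auto
    moreover have "card (Z x \<inter> {e}) - 1 = 0" for x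
      using card_mono[of "{e}" "Z x \<inter> {e}"] by simp
    ultimately show ?case using \<open>T 1 \<noteq> T (- 1)\<close> by simp
  next
    case (insert e A)
    have Ae: "A \<subseteq> E" "e \<in> E" using insert.prems by auto
    have *: "card (Z x \<inter> insert e A) - 1 = (card (Z x \<inter> A) - 1) + (if e \<in> Z x \<and> Z x \<inter> A \<noteq> {} then 1 else 0)" for x
    proof (cases "e \<in> Z x")
      case True
      then have "Z x \<inter> insert e A = insert e (Z x \<inter> A)" by blast
      moreover have "e \<notin> Z x \<inter> A" using insert.hyps by blast
      ultimately have "card (Z x \<inter> insert e A) = Suc (card (Z x \<inter> A))" by simp
      moreover have "0 < card (Z x \<inter> A) \<longleftrightarrow> Z x \<inter> A \<noteq> {}" by (simp add: card_gt_0_iff)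
      ultimately show ?thesis using True by (cases "Z x \<inter> A = {}") simp_all
    qed simp
    have "(\<Sum>x\<in>V. card (Z x \<inter> insert e A) - 1) =
        (\<Sum>x\<in>V. card (Z x \<inter> A) - 1) + card (V \<inter> {x. e \<in> Z x \<and> Z x \<inter> A \<noteq> {}})"
      unfolding * sum.distrib by (simp add: sum.If_cases)
    also have "card (V \<inter> {x. e \<in> Z x \<and> Z x \<inter> A \<noteq> {}}) = card {x \<in> range (c e). Z x \<inter> A \<noteq> {}}"
    proof (rule arg_cong[where f = card], intro equalityI subsetI)
      fix x assume "x \<in> {x \<in> range (c e). Z x \<inter> A \<noteq> {}}"
      then obtain f where "e \<in> Z x" "f \<in> Z x" "f \<in> A" using Ae by (auto simp: Z_def)
      moreover from this have "x \<in> V" using insert.hyps by (intro V_I[of e x f]) auto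
      ultimately show "x \<in> V \<inter> {x. e \<in> Z x \<and> Z x \<inter> A \<noteq> {}}" by blast
    qed (auto simp: Z_def)
    finally show ?case
      using card_TP_insert[OF Ae(1) insert.hyps(2) Ae(2) insert.hyps(3)] insert.IH[OF Ae(1)] by linarith
  qed
qed

end

section \<open>Rotation around a vertex\<close>

lemma doubleton_cancel: "{a, b} = {a, c} \<Longrightarrow> b = c"
  by (simp add: doubleton_eq_iff) metis

context pseudocircles begin

text \<open>The circle \<open>e\<close> carries \<open>2 * dg e\<close> vertices \<open>vt e n\<close>, with \<open>vt e (n + dg e) = - vt e n\<close>, and \<open>edge T e n\<close> says that the
  arc from \<open>vt e n\<close> to \<open>vt e (n + 1)\<close> bounds the cell \<open>T\<close>.  \<open>W T\<close> and \<open>K T\<close> are the walls and the corners of \<open>T\<close>.\<close>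

definition dg :: "'a \<Rightarrow> nat" where "dg e = card ((\<lambda>f. frac (\<tau> e f)) ` (E - {e}))"
definition pos :: "'a \<Rightarrow> int \<Rightarrow> real" where "pos e = (SOME p. is_enum (\<tau> e) (E - {e}) p (dg e))"
definition vt :: "'a \<Rightarrow> int \<Rightarrow> 'p" where "vt e n = c e (pos e n)"
definition edge :: "('a \<Rightarrow> real) \<Rightarrow> 'a \<Rightarrow> int \<Rightarrow> bool" where
  "edge T e n \<longleftrightarrow> e \<in> E \<and> (T e = 1 \<or> T e = - 1) \<and> (\<forall>f\<in>E - {e}. T f = sgr (pos e n - \<tau> e f)) \<and>
     (\<forall>f. f \<notin> E \<longrightarrow> T f = 0)"
definition W :: "('a \<Rightarrow> real) \<Rightarrow> 'a set" where "W T = {e. \<exists>n. edge T e n}"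
definition ends :: "('a \<Rightarrow> real) \<Rightarrow> 'a \<Rightarrow> 'p set" where
  "ends T e = {x. \<exists>n. edge T e n \<and> (x = vt e n \<or> x = vt e (n + 1))}"
definition K :: "('a \<Rightarrow> real) \<Rightarrow> 'p set" where "K T = (\<Union>e\<in>W T. ends T e)"

text \<open>The sectors around a vertex \<open>v\<close> in rotational order: sector \<open>S i\<close> lies between the rays \<open>i\<close> and
  \<open>i + 1\<close>, ray \<open>i\<close> runs along the line \<open>lin i\<close> and ends at \<open>nb i\<close>, and ray \<open>i + mult v\<close> is opposite to ray \<open>i\<close>.\<close>

definition rotation :: "'p \<Rightarrow> (int \<Rightarrow> 'a \<Rightarrow> real) \<Rightarrow> (int \<Rightarrow> 'a) \<Rightarrow> (int \<Rightarrow> 'p) \<Rightarrow> bool" where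
  "rotation v S lin nb \<longleftrightarrow>
     (\<forall>i j. S i = S j \<longleftrightarrow> 2 * int (mult v) dvd i - j) \<and>
     (\<forall>i j. lin i = lin j \<longleftrightarrow> int (mult v) dvd i - j) \<and>
     range lin = Z v \<and>
     range S = {T \<in> TP E. v \<in> K T} \<and>
     (\<forall>i. {e \<in> W (S i). v \<in> ends (S i) e} = {lin i, lin (i + 1)}) \<and>
     (\<forall>i. ends (S i) (lin i) = {v, nb i} \<and> ends (S i) (lin (i + 1)) = {v, nb (i + 1)}) \<and>
     (\<forall>i. \<exists>n. vt (lin i) n = v \<and> {nb i, nb (i + int (mult v))} = {vt (lin i) (n + 1), vt (lin i) (n - 1)})"

end

text \<open>The bound keeps vertices fewer than five steps apart on a circle from being equal or
  antipodal. The meeting points compared in the arguments on triangles and quadrilaterals are two or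
  three steps apart.\<close>

locale nondegenerate_pseudocircles = pseudocircles E c \<sigma> \<tau>
  for E :: "'a set" and c :: "'a \<Rightarrow> real \<Rightarrow> 'p::group_add" and \<sigma> \<tau> +
  assumes dg_ge: "e \<in> E \<Longrightarrow> 5 \<le> dg e"
begin

lemma en: "e \<in> E \<Longrightarrow> is_enum (\<tau> e) (E - {e}) (pos e) (dg e)"
proof -
  assume e: "e \<in> E"
  have "E - {e} \<noteq> {}"
  proof
    assume "E - {e} = {}"
    then have "dg e = 0" by (simp only: dg_def image_empty card.empty)
    with dg_ge[OF e] show False by simp
  qed
  then have "\<exists>p. is_enum (\<tau> e) (E - {e}) p (dg e)"
    using is_enum_exists[of "E - {e}"] fin by (simp add: dg_def)
  then show ?thesis unfolding pos_def by (rule someI_ex)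
qed

lemma vt_eq_iff: "e \<in> E \<Longrightarrow> vt e n = vt e m \<longleftrightarrow> 2 * int (dg e) dvd n - m"
  unfolding vt_def by (rule enum_points(2)[OF _ subset_refl en])

lemma vt_dg: "e \<in> E \<Longrightarrow> vt e (n + int (dg e)) = - vt e n"
  unfolding vt_def by (rule enum_points(3)[OF _ subset_refl en])

lemma vt_Z: "e \<in> E \<Longrightarrow> e \<in> Z (vt e n)"
  by (simp add: Z_def vt_def)

lemma vt_V: "e \<in> E \<Longrightarrow> vt e n \<in> V"
proof -
  assume e: "e \<in> E"
  obtain f where f: "f \<in> E - {e}" "pos e n - \<tau> e f \<in> \<int>" using enum_crossing[OF en[OF e]] by blast
  then have "f \<in> Z (vt e n)" using on_iff[OF e, of f "pos e n"] by (auto simp: Z_def vt_def)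
  with vt_Z[OF e] show ?thesis using f(1) by (intro V_I[of e _ f]) auto
qed

lemma crossing_pos:
  assumes "x \<in> V" "e \<in> Z x" "x = c e t"
  shows "\<exists>n. t = pos e n"
proof -
  have e: "e \<in> E" using assms by (simp add: Z_def)
  obtain a b where "a \<in> Z x" "b \<in> Z x" "a \<noteq> b" using V_D[OF assms(1)] by metis
  then obtain f where f: "f \<in> Z x" "f \<noteq> e" by metis
  then have "t - \<tau> e f \<in> \<int>" using on_iff[OF e, of f t] assms(3) by (auto simp: Z_def)
  then show ?thesis using enum_crossingD[OF en[OF e], of f t] f by (auto simp: Z_def)
qed

lemma vertex_vt: "x \<in> V \<Longrightarrow> e \<in> Z x \<Longrightarrow> \<exists>n. x = vt e n"
proof -
  assume x: "x \<in> V" "e \<in> Z x"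
  then obtain t where "x = c e t" by (auto simp: Z_def)
  with crossing_pos[OF x this] show ?thesis by (auto simp: vt_def)
qed

lemma vt_cong: "e \<in> E \<Longrightarrow> vt e n = vt e m \<Longrightarrow> vt e (n + k) = vt e (m + k)"
  by (simp add: vt_eq_iff)

lemma edge_E: "edge T e n \<Longrightarrow> e \<in> E" by (simp add: edge_def)

lemma edge_cong: "vt e n = vt e m \<Longrightarrow> edge T e n \<longleftrightarrow> edge T e m"
proof -
  assume nm: "vt e n = vt e m"
  have "sgr (pos e n - x) = sgr (pos e m - x)" if e: "e \<in> E" for x
  proof -
    obtain k where "n = m + 2 * int (dg e) * k"
      using nm vt_eq_iff[OF e] by (auto simp: dvd_def algebra_simps)
    then show ?thesis using enum_sgr_periodic[OF en[OF e], of m k x] by simp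
  qed
  then show ?thesis by (auto simp: edge_def)
qed

lemma edge_unique: "edge T e n \<Longrightarrow> edge T e m \<Longrightarrow> vt e n = vt e m"
proof -
  assume nm: "edge T e n" "edge T e m"
  then have "\<forall>f\<in>E - {e}. sgr (pos e n - \<tau> e f) = sgr (pos e m - \<tau> e f)" by (metis edge_def)
  then show ?thesis using enum_distinct[OF en] vt_eq_iff edge_E[OF nm(1)] by blast
qed

lemma ends_eq: "edge T e n \<Longrightarrow> ends T e = {vt e n, vt e (n + 1)}"
  unfolding ends_def using edge_unique edge_E vt_cong by blast

lemma W_E: "e \<in> W T \<Longrightarrow> e \<in> E" by (auto simp: W_def edge_E)

lemma finite_W [simp]: "finite (W T)"
  by (rule finite_subset[OF _ fin]) (auto simp: W_E)

lemma ends_D: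
  assumes "e \<in> W T"
  shows "card (ends T e) = 2" "ends T e \<subseteq> V" "x \<in> ends T e \<Longrightarrow> e \<in> Z x"
    "x \<in> ends T e \<Longrightarrow> - x \<notin> ends T e"
proof -
  obtain n where n: "edge T e n" using assms by (auto simp: W_def)
  have e: "e \<in> E" using W_E[OF assms] .
  have d: "5 \<le> int (dg e)" using dg_ge[OF e] by simp
  have small: "\<not> 2 * int (dg e) dvd z" if "0 < z" "z < 10" for z
    using zdvd_not_zless[of z "2 * int (dg e)"] that d by simp
  have "vt e n \<noteq> vt e (n + 1)" using small[of 1] by (simp add: vt_eq_iff[OF e])
  then show "card (ends T e) = 2" by (simp add: ends_eq[OF n])
  show "ends T e \<subseteq> V" using vt_V[OF e] by (simp add: ends_eq[OF n])
  show "x \<in> ends T e \<Longrightarrow> e \<in> Z x" using vt_Z[OF e] by (auto simp: ends_eq[OF n])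
  have ndvd: "\<not> 2 * int (dg e) dvd int (dg e) + z" if "- 2 \<le> z" "z \<le> 2" for z
    using zdvd_not_zless[of "int (dg e) + z" "2 * int (dg e)"] that d by simp
  show "x \<in> ends T e \<Longrightarrow> - x \<notin> ends T e"
    using ndvd[of 0] ndvd[of 1] ndvd[of "- 1"]
    by (auto simp: ends_eq[OF n] vt_dg[OF e, symmetric] vt_eq_iff[OF e] algebra_simps)
qed

text \<open>Different circles share only an antipodal pair, and the ends of a wall are never
  antipodal.\<close>

lemma ends_Int: "e \<in> W T \<Longrightarrow> f \<in> W T' \<Longrightarrow> e \<noteq> f \<Longrightarrow> x \<in> ends T e \<Longrightarrow> y \<in> ends T e \<Longrightarrow>
    x \<in> ends T' f \<Longrightarrow> y \<in> ends T' f \<Longrightarrow> x = y"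
  using meet_antipodal[of e x y f] ends_D(3,4) by metis

lemma TP_iff_edge: "T \<in> TP E \<longleftrightarrow> (\<exists>e n. edge T e n)"
proof
  assume "T \<in> TP E"
  then obtain e p s where T: "e \<in> E" "s = 1 \<or> s = - 1"
    "T = (\<lambda>f. if f = e then s else if f \<in> E then sgr (p - \<tau> e f) else 0)"
    unfolding TP_def by blast
  obtain n where n: "pos e n \<le> p" "p < pos e (n + 1)" using enum_locate[OF en[OF T(1)]] by blast
  have "edge T e n" unfolding edge_def T(3) using T(1,2) enum_sgr[OF en[OF T(1)] _ n] by auto
  then show "\<exists>e n. edge T e n" by blast
next
  assume "\<exists>e n. edge T e n"
  then obtain e n where e: "edge T e n" by blast
  then have "T = (\<lambda>f. if f = e then T e else if f \<in> E then sgr (pos e n - \<tau> e f) else 0)"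
    by (auto simp: edge_def fun_eq_iff)
  then show "T \<in> TP E" unfolding TP_def using e by (auto simp: edge_def)
qed

text \<open>The vertex next to \<open>v\<close> on a circle \<open>e\<close> lies on a second
  circle. That one misses \<open>v\<close>, because otherwise it would meet \<open>e\<close> outside
  an antipodal pair. Such a circle is the observer from which the lines at \<open>v\<close> get
  their order.\<close>

lemma ex_line_off: "v \<in> V \<Longrightarrow> \<exists>k\<in>E. k \<notin> Z v"
proof -
  assume v: "v \<in> V"
  then obtain e where e: "e \<in> Z v" by (rule V_D)
  then have eE: "e \<in> E" by (simp add: Z_def)
  have d: "5 \<le> int (dg e)" using dg_ge[OF eE] by simp
  obtain n where n: "v = vt e n" using vertex_vt[OF v e] by blast
  obtain a b where "a \<in> Z (vt e (n + 1))" "b \<in> Z (vt e (n + 1))" "a \<noteq> b"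
    using V_D[OF vt_V[OF eE]] by metis
  then obtain f where f: "f \<in> Z (vt e (n + 1))" "f \<noteq> e" by metis
  have "f \<notin> Z v"
  proof
    assume "f \<in> Z v"
    then have "vt e (n + 1) = v \<or> vt e (n + 1) = - v"
      using meet_antipodal[OF e vt_Z[OF eE] _ f(1)] f(2) by blast
    moreover have "\<not> 2 * int (dg e) dvd 1" "\<not> 2 * int (dg e) dvd int (dg e) - 1"
      using zdvd_not_zless[of "int (dg e) - 1" "2 * int (dg e)"] zdvd_not_zless[of 1 "2 * int (dg e)"] d by simp_all
    ultimately show False
      unfolding n vt_dg[OF eE, symmetric] vt_eq_iff[OF eE] using dvd_diff_commute[of "2 * int (dg e)" 1 "int (dg e)"]
      by simp
  qed
  then show ?thesis using f(1) by (auto simp: Z_def)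
qed

section \<open>The lines at a vertex seen from a circle that avoids it\<close>

context
  fixes v k q
  assumes v: "v \<in> V" and k: "k \<in> E" "k \<notin> Z v"
    and q: "is_enum (\<tau> k) (Z v) q (mult v)"
begin

definition line_at :: "int \<Rightarrow> 'a" where "line_at i = (THE f. f \<in> Z v \<and> q i - \<tau> k f \<in> \<int>)"

text \<open>A cell touching \<open>v\<close> has the sign of \<open>v\<close> on each circle that
  avoids \<open>v\<close>. On the circles through \<open>v\<close> it gets the signs just after the
  crossing \<open>q i\<close>, because a walk along \<open>k\<close> passes the lines at
  \<open>v\<close> in the same order as a small loop around \<open>v\<close>.\<close>

definition sector :: "int \<Rightarrow> 'a \<Rightarrow> real" where
  "sector i = (\<lambda>f. if f \<in> Z v then sgr (q i - \<tau> k f) else if f \<in> E then \<sigma> f v else 0)"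

lemma Zv_E: "f \<in> Z v \<Longrightarrow> f \<in> E" "f \<in> Z v \<Longrightarrow> k \<noteq> f" using k by (auto simp: Z_def)

lemma off_k: "c k t \<noteq> v" "c k t \<noteq> - v"
proof -
  have "v \<notin> range (c k)" using k by (simp add: Z_def)
  moreover from this have "- v \<notin> range (c k)" using uminus_range_iff[OF k(1)] by simp
  ultimately show "c k t \<noteq> v" "c k t \<noteq> - v" by (metis rangeI)+
qed

lemma unique_line: "f \<in> Z v \<Longrightarrow> g \<in> Z v \<Longrightarrow> t - \<tau> k f \<in> \<int> \<Longrightarrow> t - \<tau> k g \<in> \<int> \<Longrightarrow> f = g"
proof (rule ccontr)
  assume fg: "f \<in> Z v" "g \<in> Z v" "t - \<tau> k f \<in> \<int>" "t - \<tau> k g \<in> \<int>" "f \<noteq> g"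
  have "f \<in> Z (c k t)" "g \<in> Z (c k t)"
    using on_iff[OF k(1) Zv_E(1)[OF fg(1)] Zv_E(2)[OF fg(1)]] on_iff[OF k(1) Zv_E(1)[OF fg(2)] Zv_E(2)[OF fg(2)]]
      fg(3,4) Zv_E(1)[OF fg(1)] Zv_E(1)[OF fg(2)] by (simp_all add: Z_def)
  from meet_antipodal[OF fg(1) this(1) fg(2) this(2) fg(5)] off_k show False by simp
qed

lemma line_at: "line_at i \<in> Z v" "q i - \<tau> k (line_at i) \<in> \<int>"
proof -
  have "\<exists>!f. f \<in> Z v \<and> q i - \<tau> k f \<in> \<int>" using enum_crossing[OF q] unique_line by blast
  from theI'[OF this] show "line_at i \<in> Z v" "q i - \<tau> k (line_at i) \<in> \<int>" by (auto simp: line_at_def)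
qed

lemma line_at_iff: "f \<in> Z v \<Longrightarrow> q i - \<tau> k f \<in> \<int> \<longleftrightarrow> line_at i = f"
  using line_at unique_line by blast

lemma line_at_eq_iff: "line_at i = line_at j \<longleftrightarrow> int (mult v) dvd i - j"
proof
  assume eq: "line_at i = line_at j"
  have "q j - \<tau> k (line_at i) \<in> \<int>" using line_at(2)[of j] unfolding eq .
  with line_at(2)[of i] have "(q i - \<tau> k (line_at i)) - (q j - \<tau> k (line_at i)) \<in> \<int>"
    by (rule Ints_diff)
  then obtain z where "(q i - \<tau> k (line_at i)) - (q j - \<tau> k (line_at i)) = of_int z" by (elim Ints_cases)
  then have "q i = q (j + int (mult v) * z)" using enum_shift[OF q, of j z] by simp
  then have "i = j + int (mult v) * z" by (simp only: enum_less_iff[OF q])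
  then show "int (mult v) dvd i - j" by simp
next
  assume "int (mult v) dvd i - j"
  then obtain z where "i = j + int (mult v) * z" by (auto simp: dvd_def algebra_simps)
  then have "q i - \<tau> k (line_at j) = (q j - \<tau> k (line_at j)) + of_int z"
    using enum_shift[OF q, of j z] by simp
  also have "\<dots> \<in> \<int>" using line_at(2) by (intro Ints_add Ints_of_int)
  finally show "line_at i = line_at j" using line_at_iff line_at(1) by blast
qed

lemma range_line_at: "range line_at = Z v"
proof (intro equalityI subsetI)
  fix f assume f: "f \<in> Z v"
  then obtain i where "\<tau> k f = q i" using enum_crossingD[OF q f, of "\<tau> k f"] by auto
  then have "q i - \<tau> k f \<in> \<int>" by (metis Ints_0 diff_self)
  then have "line_at i = f" using line_at_iff[OF f] by blast
  then show "f \<in> range line_at" by (metis rangeI)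
qed (use line_at in blast)

lemma sector_eq_iff: "sector i = sector j \<longleftrightarrow> 2 * int (mult v) dvd i - j"
proof
  assume "sector i = sector j"
  then have "\<forall>f\<in>Z v. sgr (q i - \<tau> k f) = sgr (q j - \<tau> k f)" unfolding sector_def by (metis (full_types))
  then show "2 * int (mult v) dvd i - j" by (rule enum_distinct[OF q])
next
  assume "2 * int (mult v) dvd i - j"
  then obtain z where z: "i = j + 2 * int (mult v) * z" by (auto simp: dvd_def algebra_simps)
  show "sector i = sector j" unfolding sector_def z enum_sgr_periodic[OF q] ..
qed

lemma sector_prev:
  "f \<noteq> line_at i \<Longrightarrow> sector (i - 1) f = sector i f"
  "sector (i - 1) (line_at i) = - sector i (line_at i)"
  "sector i (line_at i) = 1 \<or> sector i (line_at i) = - 1"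
proof -
  have gap: "sgr (q (i - 1) - \<tau> k f) = sgl (q i - \<tau> k f)" if "f \<in> Z v" for f
    using enum_sgl[OF q that, of "i - 1" "q i"] by (simp add: enum_less_iff[OF q])
  show "sector (i - 1) f = sector i f" if "f \<noteq> line_at i"
    using gap[of f] line_at_iff[of f i] that sgl_nonint[of "q i - \<tau> k f"] by (auto simp: sector_def)
  show "sector (i - 1) (line_at i) = - sector i (line_at i)"
    using gap[OF line_at(1)] line_at sgl_int by (simp add: sector_def)
  show "sector i (line_at i) = 1 \<or> sector i (line_at i) = - 1"
    using line_at(1) sgr_cases by (simp add: sector_def)
qed

lemma sector_prev_edge:
  "edge (sector i) (line_at i) n \<Longrightarrow> edge (sector (i - 1)) (line_at i) n"
proof -
  assume h: "edge (sector i) (line_at i) n"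
  have "sector (i - 1) (line_at i) = 1 \<or> sector (i - 1) (line_at i) = - 1"
    using sector_prev(2,3)[of i] by auto
  moreover have "sector (i - 1) f = sector i f" if "f \<in> E - {line_at i} \<or> f \<notin> E" for f
    using sector_prev(1)[of f i] that edge_E[OF h] by blast
  ultimately show ?thesis using h by (simp add: edge_def)
qed

text \<open>The circle \<open>e\<close> carries both \<open>v\<close> and the point where
  \<open>k\<close> crosses it. The other circles through \<open>v\<close> meet \<open>e\<close>
  again only at \<open>- v\<close>, so their signs do not change on the way between these two
  points; circles avoiding \<open>v\<close> keep the sign of \<open>v\<close> on the arcs next to
  it. Hence the arc of \<open>e\<close> that leaves \<open>v\<close> towards \<open>k\<close> is a
  wall of \<open>sector i\<close>. The two claims are the two possible directions.\<close>

lemma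
  assumes t: "c k (q i) = c (line_at i) t" and p: "vt (line_at i) n = v"
  shows sector_forward: "pos (line_at i) n < t \<Longrightarrow> t < pos (line_at i) n + 1 \<Longrightarrow> edge (sector i) (line_at i) n"
    and sector_backward: "t < pos (line_at i) n \<Longrightarrow> pos (line_at i) n < t + 1 \<Longrightarrow> edge (sector i) (line_at i) (n - 1)"
proof -
  define e where "e = line_at i"
  define p where "p = pos e n"
  have e: "e \<in> E" using line_at Zv_E by (simp add: e_def)
  have vp: "v = c e p" using p by (simp add: vt_def e_def p_def)
  have Zval: "sector i f = sg (t - \<tau> e f) \<and> p - \<tau> e f \<in> \<int>" if f: "f \<in> Z v" "f \<noteq> e" for f
  proof
    have "q i - \<tau> k f \<notin> \<int>" using line_at_iff[OF f(1)] f(2) by (simp add: e_def)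
    then have "sector i f = sg (q i - \<tau> k f)" using f by (simp add: sector_def sg_nonint)
    also have "\<dots> = \<sigma> f (c e t)" using \<sigma>_c[OF k(1), of f "q i"] Zv_E[OF f(1)] t by (simp add: e_def)
    also have "\<dots> = sg (t - \<tau> e f)" using \<sigma>_c[OF e, of f t] Zv_E[OF f(1)] f(2) by simp
    finally show "sector i f = sg (t - \<tau> e f)" .
    show "p - \<tau> e f \<in> \<int>" using on_iff[OF e, of f p] f vp Zv_E[OF f(1)] by (auto simp: Z_def)
  qed
  have offval: "sector i f = sgr (p - \<tau> e f) \<and> p - \<tau> e f \<notin> \<int>" if f: "f \<in> E" "f \<notin> Z v" for f
  proof -
    have fe: "e \<noteq> f" using f line_at by (auto simp: e_def)
    then have "p - \<tau> e f \<notin> \<int>" using on_iff[OF e f(1), of p] f vp by (auto simp: Z_def)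
    moreover have "sector i f = \<sigma> f v" using f by (simp add: sector_def)
    then have "sector i f = sg (p - \<tau> e f)" using \<sigma>_c[OF e f(1) fe, of p] vp by simp
    ultimately show ?thesis by (simp add: sg_nonint)
  qed
  have noint: "z \<notin> \<int>" if "y \<in> \<int>" "y < z" "z < y + 1" for y z :: real
  proof
    assume "z \<in> \<int>"
    then obtain j where "z = of_int j" by (elim Ints_cases)
    moreover obtain l where "y = of_int l" using \<open>y \<in> \<int>\<close> by (elim Ints_cases)
    ultimately show False using that by simp
  qed
  have val: "sector i e = 1 \<or> sector i e = - 1" "\<forall>f. f \<notin> E \<longrightarrow> sector i f = 0"
    using sector_prev(3)[of i] Zv_E by (auto simp: e_def sector_def)
  show "edge (sector i) (line_at i) n" if "pos (line_at i) n < t" "t < pos (line_at i) n + 1"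
  proof -
    have pt: "p < t" "t < p + 1" using that by (simp_all add: p_def e_def)
    have "sector i f = sgr (p - \<tau> e f)" if f: "f \<in> E - {e}" for f
    proof (cases "f \<in> Z v")
      case True
      then have *: "sector i f = sg (t - \<tau> e f)" "p - \<tau> e f \<in> \<int>" using Zval f by auto
      have "t - \<tau> e f \<notin> \<int>" by (rule noint[OF *(2)]) (use pt in simp_all)
      moreover have "sgr (t - \<tau> e f) = sgr (p - \<tau> e f)"
      proof (rule sgr_const)
        show "z \<notin> \<int>" if "p - \<tau> e f < z" "z \<le> t - \<tau> e f" for z
          by (rule noint[OF *(2)]) (use that pt in simp_all)
      qed (use pt in simp)
      ultimately show ?thesis using * by (simp add: sg_nonint)
    next
      case False
      then show ?thesis using offval f by simp
    qed
    then show ?thesis unfolding edge_def using e val by (simp add: e_def p_def)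
  qed
  show "edge (sector i) (line_at i) (n - 1)" if "t < pos (line_at i) n" "pos (line_at i) n < t + 1"
  proof -
    have pt: "t < p" "p < t + 1" using that by (simp_all add: p_def e_def)
    have "sector i f = sgr (pos e (n - 1) - \<tau> e f)" if f: "f \<in> E - {e}" for f
    proof -
      have "sgr (pos e (n - 1) - \<tau> e f) = sgl (p - \<tau> e f)"
        using enum_sgl[OF en[OF e] f, of "n - 1" p] by (simp add: p_def enum_less_iff[OF en[OF e]])
      also have "\<dots> = sector i f"
      proof (cases "f \<in> Z v")
        case True
        then have *: "sector i f = sg (t - \<tau> e f)" "p - \<tau> e f \<in> \<int>" using Zval f by auto
        have **: "p - \<tau> e f - 1 \<in> \<int>" by (rule Ints_diff[OF *(2) Ints_1])
        have "t - \<tau> e f \<notin> \<int>" by (rule noint[OF **]) (use pt in simp_all)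
        moreover have "sgl (p - \<tau> e f) = sgr (t - \<tau> e f)"
        proof (rule sgl_eq_sgr)
          show "z \<notin> \<int>" if "t - \<tau> e f < z" "z < p - \<tau> e f" for z
            by (rule noint[OF **]) (use that pt in simp_all)
        qed (use pt in simp)
        ultimately show ?thesis using * by (simp add: sg_nonint)
      next
        case False
        then show ?thesis using offval f by (simp add: sgl_nonint)
      qed
      finally show ?thesis ..
    qed
    then show ?thesis unfolding edge_def using e val by (simp add: e_def)
  qed
qed

lemma ray:
  "\<exists>n. vt (line_at i) n = v \<and>
     (edge (sector i) (line_at i) n \<and> edge (sector (i + int (mult v))) (line_at i) (n - 1) \<or>
      edge (sector i) (line_at i) (n - 1) \<and> edge (sector (i + int (mult v))) (line_at i) n)"
proof -
  define e where "e = line_at i"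
  have e: "e \<in> E" "e \<in> Z v" using line_at Zv_E by (auto simp: e_def)
  have opp: "line_at (i + int (mult v)) = e" unfolding e_def line_at_eq_iff by simp
  have "c k (q i) \<in> range (c e)"
    using on_iff[OF k(1) e(1), of "q i"] line_at(2)[of i] Zv_E[OF e(2)] by (simp add: e_def)
  then obtain t where t: "c k (q i) = c e t" by blast
  obtain p0 where p0: "v = c e p0" using e by (auto simp: Z_def)
  have nint: "t \<noteq> p0 + of_int z" for z
    using c_int[OF e(1), of p0 z] t p0 off_k[of "q i"] by (auto split: if_splits)
  \<comment> \<open>An even shift brings the parameter of \<open>v\<close> to within a half turn of
    \<open>t\<close>. The borderline values are excluded because \<open>k\<close> meets neither
    \<open>v\<close> nor \<open>- v\<close>.\<close>
  define z where "z = \<lfloor>(t + 1 - p0) / 2\<rfloor>"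
  define p where "p = p0 + of_int (2 * z)"
  have vp: "v = c e p" using c_int[OF e(1), of p0 "2 * z"] p0 by (simp add: p_def)
  have "of_int z \<le> (t + 1 - p0) / 2" "(t + 1 - p0) / 2 < of_int z + 1" unfolding z_def by linarith+
  then have "t - 1 < p" "p \<le> t + 1" by (simp_all add: p_def)
  moreover have "p \<noteq> t" "p \<noteq> t + 1" using nint[of "2 * z"] nint[of "2 * z - 1"] by (auto simp: p_def)
  ultimately have p: "t - 1 < p" "p < t + 1" "p \<noteq> t" by auto
  obtain n where n: "p = pos e n" using crossing_pos[OF v e(2) vp] by blast
  have vn: "vt e n = v" using vp n by (simp add: vt_def)
  have q': "q (i + int (mult v)) = q i + 1" using enum_shift[OF q, of i 1] by simp
  \<comment> \<open>The opposite ray is seen at the antipodal crossing, which \<open>e\<close>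
    reaches at \<open>t + 1\<close> as well as at \<open>t - 1\<close>; the one on the other side of
    \<open>p\<close> is used.\<close>
  have t': "c k (q (i + int (mult v))) = c e (t + 1)" unfolding q' by (simp add: c_add_1 k e t)
  have t'': "c k (q (i + int (mult v))) = c e (t - 1)"
    using t' c_int[OF e(1), of "t - 1" 2] by (simp add: algebra_simps)
  show ?thesis
  proof (cases "p < t")
    case True
    have "edge (sector i) e n"
      using sector_forward[of i t n] t vn True p n by (simp add: e_def)
    moreover have "edge (sector (i + int (mult v))) e (n - 1)"
      using sector_backward[of "i + int (mult v)" "t - 1" n] t'' vn True p n by (simp add: opp)
    ultimately show ?thesis using vn by (auto simp: e_def)
  next
    case False
    have "edge (sector i) e (n - 1)"
      using sector_backward[of i t n] t vn False p n by (simp add: e_def)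
    moreover have "edge (sector (i + int (mult v))) e n"
      using sector_forward[of "i + int (mult v)" "t + 1" n] t' vn False p n by (simp add: opp)
    ultimately show ?thesis using vn by (auto simp: e_def)
  qed
qed

text \<open>Either arc of \<open>e\<close> at \<open>v\<close> bounds some sector by
  \<open>ray\<close>. A cell at the same arc differs from that sector at most in the sign of
  \<open>e\<close>, and by \<open>sector_prev\<close> this change leads to the preceding
  sector.\<close>

lemma tope_at:
  assumes T: "edge T e n" and vn: "v = vt e n \<or> v = vt e (n + 1)"
  shows "\<exists>j. line_at j = e \<and> (T = sector j \<or> T = sector (j - 1))"
proof -
  have e: "e \<in> E" using edge_E[OF T] .
  then have "e \<in> Z v" using vn vt_Z by blast
  then obtain i where i: "line_at i = e" using range_line_at by (metis imageE)
  have opp: "line_at (i + int (mult v)) = e" using i line_at_eq_iff[of "i + int (mult v)" i] by simp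
  obtain m where m: "vt e m = v" and
    rm: "edge (sector i) e m \<and> edge (sector (i + int (mult v))) e (m - 1) \<or>
      edge (sector i) e (m - 1) \<and> edge (sector (i + int (mult v))) e m"
    using ray[of i] i by blast
  have "edge T e m \<or> edge T e (m - 1)"
  proof (cases "v = vt e n")
    case True
    then show ?thesis using T edge_cong[of e n m] m by simp
  next
    case False
    then have "vt e n = vt e (m - 1)" using vt_cong[OF e, of "n + 1" m "- 1"] m vn by simp
    then show ?thesis using T edge_cong by blast
  qed
  then obtain j l where j: "line_at j = e" "edge (sector j) e l" "edge T e l"
    using rm i opp by blast
  have off: "T f = sector j f" if "f \<noteq> e" for f
  proof (cases "f \<in> E")
    case True
    then have "T f = sgr (pos e l - \<tau> e f)" "sector j f = sgr (pos e l - \<tau> e f)"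
      using j that unfolding edge_def by blast+
    then show ?thesis by simp
  qed (use j in \<open>simp add: edge_def\<close>)
  have "T e = sector j e \<or> T e = sector (j - 1) e"
    using j(2,3) sector_prev(2)[of j] j(1) by (auto simp: edge_def)
  then have "T = sector j \<or> T = sector (j - 1)"
  proof (elim disjE)
    assume "T e = sector j e"
    then have "T f = sector j f" for f using off by (cases "f = e") simp_all
    then show ?thesis by blast
  next
    assume "T e = sector (j - 1) e"
    then have "T f = sector (j - 1) f" for f
      using off sector_prev(1)[of f j] j(1) by (cases "f = e") simp_all
    then show ?thesis by blast
  qed
  then show ?thesis using j(1) by blast
qed

lemma rotation_sector: "\<exists>nb. rotation v sector line_at nb"
proof -
  define m where "m = int (mult v)"
  have "\<exists>x n. vt (line_at i) n = v \<and> 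
      ends (sector i) (line_at i) = {v, x} \<and> ends (sector (i - 1)) (line_at i) = {v, x} \<and>
      {x, y} = {vt (line_at i) (n + 1), vt (line_at i) (n - 1)}" if "ends (sector (i + m)) (line_at i) = {v, y}" for i y
  proof -
    obtain n where n: "vt (line_at i) n = v" and
      r: "edge (sector i) (line_at i) n \<and> edge (sector (i + m)) (line_at i) (n - 1) \<or>
        edge (sector i) (line_at i) (n - 1) \<and> edge (sector (i + m)) (line_at i) n"
      using ray[of i] unfolding m_def by blast
    have e: "line_at i \<in> E" using line_at Zv_E by blast
    from r show ?thesis
    proof (elim disjE conjE)
      assume a: "edge (sector i) (line_at i) n" and b: "edge (sector (i + m)) (line_at i) (n - 1)"
      have "{v, y} = {v, vt (line_at i) (n - 1)}" using ends_eq[OF b] n that by (simp add: insert_commute)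
      then have "y = vt (line_at i) (n - 1)" by (rule doubleton_cancel)
      then show ?thesis
        using n ends_eq[OF a] ends_eq[OF sector_prev_edge[OF a]]
        by (intro exI[of _ "vt (line_at i) (n + 1)"] exI[of _ n]) simp
    next
      assume a: "edge (sector i) (line_at i) (n - 1)" and b: "edge (sector (i + m)) (line_at i) n"
      have "{v, y} = {v, vt (line_at i) (n + 1)}" using ends_eq[OF b] n that by simp
      then have "y = vt (line_at i) (n + 1)" by (rule doubleton_cancel)
      then show ?thesis
        using n ends_eq[OF a] ends_eq[OF sector_prev_edge[OF a]]
        by (intro exI[of _ "vt (line_at i) (n - 1)"] exI[of _ n]) (simp add: insert_commute)
    qed
  qed note nbr = this
  have wall: "line_at i \<in> W (sector i)" for i using ray[of i] unfolding W_def by blast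
  have wall': "line_at (i + 1) \<in> W (sector i)" for i
  proof -
    obtain n where "edge (sector (i + 1)) (line_at (i + 1)) n" using ray[of "i + 1"] by blast
    from sector_prev_edge[OF this] show ?thesis unfolding W_def by (simp only: add_diff_cancel_right' mem_Collect_eq) (rule exI)
  qed
  have vin: "v \<in> ends (sector i) (line_at i)" for i
  proof -
    obtain n where "vt (line_at i) n = v" "edge (sector i) (line_at i) n \<or> edge (sector i) (line_at i) (n - 1)"
      using ray[of i] by blast
    then show ?thesis
      by (elim disjE) (simp_all add: ends_eq[of "sector i" "line_at i" n] ends_eq[of "sector i" "line_at i" "n - 1"])
  qed
  have ex: "\<exists>x. ends (sector i) (line_at i) = {v, x}" for i
  proof -
    obtain a b where "ends (sector i) (line_at i) = {a, b}"
      using ends_D(1)[OF wall, of i] by (auto simp only: card_2_iff)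
    moreover have "v = a \<or> v = b" using vin[of i] calculation by simp
    ultimately show ?thesis by (metis insert_commute)
  qed
  define nb where "nb i = (SOME x. ends (sector i) (line_at i) = {v, x})" for i
  have nb: "ends (sector i) (line_at i) = {v, nb i}" for i
    unfolding nb_def by (rule someI_ex[OF ex])
  have opp: "line_at (i + m) = line_at i" for i by (simp add: line_at_eq_iff m_def)
  have nb2: "ends (sector (i - 1)) (line_at i) = {v, nb i} \<and>
      (\<exists>n. vt (line_at i) n = v \<and> {nb i, nb (i + m)} = {vt (line_at i) (n + 1), vt (line_at i) (n - 1)})" for i
  proof -
    have "ends (sector (i + m)) (line_at i) = {v, nb (i + m)}" using nb[of "i + m"] unfolding opp .
    from nbr[OF this] show ?thesis
    proof (elim exE conjE)
      fix x n assume x: "vt (line_at i) n = v" "ends (sector i) (line_at i) = {v, x}"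
        "ends (sector (i - 1)) (line_at i) = {v, x}"
        "{x, nb (i + m)} = {vt (line_at i) (n + 1), vt (line_at i) (n - 1)}"
      have "{v, x} = {v, nb i}" unfolding x(2)[symmetric] by (rule nb)
      then have "x = nb i" by (rule doubleton_cancel)
      with x(1,3,4) show ?thesis by (intro conjI exI[of _ n]) simp_all
    qed
  qed
  have inc: "{e \<in> W (sector i). v \<in> ends (sector i) e} = {line_at i, line_at (i + 1)}" for i
  proof (intro equalityI subsetI)
    fix e assume "e \<in> {e \<in> W (sector i). v \<in> ends (sector i) e}"
    then obtain n where "edge (sector i) e n" "v = vt e n \<or> v = vt e (n + 1)" by (auto simp: ends_def)
    from tope_at[OF this] obtain j where j: "line_at j = e" "sector i = sector j \<or> sector i = sector (j - 1)" by blast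
    have half: "int (mult v) dvd z" if "2 * int (mult v) dvd z" for z
      using dvd_triv_right that by (rule dvd_trans)
    have "int (mult v) dvd i - j \<or> int (mult v) dvd i - (j - 1)"
      using j(2) half unfolding sector_eq_iff by blast
    moreover have "i - (j - 1) = (i + 1) - j" by simp
    ultimately have "int (mult v) dvd i - j \<or> int (mult v) dvd (i + 1) - j" by metis
    then show "e \<in> {line_at i, line_at (i + 1)}" 
      unfolding line_at_eq_iff[symmetric] j(1) by auto
  next
    fix e assume "e \<in> {line_at i, line_at (i + 1)}"
    then show "e \<in> {e \<in> W (sector i). v \<in> ends (sector i) e}"
      using wall[of i] wall'[of i] vin[of i] nb2[of "i + 1"] by auto
  qed
  have ran: "range sector = {T \<in> TP E. v \<in> K T}"
  proof (intro equalityI subsetI)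
    fix T assume "T \<in> range sector"
    then obtain i where "T = sector i" by blast
    then show "T \<in> {T \<in> TP E. v \<in> K T}" using wall[of i] vin[of i] by (auto simp: K_def TP_iff_edge W_def)
  next
    fix T assume "T \<in> {T \<in> TP E. v \<in> K T}"
    then obtain e n where "edge T e n" "v = vt e n \<or> v = vt e (n + 1)" by (auto simp: K_def ends_def)
    from tope_at[OF this] show "T \<in> range sector" by blast
  qed
  have "rotation v sector line_at nb"
    unfolding rotation_def
  proof (intro conjI allI)
    show "ends (sector i) (line_at (i + 1)) = {v, nb (i + 1)}" for i using nb2[of "i + 1"] by simp
    show "\<exists>n. vt (line_at i) n = v \<and> {nb i, nb (i + int (mult v))} = {vt (line_at i) (n + 1), vt (line_at i) (n - 1)}" for i
      using nb2[of i] by (simp add: m_def)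
  qed (fact sector_eq_iff line_at_eq_iff range_line_at ran inc nb)+
  then show ?thesis by blast
qed

end

lemma rotation_exists: "v \<in> V \<Longrightarrow> \<exists>S lin nb. rotation v S lin nb"
proof -
  assume v: "v \<in> V"
  obtain k where k: "k \<in> E" "k \<notin> Z v" using ex_line_off[OF v] by blast
  have ne: "Z v \<noteq> {}" using v by (auto simp: V_def mult_def)
  obtain q where q: "is_enum (\<tau> k) (Z v) q (card ((\<lambda>f. frac (\<tau> k f)) ` Z v))"
    using is_enum_exists[OF finite_Z ne] by blast
  \<comment> \<open>Two circles through \<open>v\<close> meet only at \<open>v\<close> and
    \<open>- v\<close>, which \<open>k\<close> avoids, so they cross \<open>k\<close> at different
    places, and a half turn of \<open>k\<close> has exactly \<open>mult v\<close> crossings.\<close>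
  have "inj_on (\<lambda>f. frac (\<tau> k f)) (Z v)"
  proof (rule inj_onI, rule ccontr)
    fix f g assume fg: "f \<in> Z v" "g \<in> Z v" "frac (\<tau> k f) = frac (\<tau> k g)" "f \<noteq> g"
    have E: "f \<in> E" "g \<in> E" "k \<noteq> f" "k \<noteq> g" using fg k by (auto simp: Z_def)
    have "\<tau> k f - \<tau> k g \<in> \<int>" using fg(3) by (simp add: Int_minus_frac_iff)
    then have "f \<in> Z (c k (\<tau> k f))" "g \<in> Z (c k (\<tau> k f))"
      using on_iff[OF k(1) E(1,3)] on_iff[OF k(1) E(2,4)] E by (auto simp: Z_def)
    then have "c k (\<tau> k f) = v \<or> c k (\<tau> k f) = - v" using meet_antipodal fg by blast
    then show False using k uminus_range_iff[OF k(1), of v] by (auto simp: Z_def image_iff) metis+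
  qed
  then have "is_enum (\<tau> k) (Z v) q (mult v)" using q by (simp add: card_image mult_def)
  from rotation_sector[OF v k this] show ?thesis by blast
qed

end

section \<open>Cells\<close>

lemma range_periodic:
  fixes f :: "int \<Rightarrow> 'b"
  assumes f: "\<And>i j. f i = f j \<longleftrightarrow> int N dvd i - j" and N: "0 < N"
  shows "range f = f ` {0..<int N}" "inj_on f {0..<int N}" "card (range f) = N"
proof -
  show r: "range f = f ` {0..<int N}"
  proof (intro equalityI subsetI)
    fix y assume "y \<in> range f"
    then obtain i where i: "y = f i" by blast
    have "f i = f (i mod int N)" unfolding f by (simp add: dvd_minus_mod)
    then show "y \<in> f ` {0..<int N}" using i N by auto
  qed blast
  show inj: "inj_on f {0..<int N}"
  proof (rule inj_onI)
    fix i j assume ij: "i \<in> {0..<int N}" "j \<in> {0..<int N}" "f i = f j"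
    then have "int N dvd i - j" by (simp add: f)
    moreover have "\<bar>i - j\<bar> < int N" using ij by auto
    ultimately show "i = j" using zdvd_not_zless[of "\<bar>i - j\<bar>" "int N"] by auto
  qed
  show "card (range f) = N" unfolding r using card_image[OF inj] by simp
qed

lemma sum_card_swap:
  assumes "finite A" "finite B"
  shows "(\<Sum>a\<in>A. card {b \<in> B. R a b}) = (\<Sum>b\<in>B. card {a \<in> A. R a b})"
  using sum.swap_restrict[OF assms, of "\<lambda>_ _. 1 :: nat" R] by simp

section \<open>Walls and corners of a cell\<close>

context nondegenerate_pseudocircles begin

lemma K_I: "e \<in> W T \<Longrightarrow> x \<in> ends T e \<Longrightarrow> x \<in> K T" by (auto simp: K_def)

lemma K_V: "K T \<subseteq> V" using ends_D(2) by (auto simp: K_def)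

lemma finite_K [simp]: "finite (K T)" using K_V finite_V by (rule finite_subset)

lemma mult_V: "x \<in> V \<Longrightarrow> 2 \<le> mult x" by (simp add: V_def)

lemma card_topes_at: "v \<in> V \<Longrightarrow> card {T \<in> TP E. v \<in> K T} = 2 * mult v"
proof -
  assume v: "v \<in> V"
  obtain S lin nb where "rotation v S lin nb" using rotation_exists[OF v] by blast
  then have r: "range S = {T \<in> TP E. v \<in> K T}" and s: "\<And>i j. S i = S j \<longleftrightarrow> int (2 * mult v) dvd i - j"
    unfolding rotation_def by simp_all
  show ?thesis using range_periodic(3)[of S, OF s] mult_V[OF v] unfolding r by simp
qed

lemma two_walls_at:
  assumes T: "T \<in> TP E" and v: "v \<in> K T"
  shows "card {e \<in> W T. v \<in> ends T e} = 2"
proof -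
  have vV: "v \<in> V" using K_V v by blast
  obtain S lin nb where rot: "rotation v S lin nb" using rotation_exists[OF vV] by blast
  then have "T \<in> range S" using T v unfolding rotation_def by simp
  then obtain i where i: "T = S i" by blast
  have "\<not> int (mult v) dvd i - (i + 1)"
    using mult_V[OF vV] zdvd_not_zless[of 1 "int (mult v)"] by simp
  then have "lin i \<noteq> lin (i + 1)" using rot unfolding rotation_def by blast
  moreover have "{e \<in> W T. v \<in> ends T e} = {lin i, lin (i + 1)}"
    using rot unfolding rotation_def i by blast
  ultimately show ?thesis by simp
qed

text \<open>Double counting of incidences: every wall has two ends and every corner lies on two
  walls.\<close>

lemma card_K: "T \<in> TP E \<Longrightarrow> card (K T) = card (W T)"
proof -
  assume T: "T \<in> TP E"
  have "card {v \<in> K T. v \<in> ends T e} = 2" if "e \<in> W T" for e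
  proof -
    have "{v \<in> K T. v \<in> ends T e} = ends T e" using K_I[OF that] by blast
    then show ?thesis using ends_D(1)[OF that] by simp
  qed
  then have "(\<Sum>e\<in>W T. card {v \<in> K T. v \<in> ends T e}) = 2 * card (W T)" by simp
  moreover have "(\<Sum>v\<in>K T. card {e \<in> W T. v \<in> ends T e}) = 2 * card (K T)"
    using two_walls_at[OF T] by simp
  ultimately show ?thesis using sum_card_swap[of "W T" "K T" "\<lambda>e v. v \<in> ends T e"] by simp
qed

lemma other_wall:
  assumes T: "T \<in> TP E" and e: "e \<in> W T" "x \<in> ends T e"
  obtains f where "f \<in> W T" "f \<noteq> e" "x \<in> ends T f" "{g \<in> W T. x \<in> ends T g} = {e, f}"
proof -
  have "card {g \<in> W T. x \<in> ends T g} = 2" using two_walls_at[OF T K_I[OF e]] .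
  then obtain a b where ab: "{g \<in> W T. x \<in> ends T g} = {a, b}" "a \<noteq> b" by (auto simp only: card_2_iff)
  then have "e = a \<or> e = b" using e by blast
  then show ?thesis
  proof
    assume "e = a"
    then show ?thesis using ab that[of b] by blast
  next
    assume "e = b"
    then show ?thesis using ab that[of a] by blast
  qed
qed

lemma Z_mult_2:
  assumes "mult x = 2" "e \<in> Z x" "f \<in> Z x" "f \<noteq> e"
  shows "Z x = {e, f}"
proof -
  have "card {e, f} = card (Z x)" using assms by (simp add: mult_def)
  then show ?thesis using card_subset_eq[of "Z x" "{e, f}"] assms by simp
qed

lemma ends_pair:
  assumes "e \<in> W T" "u \<in> ends T e"
  obtains x where "ends T e = {u, x}" "x \<noteq> u"
proof -
  obtain a b where "ends T e = {a, b}" "a \<noteq> b" using ends_D(1)[OF assms(1)] by (auto simp only: card_2_iff)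
  then show ?thesis using that[of a] that[of b] assms(2) by (auto simp: insert_commute)
qed

lemma W_ne: "T \<in> TP E \<Longrightarrow> \<exists>e. e \<in> W T" by (auto simp: TP_iff_edge W_def)

text \<open>This local step takes the place of a cyclic listing of the boundary. The walls next to
  \<open>e\<close> end away from \<open>e\<close>, since by \<open>ends_Int\<close> they share only
  one vertex with it.\<close>

lemma neighbours:
  assumes T: "T \<in> TP E" and e: "e \<in> W T" "ends T e = {u, w}" "u \<noteq> w"
  obtains f g p q where "f \<in> W T" "g \<in> W T" "f \<noteq> e" "g \<noteq> e" "f \<noteq> g"
    "ends T f = {u, p}" "ends T g = {w, q}" "p \<noteq> u" "p \<noteq> w" "q \<noteq> u" "q \<noteq> w"
    "{h \<in> W T. u \<in> ends T h} = {e, f}" "{h \<in> W T. w \<in> ends T h} = {e, g}"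
proof -
  have uw: "u \<in> ends T e" "w \<in> ends T e" using e by auto
  obtain f where f: "f \<in> W T" "f \<noteq> e" "u \<in> ends T f" "{h \<in> W T. u \<in> ends T h} = {e, f}"
    by (rule other_wall[OF T e(1) uw(1)])
  obtain g where g: "g \<in> W T" "g \<noteq> e" "w \<in> ends T g" "{h \<in> W T. w \<in> ends T h} = {e, g}"
    by (rule other_wall[OF T e(1) uw(2)])
  have wf: "w \<notin> ends T f" using ends_Int[OF e(1) f(1) f(2)[symmetric] uw f(3)] e(3) by blast
  have ug: "u \<notin> ends T g" using ends_Int[OF e(1) g(1) g(2)[symmetric] uw(2,1) g(3)] e(3) by blast
  obtain p where p: "ends T f = {u, p}" "p \<noteq> u" using ends_pair[OF f(1,3)] .
  obtain q where q: "ends T g = {w, q}" "q \<noteq> w" using ends_pair[OF g(1,3)] .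
  have "f \<noteq> g" using f(3) ug by blast
  moreover have "p \<noteq> w" "q \<noteq> u" using wf ug p q by auto
  ultimately show ?thesis using that f g p q by blast
qed

lemma card_W_ge_3: "T \<in> TP E \<Longrightarrow> 3 \<le> card (W T)"
proof -
  assume T: "T \<in> TP E"
  then obtain e where e: "e \<in> W T" using W_ne by blast
  obtain u w where uw: "ends T e = {u, w}" "u \<noteq> w" using ends_D(1)[OF e] by (auto simp only: card_2_iff)
  from neighbours[OF T e uw] obtain f g where "f \<in> W T" "g \<in> W T" "f \<noteq> e" "g \<noteq> e" "f \<noteq> g" by metis
  then have "card {e, f, g} \<le> card (W T)" using e by (intro card_mono) auto
  then show ?thesis using \<open>f \<noteq> e\<close> \<open>g \<noteq> e\<close> \<open>f \<noteq> g\<close> by simp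
qed

section \<open>Walls with a triangle behind them\<close>

definition tri :: "('a \<Rightarrow> real) \<Rightarrow> bool" where "tri T \<longleftrightarrow> card (W T) = 3"
definition flip :: "('a \<Rightarrow> real) \<Rightarrow> 'a \<Rightarrow> 'a \<Rightarrow> real" where "flip T e = T(e := - T e)"
definition two_wall :: "('a \<Rightarrow> real) \<Rightarrow> 'a \<Rightarrow> bool" where
  "two_wall T e \<longleftrightarrow> e \<in> W T \<and> (\<forall>x\<in>ends T e. mult x = 2)"
text \<open>The walls through which \<open>T\<close> is charged by triangles; the arguments on walls
  between double points amount to bounding the size of this set.\<close>

definition D :: "('a \<Rightarrow> real) \<Rightarrow> 'a set" where "D T = {e. two_wall T e \<and> tri (flip T e)}"

lemma triangle:
  assumes T: "T \<in> TP E" "tri T" and e: "e \<in> W T" "ends T e = {u, w}" "u \<noteq> w"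
  obtains f g x where "W T = {e, f, g}" "f \<noteq> e" "g \<noteq> e" "f \<noteq> g"
    "ends T f = {u, x}" "ends T g = {w, x}" "x \<noteq> u" "x \<noteq> w" "K T = {u, w, x}"
proof (rule neighbours[OF T(1) e])
  fix f g p q
  assume fg: "f \<in> W T" "g \<in> W T" "f \<noteq> e" "g \<noteq> e" "f \<noteq> g" "ends T f = {u, p}" "ends T g = {w, q}"
    "p \<noteq> u" "p \<noteq> w" "q \<noteq> u" "q \<noteq> w"
  have W: "W T = {e, f, g}"
    using T(2) card_subset_eq[of "W T" "{e, f, g}"] fg e(1) by (simp add: tri_def)
  have "p \<in> ends T f" using fg(6) by simp
  from other_wall[OF T(1) fg(1) this] obtain h where h: "h \<in> W T" "h \<noteq> f" "p \<in> ends T h" by metis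
  have "h \<noteq> e" using h(3) e(2) fg by auto
  then have "h = g" using h W by auto
  then have pq: "p = q" using h fg by auto
  have "K T = {u, w, p}" unfolding K_def W using e(2) fg(6,7) pq by auto
  then show thesis using that[OF W fg(3-5)] fg pq by simp
qed

lemma edge_flip: "e \<in> E \<Longrightarrow> edge (flip T e) e n \<longleftrightarrow> edge T e n"
  by (auto simp: edge_def flip_def)

lemma flip_wall:
  assumes "e \<in> W T"
  shows "e \<in> W (flip T e)" "ends (flip T e) e = ends T e" "flip T e \<in> TP E" "T \<in> TP E"
proof -
  obtain n where "edge T e n" using assms by (auto simp: W_def)
  then have "edge (flip T e) e n" by (simp only: edge_flip[OF W_E[OF assms]])
  then show 1: "e \<in> W (flip T e)" by (auto simp: W_def)
  show "ends (flip T e) e = ends T e" unfolding ends_def using edge_flip[OF W_E[OF assms]] by simp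
  show "flip T e \<in> TP E" "T \<in> TP E" using 1 assms by (auto simp: TP_iff_edge W_def)
qed

lemma flip_flip [simp]: "flip (flip T e) e = T" by (simp add: flip_def)

lemma two_wall_flip: "two_wall T e \<Longrightarrow> two_wall (flip T e) e"
  by (simp add: two_wall_def flip_wall)

lemma edge_at:
  assumes "edge T f n" "ends T f = {vt f a, x}"
  shows "(edge T f a \<and> x = vt f (a + 1)) \<or> (edge T f (a - 1) \<and> x = vt f (a - 1))"
proof -
  have f: "f \<in> E" using edge_E[OF assms(1)] .
  have *: "{vt f a, x} = {vt f n, vt f (n + 1)}" using ends_eq[OF assms(1)] assms(2) by simp
  then consider "vt f a = vt f n" "x = vt f (n + 1)" | "vt f a = vt f (n + 1)" "x = vt f n"
    by (auto simp: doubleton_eq_iff)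
  then show ?thesis
  proof cases
    case 1
    then show ?thesis using edge_cong[of f a n T] assms(1) vt_cong[OF f 1(1), of 1] by simp
  next
    case 2
    then have "vt f (a - 1) = vt f n" using vt_cong[OF f 2(1), of "- 1"] by simp
    then show ?thesis using edge_cong[of f "a - 1" n T] assms(1) 2 by simp
  qed
qed

text \<open>Only two arcs of \<open>f\<close> start at a given vertex. An arc of \<open>f\<close>
  determines the sign of \<open>g\<close>, so cells that differ there use different arcs, and these
  leave the vertex in opposite directions.\<close>

lemma opposite_ends:
  assumes T: "f \<in> W T" "f \<in> W T'" and ne: "g \<in> E" "g \<noteq> f" "T g \<noteq> T' g"
    and x: "ends T f = {vt f a, x}" and y: "ends T' f = {vt f a, y}"
  shows "\<exists>s. (s = 1 \<or> s = - 1) \<and> x = vt f (a + s) \<and> y = vt f (a - s)"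
proof -
  have diff: "\<not> (edge T f n \<and> edge T' f n)" for n using ne by (auto simp: edge_def)
  obtain n n' where "edge T f n" "edge T' f n'" using T by (auto simp: W_def)
  from edge_at[OF this(1) x] edge_at[OF this(2) y]
  consider "x = vt f (a + 1)" "y = vt f (a - 1)" | "x = vt f (a - 1)" "y = vt f (a + 1)"
    using diff by blast
  then show ?thesis
  proof cases
    case 1 then show ?thesis by (intro exI[of _ 1]) simp
  next
    case 2 then show ?thesis by (intro exI[of _ "- 1"]) simp
  qed
qed

lemma vt_far:
  assumes "f \<in> E" "0 < \<bar>n - m\<bar>" "\<bar>n - m\<bar> < 5"
  shows "vt f n \<noteq> vt f m" "vt f n \<noteq> - vt f m"
proof -
  have d: "5 \<le> int (dg f)" using dg_ge[OF assms(1)] by simp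
  have nd: "\<not> 2 * int (dg f) dvd z" if "0 < \<bar>z\<bar>" "\<bar>z\<bar> < 2 * int (dg f)" for z
    using zdvd_not_zless[of "\<bar>z\<bar>" "2 * int (dg f)"] that by simp
  show "vt f n \<noteq> vt f m" unfolding vt_eq_iff[OF assms(1)] by (rule nd) (use assms d in linarith)+
  show "vt f n \<noteq> - vt f m" unfolding vt_dg[OF assms(1), symmetric] vt_eq_iff[OF assms(1)]
    by (rule nd) (use assms d in linarith)+
qed

text \<open>Only two circles pass through a double point, so the sides of the triangle behind
  \<open>e\<close> continue the walls \<open>f\<close> and \<open>g\<close> of \<open>T\<close> and
  meet at its apex \<open>x\<close>.\<close>

lemma D_apex:
  assumes e: "e \<in> D T" and uw: "ends T e = {u, w}" "u \<noteq> w"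
    and f: "f \<in> W T" "f \<noteq> e" "u \<in> ends T f" and g: "g \<in> W T" "g \<noteq> e" "w \<in> ends T g"
  obtains x where "f \<in> W (flip T e)" "g \<in> W (flip T e)" "ends (flip T e) f = {u, x}" "ends (flip T e) g = {w, x}"
proof -
  have eW: "e \<in> W T" and m: "mult u = 2" "mult w = 2" and t: "tri (flip T e)"
    using e uw by (auto simp: D_def two_wall_def)
  have Zu: "Z u = {e, f}" using Z_mult_2[OF m(1)] ends_D(3)[OF eW] ends_D(3)[OF f(1,3)] uw f(2) by blast
  have Zw: "Z w = {e, g}" using Z_mult_2[OF m(2)] ends_D(3)[OF eW] ends_D(3)[OF g(1,3)] uw g(2) by blast
  have "ends (flip T e) e = {u, w}" using flip_wall(2)[OF eW] uw by simp
  from triangle[OF flip_wall(3)[OF eW] t flip_wall(1)[OF eW] this uw(2)]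
  obtain f' g' x where t: "W (flip T e) = {e, f', g'}" "f' \<noteq> e" "g' \<noteq> e" "f' \<noteq> g'"
    "ends (flip T e) f' = {u, x}" "ends (flip T e) g' = {w, x}" by metis
  have "f' \<in> Z u" using ends_D(3)[of f' "flip T e" u] t by simp
  then have "f' = f" using Zu t by auto
  moreover have "g' \<in> Z w" using ends_D(3)[of g' "flip T e" w] t by simp
  then have "g' = g" using Zw t by auto
  ultimately show ?thesis using that t by simp
qed

lemma sign_nz: "e \<in> W T \<Longrightarrow> T e \<noteq> 0" by (auto simp: W_def edge_def)

lemma flip_neq: "e \<in> W T \<Longrightarrow> T e \<noteq> flip T e e" using sign_nz by (simp add: flip_def)

text \<open>Otherwise the other two circles of the triangle would meet on both sides of
  \<open>e\<close>, at points two steps apart on \<open>f\<close>, whereas two circles meet only in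
  an antipodal pair.\<close>

lemma tri_D_empty:
  assumes T: "T \<in> TP E" "tri T"
  shows "D T = {}"
proof (rule ccontr)
  assume "D T \<noteq> {}"
  then obtain e where e: "e \<in> D T" by blast
  then have eW: "e \<in> W T" by (simp add: D_def two_wall_def)
  obtain u w where uw: "ends T e = {u, w}" "u \<noteq> w" using ends_D(1)[OF eW] by (auto simp only: card_2_iff)
  from triangle[OF T eW uw] obtain f g x where t: "W T = {e, f, g}" "f \<noteq> e" "g \<noteq> e" "f \<noteq> g"
    "ends T f = {u, x}" "ends T g = {w, x}" by metis
  obtain y where y: "f \<in> W (flip T e)" "g \<in> W (flip T e)" "ends (flip T e) f = {u, y}" "ends (flip T e) g = {w, y}"
    using D_apex[OF e uw, of f g] t by auto
  have fE: "f \<in> E" using W_E t(1) by blast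
  have "u \<in> V" "f \<in> Z u" using ends_D(2,3)[of f T] t by auto
  then obtain a where a: "u = vt f a" using vertex_vt by blast
  obtain s where s: "s = 1 \<or> s = - 1" "x = vt f (a + s)" "y = vt f (a - s)"
    using opposite_ends[of f T "flip T e" e a x y] t y a flip_neq[OF eW] W_E[OF eW] by auto
  have "f \<in> Z x" "f \<in> Z y" "g \<in> Z x" "g \<in> Z y"
    using ends_D(3)[of f T x] ends_D(3)[of g T x] ends_D(3)[of f "flip T e" y] ends_D(3)[of g "flip T e" y] t y by simp_all
  then have "x = y \<or> x = - y" using meet_antipodal[of f y x g] t(4) by blast
  then show False using vt_far[OF fE, of "a + s" "a - s"] s by auto
qed

text \<open>If opposite walls both had a triangle behind them, the remaining two circles would meet
  beyond either wall, at points three steps apart on \<open>f\<close>; these can be neither equal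
  nor antipodal.\<close>

lemma quad_opposite:
  assumes T: "T \<in> TP E" "card (W T) = 4" and e: "e \<in> D T"
  shows "\<exists>g\<in>W T. g \<notin> D T \<and> ends T g \<inter> ends T e = {}"
proof -
  have eW: "e \<in> W T" using e by (simp add: D_def two_wall_def)
  obtain u w where uw: "ends T e = {u, w}" "u \<noteq> w" using ends_D(1)[OF eW] by (auto simp only: card_2_iff)
  show ?thesis
  proof (rule neighbours[OF T(1) eW uw])
    fix f h p q
    assume fh: "f \<in> W T" "h \<in> W T" "f \<noteq> e" "h \<noteq> e" "f \<noteq> h" "ends T f = {u, p}" "ends T h = {w, q}"
      "p \<noteq> u" "p \<noteq> w" "q \<noteq> u" "q \<noteq> w"
      and at: "{k \<in> W T. u \<in> ends T k} = {e, f}" "{k \<in> W T. w \<in> ends T k} = {e, h}"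
    have "card (W T - {e, f, h}) = 1"
      using fh eW T(2) by (subst card_Diff_subset) auto
    then obtain g where g: "W T - {e, f, h} = {g}" by (rule card_1_singletonE)
    then have W: "W T = {e, f, h, g}" and gn: "g \<noteq> e" "g \<noteq> f" "g \<noteq> h" using fh eW by auto
    have pf: "p \<in> ends T f" and qh: "q \<in> ends T h" using fh by simp_all
    obtain k where k: "k \<in> W T" "k \<noteq> f" "p \<in> ends T k" "{k \<in> W T. p \<in> ends T k} = {f, k}"
      by (rule other_wall[OF T(1) fh(1) pf])
    obtain l where l: "l \<in> W T" "l \<noteq> h" "q \<in> ends T l" "{k \<in> W T. q \<in> ends T k} = {h, l}"
      by (rule other_wall[OF T(1) fh(2) qh])
    have ke: "k \<noteq> e" using k(3) uw fh by auto
    have le: "l \<noteq> e" using l(3) uw fh by auto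
    \<comment> \<open>If the boundary closed up after \<open>e\<close>, \<open>f\<close>,
      \<open>h\<close>, no corner would be left for the fourth wall: each of \<open>u\<close>,
      \<open>w\<close>, \<open>p\<close> already lies on two of these three.\<close>
    have pq: "p \<noteq> q"
    proof
      assume pq: "p = q"
      have "card (ends T g) = 2" using ends_D(1)[of g T] W by blast
      then obtain y where y: "y \<in> ends T g" by (auto simp only: card_2_iff)
      have "g \<in> W T" using W by blast
      from other_wall[OF T(1) this y] obtain j where j: "j \<in> W T" "j \<noteq> g" "y \<in> ends T j" by metis
      then consider "y = u" | "y = w" | "y = p" using W uw fh pq by auto
      moreover have gy: "g \<in> {k \<in> W T. y \<in> ends T k}" using W y by blast
      moreover have "h \<in> {f, k}" using fh(2) qh unfolding k(4)[symmetric] pq by simp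
      then have atp: "{k \<in> W T. p \<in> ends T k} = {f, h}" using k(4) fh(5) by auto
      ultimately show False
      proof cases
        case 1 then show ?thesis using gy gn unfolding 1 at(1) by simp
      next
        case 2 then show ?thesis using gy gn unfolding 2 at(2) by simp
      next
        case 3 then show ?thesis using gy gn unfolding 3 atp by simp
      qed
    qed
    have "k = g" using k W ke fh pq by auto
    moreover have "l = g" using l W le fh pq by auto
    ultimately have pg: "p \<in> ends T g" "q \<in> ends T g" and atp: "{k \<in> W T. p \<in> ends T k} = {f, g}" "{k \<in> W T. q \<in> ends T k} = {h, g}"
      using k l by simp_all
    have gW: "g \<in> W T" using W by blast
    have eg: "ends T g = {p, q}"
    proof -
      obtain z where "ends T g = {p, z}" using ends_pair[OF gW pg(1)] by blast
      then show ?thesis using pg(2) pq by auto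
    qed
    have "g \<notin> D T"
    proof
      assume gD: "g \<in> D T"
      obtain x where x: "f \<in> W (flip T e)" "h \<in> W (flip T e)" "ends (flip T e) f = {u, x}" "ends (flip T e) h = {w, x}"
        using D_apex[OF e uw, of f h] fh by auto
      obtain y where y: "f \<in> W (flip T g)" "h \<in> W (flip T g)" "ends (flip T g) f = {p, y}" "ends (flip T g) h = {q, y}"
        using D_apex[OF gD eg pq, of f h] fh gn by auto
      have fE: "f \<in> E" using W_E fh(1) by blast
      have "u \<in> V" "f \<in> Z u" using ends_D(2,3)[OF fh(1)] fh(6) by auto
      then obtain a where a: "u = vt f a" using vertex_vt by blast
      obtain s where s: "s = 1 \<or> s = - 1" "p = vt f (a + s)" "x = vt f (a - s)"
        using opposite_ends[of f T "flip T e" e a p x] fh x a flip_neq[OF eW] W_E[OF eW] by auto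
      have "ends T f = {vt f (a + s), u}" using fh(6) s by auto
      then obtain s' where s': "s' = 1 \<or> s' = - 1" "u = vt f (a + s + s')" "y = vt f (a + s - s')"
        using opposite_ends[of f T "flip T g" g "a + s" u y] fh y s gn flip_neq[OF gW] W_E[OF gW] by auto
      have "s' = - s"
      proof (rule ccontr)
        assume "s' \<noteq> - s"
        then have "s' = s" using s s' by auto
        then have "vt f (a + s + s') \<noteq> vt f a" using s by (intro vt_far fE) auto
        then show False using s' a by simp
      qed
      then have yy: "y = vt f (a + 2 * s)" using s' by (simp add: algebra_simps)
      have "f \<in> Z x" "f \<in> Z y" "h \<in> Z x" "h \<in> Z y"
        using ends_D(3)[OF x(1), of x] ends_D(3)[OF x(2), of x] ends_D(3)[OF y(1), of y] ends_D(3)[OF y(2), of y] x y by simp_all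
      then have "x = y \<or> x = - y" using meet_antipodal[of f y x h] fh(5) by blast
      then show False using vt_far[OF fE, of "a - s" "a + 2 * s"] s yy by auto
    qed
    then show ?thesis using gW eg uw fh by (intro bexI[of _ g]) auto
  qed
qed

lemma D_W: "D T \<subseteq> W T" by (auto simp: D_def two_wall_def)

text \<open>If \<open>g\<close> were the only wall outside \<open>D T\<close>, a wall next to
  \<open>g\<close> would still need an opposite wall outside \<open>D T\<close>, but the only
  candidate \<open>g\<close> is adjacent to it.\<close>

lemma quad_D:
  assumes T: "T \<in> TP E" "card (W T) = 4"
  shows "card (D T) \<le> 2"
proof (rule ccontr)
  assume "\<not> card (D T) \<le> 2"
  then have c3: "3 \<le> card (D T)" by simp
  then obtain e where "e \<in> D T" by fastforce
  from quad_opposite[OF T this] obtain g where g: "g \<in> W T" "g \<notin> D T" by blast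
  have "card (D T) \<le> card (W T - {g})" using D_W g by (intro card_mono) auto
  moreover have cW: "card (W T - {g}) = 3" using g T(2) by simp
  ultimately have "D T = W T - {g}" using c3 D_W g by (intro card_subset_eq) auto
  then have WD: "W T = insert g (D T)" using g by blast
  obtain y where y: "y \<in> ends T g" using ends_D(1)[OF g(1)] by (auto simp only: card_2_iff)
  from other_wall[OF T(1) g(1) y] obtain j where j: "j \<in> W T" "j \<noteq> g" "y \<in> ends T j" by metis
  then have "j \<in> D T" using WD by blast
  from quad_opposite[OF T this] obtain h where h: "h \<in> W T" "h \<notin> D T" "ends T h \<inter> ends T j = {}" by blast
  then have "h = g" using WD by blast
  then show False using h y j by blast
qed

section \<open>Counting double corners\<close>

definition corners :: "nat \<Rightarrow> ('a \<Rightarrow> real) \<Rightarrow> 'p set" where "corners m T = {x \<in> K T. mult x = m}"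

lemma finite_corners [simp]: "finite (corners m T)" by (simp add: corners_def)

lemma card_two_walls_le: "T \<in> TP E \<Longrightarrow> card {e. two_wall T e} \<le> card (corners 2 T)"
proof -
  assume T: "T \<in> TP E"
  have fin2: "finite {e. two_wall T e}" by (rule finite_subset[OF _ finite_W[of T]]) (auto simp: two_wall_def)
  have "2 * card {e. two_wall T e} = (\<Sum>e\<in>{e. two_wall T e}. card {x \<in> corners 2 T. x \<in> ends T e})"
  proof -
    have "card {x \<in> corners 2 T. x \<in> ends T e} = 2" if "two_wall T e" for e
    proof -
      have "{x \<in> corners 2 T. x \<in> ends T e} = ends T e"
        using that K_I[of e T] by (auto simp: corners_def two_wall_def)
      then show ?thesis using ends_D(1)[of e T] that by (simp add: two_wall_def)
    qed
    then show ?thesis by simp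
  qed
  also have "\<dots> = (\<Sum>x\<in>corners 2 T. card {e \<in> {e. two_wall T e}. x \<in> ends T e})"
    by (rule sum_card_swap[OF fin2 finite_corners])
  also have "\<dots> \<le> (\<Sum>x\<in>corners 2 T. 2)"
  proof (rule sum_mono)
    fix x assume "x \<in> corners 2 T"
    then have "card {e \<in> W T. x \<in> ends T e} = 2" using two_walls_at[OF T] by (simp add: corners_def)
    moreover have "card {e \<in> {e. two_wall T e}. x \<in> ends T e} \<le> card {e \<in> W T. x \<in> ends T e}"
      by (intro card_mono) (auto simp: two_wall_def)
    ultimately show "card {e \<in> {e. two_wall T e}. x \<in> ends T e} \<le> 2" by simp
  qed
  finally show ?thesis by simp
qed

lemma card_D_le: "T \<in> TP E \<Longrightarrow> card (D T) \<le> card (corners 2 T)"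
proof -
  assume T: "T \<in> TP E"
  have "finite {e. two_wall T e}" by (rule finite_subset[OF _ finite_W[of T]]) (auto simp: two_wall_def)
  then have "card (D T) \<le> card {e. two_wall T e}" by (rule card_mono) (auto simp: D_def)
  then show ?thesis using card_two_walls_le[OF T] by simp
qed

lemma card_corners_le: "T \<in> TP E \<Longrightarrow> card (corners m T) \<le> card (W T)"
  using card_K[of T] card_mono[of "K T" "corners m T"] by (auto simp: corners_def)

text \<open>Any two corners of a triangle are joined by a wall, so 0, 1, 2, 3 double corners give 0,
  0, 1, 3 walls between double points.\<close>

lemma tri_two_walls:
  assumes T: "T \<in> TP E" "tri T"
  shows "card (corners 2 T) \<le> 1 + card {e. two_wall T e}" "card (corners 2 T) = 3 \<Longrightarrow> card {e. two_wall T e} = 3"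
proof -
  obtain e where eW: "e \<in> W T" using W_ne[OF T(1)] by blast
  obtain u w where uw: "ends T e = {u, w}" "u \<noteq> w" using ends_D(1)[OF eW] by (auto simp only: card_2_iff)
  from triangle[OF T eW uw] obtain f g x where t: "W T = {e, f, g}" "f \<noteq> e" "g \<noteq> e" "f \<noteq> g"
    "ends T f = {u, x}" "ends T g = {w, x}" "x \<noteq> u" "x \<noteq> w" "K T = {u, w, x}" by metis
  have "{e. two_wall T e} = (if mult u = 2 \<and> mult w = 2 then {e} else {}) \<union>
     (if mult u = 2 \<and> mult x = 2 then {f} else {}) \<union> (if mult w = 2 \<and> mult x = 2 then {g} else {})"
    unfolding two_wall_def t(1) using uw t by auto
  moreover have "corners 2 T = (if mult u = 2 then {u} else {}) \<union> (if mult w = 2 then {w} else {}) \<union>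
      (if mult x = 2 then {x} else {})"
    unfolding corners_def t(9) by auto
  ultimately show "card (corners 2 T) \<le> 1 + card {e. two_wall T e}"
    "card (corners 2 T) = 3 \<Longrightarrow> card {e. two_wall T e} = 3"
    using t uw by (auto simp: card_insert_if split: if_splits)
qed

lemma finite_TP_E [simp]: "finite (TP E)" by (rule finite_TP[OF fin])

text \<open>Pass to the cell behind the wall. Flipping back recovers the pair of cell and wall, and
  the cell behind is not a triangle by \<open>tri_D_empty\<close>.\<close>

lemma sum_two_walls_le:
  "(\<Sum>T | T \<in> TP E \<and> tri T. card {e. two_wall T e}) \<le> (\<Sum>T | T \<in> TP E \<and> \<not> tri T. card (D T))"
proof -
  define A where "A = (SIGMA T:{T \<in> TP E. tri T}. {e. two_wall T e})"
  define B where "B = (SIGMA T:{T \<in> TP E. \<not> tri T}. D T)"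
  have finD: "finite (D T)" for T by (rule finite_subset[OF D_W finite_W])
  have fin2: "finite {e. two_wall T e}" for T
    by (rule finite_subset[OF _ finite_W[of T]]) (auto simp: two_wall_def)
  define h where "h = (\<lambda>(T, e). (flip T e, e))"
  have "h ` A \<subseteq> B"
  proof
    fix y assume "y \<in> h ` A"
    then obtain T e where Te: "T \<in> TP E" "tri T" "two_wall T e" "y = (flip T e, e)"
      by (auto simp: A_def h_def)
    have eW: "e \<in> W T" using Te(3) by (simp add: two_wall_def)
    have d: "e \<in> D (flip T e)" using Te two_wall_flip[OF Te(3)] by (simp add: D_def)
    moreover have "\<not> tri (flip T e)" using tri_D_empty[OF flip_wall(3)[OF eW]] d by blast
    ultimately show "y \<in> B" using Te(4) flip_wall(3)[OF eW] by (simp add: B_def)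
  qed
  moreover have "inj_on h A"
  proof (rule inj_onI)
    fix y z assume yz: "h y = h z"
    obtain T e where y: "y = (T, e)" by (cases y)
    obtain T' e' where z: "z = (T', e')" by (cases z)
    have *: "flip T e = flip T' e' \<and> e = e'" using yz unfolding y z h_def prod.case prod.inject .
    then have e: "e = e'" by (rule conjunct2)
    have "flip T e = flip T' e" using conjunct1[OF *] unfolding e .
    then have "flip (flip T e) e = flip (flip T' e) e" by (simp only:)
    then show "y = z" using e by (simp add: y z)
  qed
  moreover have "finite B" unfolding B_def using finD by (intro finite_SigmaI) auto
  ultimately have "card A \<le> card B" by (intro card_inj_on_le[of h])
  then show ?thesis unfolding A_def B_def using finD fin2 by (simp add: card_SigmaI)
qed

lemma sum_corners: "(\<Sum>T\<in>TP E. card (corners m T)) = 2 * m * card {x \<in> V. mult x = m}"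
proof -
  have "corners m T = {x \<in> {x \<in> V. mult x = m}. x \<in> K T}" for T
    using K_V by (auto simp: corners_def)
  then have "(\<Sum>T\<in>TP E. card (corners m T)) = (\<Sum>x\<in>{x \<in> V. mult x = m}. card {T \<in> TP E. x \<in> K T})"
    using sum_card_swap[of "TP E" "{x \<in> V. mult x = m}" "\<lambda>T x. x \<in> K T"] by simp
  also have "\<dots> = (\<Sum>x\<in>{x \<in> V. mult x = m}. 2 * m)"
    by (rule sum.cong) (auto simp: card_topes_at)
  finally show ?thesis by simp
qed

lemma sum_walls: "(\<Sum>T\<in>TP E. card (W T)) = (\<Sum>x\<in>V. 2 * mult x)"
proof -
  have "(\<Sum>T\<in>TP E. card (W T)) = (\<Sum>T\<in>TP E. card {x \<in> V. x \<in> K T})"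
  proof (rule sum.cong)
    fix T assume "T \<in> TP E"
    moreover have "{x \<in> V. x \<in> K T} = K T" using K_V by blast
    ultimately show "card (W T) = card {x \<in> V. x \<in> K T}" using card_K by simp
  qed simp
  also have "\<dots> = (\<Sum>x\<in>V. card {T \<in> TP E. x \<in> K T})" by (rule sum_card_swap) simp_all
  also have "\<dots> = (\<Sum>x\<in>V. 2 * mult x)" by (rule sum.cong) (auto simp: card_topes_at)
  finally show ?thesis .
qed

text \<open>Every wall of a triangle between two double points is charged to the cell behind it, which is not a triangle.\<close>

definition charge :: "('a \<Rightarrow> real) \<Rightarrow> int" where
  "charge T = (if tri T then - int (card {e. two_wall T e}) else int (card (D T)))"

lemma sum_charge_nonneg: "0 \<le> (\<Sum>T\<in>TP E. charge T)"
proof -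
  have "(\<Sum>T\<in>TP E. charge T) = (\<Sum>T\<in>TP E \<inter> {T. tri T}. - int (card {e. two_wall T e})) +
      (\<Sum>T\<in>TP E \<inter> - {T. tri T}. int (card (D T)))"
    unfolding charge_def by (rule sum.If_cases) simp
  also have "TP E \<inter> {T. tri T} = {T. T \<in> TP E \<and> tri T}" by blast
  also have "TP E \<inter> - {T. tri T} = {T. T \<in> TP E \<and> \<not> tri T}" by blast
  finally show ?thesis using sum_two_walls_le by (simp add: sum_negf flip: of_nat_sum)
qed

text \<open>Triangles with one or two double corners are tight. The slope 5 comes from
  quadrilaterals with four double corners and two walls in \<open>D T\<close>, where
  \<open>4 + 2 = 1 + 5\<close>. For \<open>k \<ge> 5\<close> walls the crude bound
  \<open>2 * k \<le> 5 * k - 14\<close> is enough.\<close>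

lemma charge_le:
  assumes T: "T \<in> TP E"
  shows "int (card (corners 2 T)) + charge T \<le> 1 + 5 * (int (card (W T)) - 3)"
proof (cases "tri T")
  case True
  then show ?thesis using tri_two_walls(1)[OF T True] by (simp add: charge_def tri_def)
next
  case False
  then have k: "4 \<le> card (W T)" using card_W_ge_3[OF T] by (simp add: tri_def)
  have c: "card (corners 2 T) \<le> card (W T)" "card (D T) \<le> card (corners 2 T)"
    using card_corners_le[OF T] card_D_le[OF T] .
  have q: "card (W T) = 4 \<Longrightarrow> card (D T) \<le> 2" using quad_D[OF T] .
  show ?thesis using False k c q unfolding charge_def by (cases "card (W T) = 4") auto
qed

text \<open>The sum of \<open>charge_le\<close> over all cells, with the nonnegative total charge
  dropped; a vertex of multiplicity \<open>m\<close> is a corner of \<open>2 * m\<close> cells, and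
  \<open>14 = 3 * 5 - 1\<close>.\<close>

lemma two_corner_inequality:
  "4 * int (card {x \<in> V. mult x = 2}) + 14 * int (card (TP E)) \<le> 10 * (\<Sum>x\<in>V. int (mult x))"
proof -
  have "(\<Sum>T\<in>TP E. int (card (corners 2 T)) + charge T) \<le> (\<Sum>T\<in>TP E. 1 + 5 * (int (card (W T)) - 3))"
    by (rule sum_mono) (rule charge_le)
  also have "\<dots> = (\<Sum>T\<in>TP E. 5 * int (card (W T)) - 14)" by (rule sum.cong) simp_all
  also have "\<dots> = 5 * int (\<Sum>T\<in>TP E. card (W T)) - 14 * int (card (TP E))"
    by (simp add: sum_subtractf sum_distrib_left)
  also have "int (\<Sum>T\<in>TP E. card (W T)) = 2 * (\<Sum>x\<in>V. int (mult x))"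
    unfolding sum_walls by (simp add: sum_distrib_left)
  finally have "int (\<Sum>T\<in>TP E. card (corners 2 T)) + (\<Sum>T\<in>TP E. charge T) \<le>
      10 * (\<Sum>x\<in>V. int (mult x)) - 14 * int (card (TP E))"
    by (simp add: sum.distrib)
  then show ?thesis unfolding sum_corners using sum_charge_nonneg by simp
qed

end

section \<open>Sixteen curves\<close>

text \<open>Three zeros separate the four ones into at most three runs, so some run has length at
  least two, and each of its two ends has one neighbour of either kind.\<close>

lemma cyclic_word_7:
  assumes "of_bool b0 + of_bool b1 + of_bool b2 + of_bool b3 + of_bool b4 + of_bool b5 + of_bool b6 = (4::nat)"
  shows "(2::nat) \<le> of_bool (b0 \<and> b1 \<noteq> b6) + of_bool (b1 \<and> b2 \<noteq> b0) + of_bool (b2 \<and> b3 \<noteq> b1) +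
    of_bool (b3 \<and> b4 \<noteq> b2) + of_bool (b4 \<and> b5 \<noteq> b3) + of_bool (b5 \<and> b6 \<noteq> b4) + of_bool (b6 \<and> b0 \<noteq> b5)"
  using assms by (cases b0; cases b1; cases b2; cases b3; cases b4; cases b5; cases b6; simp)

text \<open>The weights solve a small linear program: they dominate the mixed lines at a fourfold point (\<open>cyclic_word_8\<close>)
  and stay below what the Euler inequality allows for each cell.\<close>

definition pair_weight :: "bool \<Rightarrow> bool \<Rightarrow> nat" where
  "pair_weight a b = (if a \<and> b then 5 else if \<not> a \<and> \<not> b then 3 else 0)"

text \<open>An alternating cyclic word of length eight has equal letters at opposite places, so
  unequal opposite letters require equal neighbours. Tight cases fix the weights: 00100101 has three
  unequal opposite pairs and two factors 00, giving \<open>2 * 3 \<le> 3 + 3\<close>; 01011010 has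
  four such pairs and, read cyclically, one factor 11 and one factor 00, giving
  \<open>2 * 4 \<le> 5 + 3\<close>.\<close>

lemma cyclic_word_8:
  "2 * (of_bool (b0 \<noteq> b4) + of_bool (b1 \<noteq> b5) + of_bool (b2 \<noteq> b6) + of_bool (b3 \<noteq> b7)) \<le>
    pair_weight b0 b1 + pair_weight b1 b2 + pair_weight b2 b3 + pair_weight b3 b4 +
    pair_weight b4 b5 + pair_weight b5 b6 + pair_weight b6 b7 + pair_weight b7 b0"
  unfolding pair_weight_def
  by (cases b0; cases b1; cases b2; cases b3; cases b4; cases b5; cases b6; cases b7; simp)

section \<open>Incidence counts\<close>

context pseudocircles begin

lemma line_points_eq: "e \<in> E \<Longrightarrow> {x \<in> range (c e). Z x \<inter> (E - {e}) \<noteq> {}} = {x \<in> V. e \<in> Z x}"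
proof (intro equalityI subsetI)
  fix x assume e: "e \<in> E" and "x \<in> {x \<in> range (c e). Z x \<inter> (E - {e}) \<noteq> {}}"
  then obtain f where "f \<in> Z x" "f \<noteq> e" "e \<in> Z x" by (auto simp: Z_def)
  then show "x \<in> {x \<in> V. e \<in> Z x}" using V_I[of e x f] by simp
next
  fix x assume e: "e \<in> E" and x: "x \<in> {x \<in> V. e \<in> Z x}"
  then obtain a b where "a \<in> Z x" "b \<in> Z x" "a \<noteq> b" using V_D[of x] by blast
  then obtain f where "f \<in> Z x" "f \<noteq> e" by metis
  then have "f \<in> Z x \<inter> (E - {e})" by (simp add: Z_def)
  moreover have "x \<in> range (c e)" using x by (simp add: Z_def)
  ultimately show "x \<in> {x \<in> range (c e). Z x \<inter> (E - {e}) \<noteq> {}}" by blast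
qed

lemma card_line_points: "e \<in> E \<Longrightarrow> E - {e} \<noteq> {} \<Longrightarrow> card {x \<in> V. e \<in> Z x} = 2 * dg e"
proof -
  assume e: "e \<in> E" and ne: "E - {e} \<noteq> {}"
  obtain p where p: "is_enum (\<tau> e) (E - {e}) p (dg e)"
    using is_enum_exists[of "E - {e}"] fin ne unfolding dg_def by blast
  show ?thesis
    using bij_betw_same_card[OF enum_points(1)[OF e subset_refl p]] unfolding line_points_eq[OF e] by simp
qed

lemma card_common_points:
  assumes ef: "e \<in> E" "f \<in> E" "e \<noteq> f"
  shows "card {x. e \<in> Z x \<and> f \<in> Z x} = 2"
proof -
  define x where "x = c e (\<tau> e f)"
  have x: "e \<in> Z x" "f \<in> Z x" using on_iff[OF ef, of "\<tau> e f"] ef by (auto simp: Z_def x_def)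
  have "{x. e \<in> Z x \<and> f \<in> Z x} = {x, - x}"
  proof (intro equalityI subsetI)
    fix y assume "y \<in> {x. e \<in> Z x \<and> f \<in> Z x}"
    then show "y \<in> {x, - x}" using meet_antipodal[OF x(1) _ x(2) _ ef(3)] by blast
  qed (use x in auto)
  moreover have "x \<noteq> - x" unfolding x_def by (rule c_neq_neg[OF ef(1)])
  ultimately show ?thesis by simp
qed

lemma sum_line_mult: "e \<in> E \<Longrightarrow> (\<Sum>x\<in>{x \<in> V. e \<in> Z x}. mult x - 1) = 2 * (card E - 1)"
proof -
  assume e: "e \<in> E"
  have "(\<Sum>x\<in>{x \<in> V. e \<in> Z x}. mult x - 1) = (\<Sum>x\<in>{x \<in> V. e \<in> Z x}. card {f \<in> E - {e}. f \<in> Z x})"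
  proof (rule sum.cong)
    fix x assume x: "x \<in> {x \<in> V. e \<in> Z x}"
    have "{f \<in> E - {e}. f \<in> Z x} = Z x - {e}" by (auto simp: Z_def)
    then show "mult x - 1 = card {f \<in> E - {e}. f \<in> Z x}" using x by (simp add: mult_def)
  qed simp
  also have "\<dots> = (\<Sum>f\<in>E - {e}. card {x \<in> {x \<in> V. e \<in> Z x}. f \<in> Z x})"
    by (rule sum_card_swap) (use fin in simp_all)
  also have "\<dots> = (\<Sum>f\<in>E - {e}. 2)"
  proof (rule sum.cong)
    fix f assume f: "f \<in> E - {e}"
    then have "{x \<in> {x \<in> V. e \<in> Z x}. f \<in> Z x} = {x. e \<in> Z x \<and> f \<in> Z x}"
      using V_I[of e _ f] by auto
    then show "card {x \<in> {x \<in> V. e \<in> Z x}. f \<in> Z x} = 2" using card_common_points[OF e] f by auto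
  qed simp
  also have "\<dots> = 2 * (card E - 1)" using e fin by (simp add: card_Diff_singleton)
  finally show ?thesis .
qed

end

text \<open>The sphere covers the plane twice, so the four fourfold points on a line appear as
  eight.\<close>

locale pseudocircles_16_4 = pseudocircles E c \<sigma> \<tau>
  for E :: "'a set" and c :: "'a \<Rightarrow> real \<Rightarrow> 'p::group_add" and \<sigma> \<tau> +
  assumes card_E: "card E = 16"
    and mult_le: "x \<in> V \<Longrightarrow> mult x \<le> 4"
    and fours: "e \<in> E \<Longrightarrow> card {x \<in> V. e \<in> Z x \<and> mult x = 4} = 8"
begin

lemma sum_by_mult:
  fixes g :: "nat \<Rightarrow> nat"
  assumes "X \<subseteq> V"
  shows "(\<Sum>x\<in>X. g (mult x)) = card {x \<in> X. mult x = 2} * g 2 + card {x \<in> X. mult x = 3} * g 3 +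
    card {x \<in> X. mult x = 4} * g 4"
proof -
  have X: "finite X" using assms finite_V by (rule finite_subset)
  have "mult ` X \<subseteq> {2, 3, 4}"
  proof
    fix m assume "m \<in> mult ` X"
    then obtain x where x: "x \<in> X" "m = mult x" by blast
    then have "x \<in> V" using assms by blast
    then have "2 \<le> m" "m \<le> 4" using mult_le x by (simp_all add: V_def)
    then show "m \<in> {2, 3, 4}" by auto
  qed
  then have "(\<Sum>x\<in>X. g (mult x)) = (\<Sum>m\<in>{2, 3, 4}. \<Sum>x\<in>{x \<in> X. mult x = m}. g (mult x))"
    using sum.group[of X "{2, 3, 4}" mult "\<lambda>x. g (mult x)"] X by simp
  then show ?thesis by simp
qed

text \<open>The fifteen other circles cross \<open>e\<close> thirty times in all. The eight fourfold
  points account for 24 of these crossings, which leaves 6 for double and triple points.\<close>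

lemma line_counts:
  assumes e: "e \<in> E"
  shows "card {x \<in> V. e \<in> Z x \<and> mult x = 2} + 2 * card {x \<in> V. e \<in> Z x \<and> mult x = 3} = 6"
    "card {x \<in> V. e \<in> Z x} = card {x \<in> V. e \<in> Z x \<and> mult x = 2} + card {x \<in> V. e \<in> Z x \<and> mult x = 3} + 8"
    "card {x \<in> V. e \<in> Z x} = 2 * dg e"
proof -
  have eq: "{x \<in> {x \<in> V. e \<in> Z x}. mult x = m} = {x \<in> V. e \<in> Z x \<and> mult x = m}" for m by auto
  show "card {x \<in> V. e \<in> Z x \<and> mult x = 2} + 2 * card {x \<in> V. e \<in> Z x \<and> mult x = 3} = 6"
    using sum_by_mult[of "{x \<in> V. e \<in> Z x}" "\<lambda>m. m - 1"] sum_line_mult[OF e] card_E fours[OF e]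
    unfolding eq by auto
  show "card {x \<in> V. e \<in> Z x} = card {x \<in> V. e \<in> Z x \<and> mult x = 2} + card {x \<in> V. e \<in> Z x \<and> mult x = 3} + 8"
    using sum_by_mult[of "{x \<in> V. e \<in> Z x}" "\<lambda>m. 1"] fours[OF e] unfolding eq by auto
  have "E - {e} \<noteq> {}"
  proof
    assume "E - {e} = {}"
    then have "E \<subseteq> {e}" by blast
    then have "card E \<le> 1" using card_mono[of "{e}" E] by simp
    then show False using card_E by simp
  qed
  then show "card {x \<in> V. e \<in> Z x} = 2 * dg e" by (rule card_line_points[OF e])
qed

sublocale nondegenerate_pseudocircles E c \<sigma> \<tau>
proof
  fix e assume "e \<in> E"
  from line_counts[OF this] show "5 \<le> dg e" by linarith
qed

lemma sum_over_lines:
  "(\<Sum>e\<in>E. card {x \<in> V. e \<in> Z x \<and> mult x = m}) = m * card {x \<in> V. mult x = m}"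
proof -
  have "(\<Sum>e\<in>E. card {x \<in> V. e \<in> Z x \<and> mult x = m}) = (\<Sum>e\<in>E. card {x \<in> {x \<in> V. mult x = m}. e \<in> Z x})"
    by (rule sum.cong) (auto intro: arg_cong[where f = card])
  also have "\<dots> = (\<Sum>x\<in>{x \<in> V. mult x = m}. card {e \<in> E. e \<in> Z x})"
    by (rule sum_card_swap) (use fin in simp_all)
  also have "\<dots> = (\<Sum>x\<in>{x \<in> V. mult x = m}. m)"
  proof (rule sum.cong)
    fix x assume "x \<in> {x \<in> V. mult x = m}"
    moreover have "{e \<in> E. e \<in> Z x} = Z x" by (auto simp: Z_def)
    ultimately show "card {e \<in> E. e \<in> Z x} = m" by (simp add: mult_def)
  qed simp
  finally show ?thesis by simp
qed

lemma counts: "card {x \<in> V. mult x = 4} = 32" "card {x \<in> V. mult x = 2} + 3 * card {x \<in> V. mult x = 3} = 48"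
proof -
  have "4 * card {x \<in> V. mult x = 4} = (\<Sum>e\<in>E. 8)"
    unfolding sum_over_lines[symmetric] by (rule sum.cong) (auto simp: fours)
  then show "card {x \<in> V. mult x = 4} = 32" by (simp add: card_E)
  have "(\<Sum>e\<in>E. card {x \<in> V. e \<in> Z x \<and> mult x = 2} + 2 * card {x \<in> V. e \<in> Z x \<and> mult x = 3}) = (\<Sum>e\<in>E. 6)"
    by (rule sum.cong) (auto simp: line_counts)
  then have "2 * card {x \<in> V. mult x = 2} + 2 * (3 * card {x \<in> V. mult x = 3}) = 96"
    unfolding sum.distrib sum_distrib_left[symmetric] sum_over_lines by (simp add: card_E)
  then show "card {x \<in> V. mult x = 2} + 3 * card {x \<in> V. mult x = 3} = 48" by simp
qed

text \<open>The constant 98 is 2 plus 3 for each of the 32 fourfold vertices.\<close>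

lemma card_topes_ge:
  "98 + card {x \<in> V. mult x = 2} + 2 * card {x \<in> V. mult x = 3} \<le> card (TP E)"
proof -
  have "E \<noteq> {}" using card_E by auto
  moreover have "Z x \<inter> E = Z x" for x by (auto simp: Z_def)
  ultimately have "2 + (\<Sum>x\<in>V. mult x - 1) \<le> card (TP E)"
    using card_TP_ge[of E] by (simp add: mult_def)
  then show ?thesis using sum_by_mult[of V "\<lambda>m. m - 1"] counts(1) by simp
qed

lemma sum_mult: "(\<Sum>x\<in>V. mult x) = 2 * card {x \<in> V. mult x = 2} + 3 * card {x \<in> V. mult x = 3} + 128"
  using sum_by_mult[of V "\<lambda>m. m"] counts(1) by simp

lemma no_triple_points: "card {x \<in> V. mult x = 3} = 0"
proof -
  define n2 n3 where "n2 = card {x \<in> V. mult x = 2}" and "n3 = card {x \<in> V. mult x = 3}"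
  \<comment> \<open>The estimates below leave room for a single triple vertex, but triple vertices
    come in antipodal pairs.\<close>
  have "n3 \<noteq> 1"
  proof
    assume "n3 = 1"
    then obtain x where x: "{x \<in> V. mult x = 3} = {x}" unfolding n3_def by (rule card_1_singletonE)
    then have "x \<in> V" "mult x = 3" by auto
    then have "- x \<in> {x \<in> V. mult x = 3}" by simp
    then have "- x = x" unfolding x by simp
    moreover obtain e where "e \<in> Z x" using V_D[OF \<open>x \<in> V\<close>] by blast
    then obtain t where "e \<in> E" "x = c e t" by (auto simp: Z_def)
    ultimately show False using c_neq_neg[of e t] by simp
  qed
  have "4 * int n2 + 14 * int (card (TP E)) \<le> 10 * (2 * int n2 + 3 * int n3 + 128)"
    using two_corner_inequality sum_mult unfolding n2_def[symmetric] n3_def[symmetric]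
    by (simp flip: of_nat_sum)
  moreover have "98 + int n2 + 2 * int n3 \<le> int (card (TP E))"
    using card_topes_ge unfolding n2_def[symmetric] n3_def[symmetric] by linarith
  moreover have "int n2 + 3 * int n3 = 48"
    using counts(2) unfolding n2_def[symmetric] n3_def[symmetric] by linarith
  \<comment> \<open>With \<open>f\<close> at its lower bound and \<open>a = 48 - 3 * b\<close> the
    first inequality becomes \<open>4 * b \<le> 4\<close>.\<close>
  moreover have "b \<le> 1" if "4 * a + 14 * f \<le> 10 * (2 * a + 3 * b + 128)" "98 + a + 2 * b \<le> f" "a + 3 * b = 48" for a b f :: int
    using that by simp
  ultimately have "int n3 \<le> 1" by blast
  with \<open>n3 \<noteq> 1\<close> have "n3 = 0" by linarith
  then show ?thesis by (simp add: n3_def)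
qed

lemma mult_2_or_4: "x \<in> V \<Longrightarrow> mult x = 2 \<or> mult x = 4"
proof -
  assume x: "x \<in> V"
  have "mult x \<noteq> 3" using no_triple_points x by auto
  then show ?thesis using mult_le[OF x] mult_V[OF x] by linarith
qed

lemma dg_7: "e \<in> E \<Longrightarrow> dg e = 7"
proof -
  assume e: "e \<in> E"
  have "{x \<in> V. e \<in> Z x \<and> mult x = 3} = {}" using mult_2_or_4 by fastforce
  then have "card {x \<in> V. e \<in> Z x \<and> mult x = 3} = 0" by (simp only: card.empty)
  then show ?thesis using line_counts[OF e] by linarith
qed

section \<open>Mixed points and weights\<close>

definition mixed :: "'a \<Rightarrow> 'p \<Rightarrow> bool" where
  "mixed e x \<longleftrightarrow> (\<exists>n. vt e n = x \<and> mult (vt e (n + 1)) \<noteq> mult (vt e (n - 1)))"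

lemma sum_14: "(\<Sum>n\<in>{0..<14::int}. f n) =
   f 0 + f 1 + f 2 + f 3 + f 4 + f 5 + f 6 + (f 7 + f 8 + f 9 + f 10 + f 11 + f 12 + (f 13 :: nat))"
proof -
  have "{0..<14::int} = {0, 1, 2, 3, 4, 5, 6, 7, 8, 9, 10, 11, 12, 13}"
    unfolding set_eq_iff by simp presburger
  then show ?thesis by (simp add: add_ac)
qed

text \<open>By antipodal symmetry the multiplicities along the circle have period seven, and each
  half contributes the two places found by \<open>cyclic_word_7\<close>.\<close>

lemma card_mixed_on_line:
  assumes e: "e \<in> E"
  shows "4 \<le> card {x \<in> V. e \<in> Z x \<and> mult x = 4 \<and> mixed e x}"
proof -
  have bij: "bij_betw (vt e) {0..<14} {x \<in> V. e \<in> Z x}"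
    using enum_points(1)[OF e subset_refl en[OF e]] dg_7[OF e] unfolding line_points_eq[OF e] vt_def by simp
  have transfer: "card {x \<in> V. e \<in> Z x \<and> P x} = (\<Sum>n\<in>{0..<14}. of_bool (P (vt e n)))" for P
  proof -
    have "bij_betw (vt e) {n \<in> {0..<14}. P (vt e n)} {x \<in> V. e \<in> Z x \<and> P x}"
    proof (rule bij_betw_subset[OF bij])
      show "vt e ` {n \<in> {0..<14}. P (vt e n)} = {x \<in> V. e \<in> Z x \<and> P x}"
      proof (intro equalityI subsetI)
        fix x assume x: "x \<in> {x \<in> V. e \<in> Z x \<and> P x}"
        then have "x \<in> vt e ` {0..<14}" using bij_betw_imp_surj_on[OF bij] by simp
        then obtain n where "n \<in> {0..<14}" "x = vt e n" by (rule imageE)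
        then show "x \<in> vt e ` {n \<in> {0..<14}. P (vt e n)}" using x by (intro image_eqI[of _ _ n]) simp_all
      next
        fix x assume "x \<in> vt e ` {n \<in> {0..<14}. P (vt e n)}"
        then show "x \<in> {x \<in> V. e \<in> Z x \<and> P x}" using vt_V[OF e] vt_Z[OF e] by auto
      qed
    qed auto
    then have "card {x \<in> V. e \<in> Z x \<and> P x} = card {n \<in> {0..<14}. P (vt e n)}"
      by (rule bij_betw_same_card[symmetric])
    also have "\<dots> = (\<Sum>n\<in>{0..<14}. of_bool (P (vt e n)))"
      by (simp add: of_bool_def sum.If_cases Int_def)
    finally show ?thesis .
  qed
  define y where "y n \<longleftrightarrow> mult (vt e n) = 4" for n
  have y7: "y (n + 7) = y n" for n
    using vt_dg[OF e, of n] dg_7[OF e] by (simp add: y_def)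
  have ys: "y 7 = y 0" "y 8 = y 1" "y 9 = y 2" "y 10 = y 3" "y 11 = y 4" "y 12 = y 5" "y 13 = y 6" "y 14 = y 0" "y (- 1) = y 6"
    using y7[of 0] y7[of 1] y7[of 2] y7[of 3] y7[of 4] y7[of 5] y7[of 6] y7[of 7] y7[of "- 1"] by simp_all
  have "(8::nat) = (\<Sum>n\<in>{0..<14}. of_bool (y n))"
    unfolding y_def using transfer[of "\<lambda>x. mult x = 4"] fours[OF e] by (simp only:)
  then have "of_bool (y 0) + of_bool (y 1) + of_bool (y 2) + of_bool (y 3) + of_bool (y 4) + of_bool (y 5) + of_bool (y 6) = (4::nat)"
    unfolding sum_14 ys by linarith
  from cyclic_word_7[OF this]
  have "4 \<le> (\<Sum>n\<in>{0..<14}. of_bool (y n \<and> y (n + 1) \<noteq> y (n - 1)) :: nat)"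
    unfolding sum_14 by (simp add: ys)
  also have "\<dots> \<le> (\<Sum>n\<in>{0..<14}. of_bool (mult (vt e n) = 4 \<and> mixed e (vt e n)))"
  proof (rule sum_mono)
    fix n :: int
    have "mixed e (vt e n)" if "y (n + 1) \<noteq> y (n - 1)"
      unfolding mixed_def using that by (intro exI[of _ n]) (auto simp: y_def)
    then show "(of_bool (y n \<and> y (n + 1) \<noteq> y (n - 1)) :: nat) \<le> of_bool (mult (vt e n) = 4 \<and> mixed e (vt e n))"
      by (simp add: y_def)
  qed
  also have "\<dots> = card {x \<in> V. e \<in> Z x \<and> mult x = 4 \<and> mixed e x}"
    by (rule transfer[symmetric])
  finally show ?thesis .
qed

text \<open>The neighbours of a corner of a triangle are its other two corners, so the number of
  fourfold corners determines the pair weight at each of them. All other cells get the largest pair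
  weight.\<close>

definition weight :: "('a \<Rightarrow> real) \<Rightarrow> nat" where
  "weight T = (if tri T then (if card (corners 4 T) = 3 then 5 else if card (corners 4 T) = 1 then 3 else 0) else 5)"

lemma weight_at_corner:
  assumes T: "T \<in> TP E" and v: "mult v = 4" and e: "e \<in> W T" "ends T e = {v, u}" and f: "f \<in> W T" "ends T f = {v, w}" "f \<noteq> e"
  shows "pair_weight (mult u = 4) (mult w = 4) \<le> weight T"
proof (cases "tri T")
  case True
  have vu: "v \<noteq> u" using ends_D(1)[OF e(1)] e(2) by auto
  from triangle[OF T True e vu] obtain f' g x where t: "W T = {e, f', g}" "f' \<noteq> e" "g \<noteq> e" "f' \<noteq> g"
    "ends T f' = {v, x}" "ends T g = {u, x}" "x \<noteq> v" "x \<noteq> u" "K T = {v, u, x}" by metis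
  have "f \<noteq> g"
  proof
    assume "f = g"
    then have "v \<in> {u, x}" using f(2) t(6) by auto
    then show False using vu t by auto
  qed
  then have "f = f'" using f t by auto
  then have xw: "x = w" using f(2) t(5) doubleton_cancel[of v w x] by simp
  have "corners 4 T = {v} \<union> (if mult u = 4 then {u} else {}) \<union> (if mult w = 4 then {w} else {})"
    unfolding corners_def t(9) xw using v by auto
  then have "card (corners 4 T) = 1 + of_bool (mult u = 4) + of_bool (mult w = 4)"
    using vu t(7,8) unfolding xw by (simp add: card_insert_if)
  then show ?thesis using True by (simp add: weight_def pair_weight_def)
qed (simp add: weight_def pair_weight_def)

text \<open>Rays \<open>i\<close> and \<open>i + 4\<close> lie on the same line and rays
  \<open>i\<close> and \<open>i + 1\<close> bound the same cell. The types of the eight neighbours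
  therefore form a word for \<open>cyclic_word_8\<close>, and each pair weight in it is at most the
  weight of the sector between the two rays.\<close>

lemma card_mixed_at_vertex:
  assumes v: "v \<in> V" "mult v = 4"
  shows "2 * card {e \<in> Z v. mixed e v} \<le> (\<Sum>T\<in>{T \<in> TP E. v \<in> K T}. weight T)"
proof -
  obtain S lin nb where rot: "rotation v S lin nb" using rotation_exists[OF v(1)] by blast
  have S: "S i = S j \<longleftrightarrow> int 8 dvd i - j" and lin: "lin i = lin j \<longleftrightarrow> int 4 dvd i - j" for i j
    using rot v(2) unfolding rotation_def by simp_all
  have ran: "range lin = Z v" "range S = {T \<in> TP E. v \<in> K T}"
    and inc: "{e \<in> W (S i). v \<in> ends (S i) e} = {lin i, lin (i + 1)}"
    and ends: "ends (S i) (lin i) = {v, nb i}" "ends (S i) (lin (i + 1)) = {v, nb (i + 1)}"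
    and opp: "\<exists>n. vt (lin i) n = v \<and> {nb i, nb (i + 4)} = {vt (lin i) (n + 1), vt (lin i) (n - 1)}" for i
    using rot v(2) unfolding rotation_def by simp_all
  have linW: "lin i \<in> W (S i)" "lin (i + 1) \<in> W (S i)" for i using inc[of i] by blast+
  have STP: "S i \<in> TP E" for i using ran(2) by blast
  have nbV: "nb i \<in> V" for i using ends_D(2)[OF linW(1)[of i]] ends(1)[of i] by simp
  define w where "w i \<longleftrightarrow> mult (nb i) = 4" for i
  have nb8: "nb (i + 8) = nb i" for i
  proof -
    have "{v, nb (i + 8)} = {v, nb i}"
      using ends(1)[of "i + 8"] ends(1)[of i] S[of "i + 8" i] lin[of "i + 8" i] by simp
    then show ?thesis by (rule doubleton_cancel)
  qed
  have ne: "lin (i + 1) \<noteq> lin i" for i by (simp add: lin)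
  have wt: "pair_weight (w i) (w (i + 1)) \<le> weight (S i)" for i
    unfolding w_def by (rule weight_at_corner[OF STP v(2) linW(1) ends(1) linW(2) ends(2) ne])
  have mixed_w: "w i \<noteq> w (i + 4)" if "mixed (lin i) v" for i
  proof -
    have E: "lin i \<in> E" using W_E linW by blast
    obtain n where n: "vt (lin i) n = v" "{nb i, nb (i + 4)} = {vt (lin i) (n + 1), vt (lin i) (n - 1)}"
      using opp by blast
    obtain n' where n': "vt (lin i) n' = v" "mult (vt (lin i) (n' + 1)) \<noteq> mult (vt (lin i) (n' - 1))"
      using \<open>mixed (lin i) v\<close> unfolding mixed_def by blast
    have "vt (lin i) (n' + 1) = vt (lin i) (n + 1)" "vt (lin i) (n' - 1) = vt (lin i) (n - 1)"
      using vt_cong[OF E, of n' n 1] vt_cong[OF E, of n' n "- 1"] n n' by simp_all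
    then have "mult (nb i) \<noteq> mult (nb (i + 4))" using n(2) n'(2) by (auto simp: doubleton_eq_iff)
    then show ?thesis using mult_2_or_4[OF nbV[of i]] mult_2_or_4[OF nbV[of "i + 4"]] by (auto simp: w_def)
  qed
  note rl = range_periodic[of lin 4, OF lin, simplified] and rS = range_periodic[of S 8, OF S, simplified]
  have i4: "{0..<4::int} = {0, 1, 2, 3}" and i8: "{0..<8::int} = {0, 1, 2, 3, 4, 5, 6, 7}" by auto
  have fin4: "finite {i \<in> {0..<4::int}. Q i}" for Q
    by (rule finite_subset[of _ "{0..<4}"]) auto
  have "{e \<in> Z v. mixed e v} = lin ` {i \<in> {0..<4}. mixed (lin i) v}" using rl(1) ran(1) by auto
  then have "card {e \<in> Z v. mixed e v} \<le> card {i \<in> {0..<4::int}. mixed (lin i) v}"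
    using card_image_le[OF fin4] by (simp only:)
  also have "\<dots> \<le> card {i \<in> {0..<4::int}. w i \<noteq> w (i + 4)}" 
    using mixed_w by (intro card_mono[OF fin4]) blast
  also have "\<dots> = (\<Sum>i\<in>{0..<4::int}. of_bool (w i \<noteq> w (i + 4)))"
    by (simp add: of_bool_def sum.If_cases Int_def)
  also have "\<dots> = of_bool (w 0 \<noteq> w 4) + of_bool (w 1 \<noteq> w 5) + of_bool (w 2 \<noteq> w 6) + of_bool (w 3 \<noteq> w 7)"
    unfolding i4 by simp
  finally have "2 * card {e \<in> Z v. mixed e v} \<le>
    2 * (of_bool (w 0 \<noteq> w 4) + of_bool (w 1 \<noteq> w 5) + of_bool (w 2 \<noteq> w 6) + of_bool (w 3 \<noteq> w 7))" by simp
  also have "\<dots> \<le> pair_weight (w 0) (w 1) + pair_weight (w 1) (w 2) + pair_weight (w 2) (w 3) + pair_weight (w 3) (w 4) +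
    pair_weight (w 4) (w 5) + pair_weight (w 5) (w 6) + pair_weight (w 6) (w 7) + pair_weight (w 7) (w 0)"
    by (rule cyclic_word_8)
  \<comment> \<open>The last pair has to close up as \<open>(w 7, w 8)\<close> to match the sector
    \<open>S 7\<close>. The rewriting also hits the first pair, which the next step
    restores.\<close>
  also have "w 0 = w 8" using nb8[of 0] by (simp add: w_def)
  also have "pair_weight (w 8) (w 1) = pair_weight (w 0) (w 1)" using nb8[of 0] by (simp add: w_def)
  also have "pair_weight (w 0) (w 1) + pair_weight (w 1) (w 2) + pair_weight (w 2) (w 3) + pair_weight (w 3) (w 4) +
    pair_weight (w 4) (w 5) + pair_weight (w 5) (w 6) + pair_weight (w 6) (w 7) + pair_weight (w 7) (w 8) \<le>
    (\<Sum>i\<in>{0..<8}. weight (S i))"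
    unfolding i8 using wt[of 0] wt[of 1] wt[of 2] wt[of 3] wt[of 4] wt[of 5] wt[of 6] wt[of 7] by simp
  also have "\<dots> = (\<Sum>T\<in>S ` {0..<8}. weight T)" using rS(2) by (simp add: sum.reindex)
  finally show ?thesis using rS(1) ran(2) by simp
qed

text \<open>The tight cells determine the constants. Triangles with 0, 1 and 2 double corners give
  the value \<open>15 = 3 * 5\<close>, the slope \<open>- 15\<close> and \<open>18 = 15 + 3\<close>;
  quadrilaterals with four double corners and two walls in \<open>D T\<close> give
  \<open>81 = 2 * 18 + 45\<close>.\<close>

lemma weight_le:
  assumes T: "T \<in> TP E"
  shows "int (weight T) * int (card (corners 4 T)) + 18 * charge T \<le>
    15 - 15 * int (card (corners 2 T)) + 81 * (int (card (W T)) - 3)"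
proof -
  have "K T = corners 2 T \<union> corners 4 T"
    using mult_2_or_4 K_V by (auto simp: corners_def)
  moreover have "corners 2 T \<inter> corners 4 T = {}" by (auto simp: corners_def)
  ultimately have k: "card (W T) = card (corners 2 T) + card (corners 4 T)"
    using card_K[OF T] by (simp add: card_Un_disjoint)
  show ?thesis
  proof (cases "tri T")
    case True
    then have k3: "card (corners 2 T) + card (corners 4 T) = 3" using k by (simp add: tri_def)
    then consider "card (corners 2 T) = 0" "card (corners 4 T) = 3" | "card (corners 2 T) = 1" "card (corners 4 T) = 2"
      | "card (corners 2 T) = 2" "card (corners 4 T) = 1" | "card (corners 2 T) = 3" "card (corners 4 T) = 0"
      by linarith
    then show ?thesis
      using tri_two_walls[OF T True] k True by cases (auto simp: weight_def charge_def)
  next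
    case False
    then have k4: "4 \<le> card (W T)" using card_W_ge_3[OF T] by (simp add: tri_def)
    have d: "card (D T) \<le> card (corners 2 T)" using card_D_le[OF T] .
    have q: "card (W T) = 4 \<Longrightarrow> card (D T) \<le> 2" using quad_D[OF T] .
    show ?thesis using False k4 d q k unfolding charge_def weight_def
      by (cases "card (W T) = 4") auto
  qed
qed

text \<open>Each of the 16 lines has at least 4 mixed fourfold vertices, and
  \<open>card_mixed_at_vertex\<close> counts each incidence twice, so the weights summed over
  fourfold corners amount to at least 128. The sum of \<open>weight_le\<close> over all cells bounds
  the same quantity by \<open>81 * 448 - 15 * 192 - 228 * 146 = 120\<close>, where
  \<open>228 = 3 * 81 - 15\<close>.\<close>

lemma contradiction: False
proof -
  have n3: "card {x \<in> V. mult x = 3} = 0" by (rule no_triple_points)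
  then have n2: "card {x \<in> V. mult x = 2} = 48" using counts(2) by linarith
  have F: "146 \<le> card (TP E)" using card_topes_ge n2 n3 by simp
  define X where "X = {x \<in> V. mult x = 4}"
  have "(64::nat) = (\<Sum>e\<in>E. 4)" by (simp add: card_E)
  also have "\<dots> \<le> (\<Sum>e\<in>E. card {x \<in> V. e \<in> Z x \<and> mult x = 4 \<and> mixed e x})"
    by (rule sum_mono) (rule card_mixed_on_line)
  also have "\<dots> = (\<Sum>e\<in>E. card {x \<in> X. e \<in> Z x \<and> mixed e x})"
    by (rule sum.cong) (auto simp: X_def intro: arg_cong[where f = card])
  also have "\<dots> = (\<Sum>x\<in>X. card {e \<in> E. e \<in> Z x \<and> mixed e x})"
    by (rule sum_card_swap) (use fin in \<open>simp_all add: X_def\<close>)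
  also have "\<dots> = (\<Sum>x\<in>X. card {e \<in> Z x. mixed e x})"
    by (rule sum.cong) (auto simp: Z_def intro: arg_cong[where f = card])
  finally have "128 \<le> (\<Sum>x\<in>X. 2 * card {e \<in> Z x. mixed e x})" by (simp flip: sum_distrib_left)
  also have "\<dots> \<le> (\<Sum>x\<in>X. \<Sum>T\<in>{T \<in> TP E. x \<in> K T}. weight T)"
    by (rule sum_mono) (auto simp: X_def intro: card_mixed_at_vertex)
  also have "\<dots> = (\<Sum>T\<in>TP E. \<Sum>x\<in>{x \<in> X. x \<in> K T}. weight T)"
    by (rule sum.swap_restrict) (simp_all add: X_def)
  also have "\<dots> = (\<Sum>T\<in>TP E. weight T * card (corners 4 T))"
  proof (rule sum.cong)
    fix T
    have "{x \<in> X. x \<in> K T} = corners 4 T" using K_V by (auto simp: X_def corners_def)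
    then show "(\<Sum>x\<in>{x \<in> X. x \<in> K T}. weight T) = weight T * card (corners 4 T)" by simp
  qed simp
  finally have "128 \<le> int (\<Sum>T\<in>TP E. weight T * card (corners 4 T))" by linarith
  also have "\<dots> \<le> (\<Sum>T\<in>TP E. int (weight T) * int (card (corners 4 T))) + 18 * (\<Sum>T\<in>TP E. charge T)"
    using sum_charge_nonneg by simp
  also have "\<dots> = (\<Sum>T\<in>TP E. int (weight T) * int (card (corners 4 T)) + 18 * charge T)"
    by (simp add: sum.distrib sum_distrib_left)
  also have "\<dots> \<le> (\<Sum>T\<in>TP E. 15 - 15 * int (card (corners 2 T)) + 81 * (int (card (W T)) - 3))"
    by (rule sum_mono) (rule weight_le)
  also have "\<dots> = (\<Sum>T\<in>TP E. 81 * int (card (W T)) - 15 * int (card (corners 2 T)) - 228)"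
    by (rule sum.cong) simp_all
  also have "\<dots> = 81 * int (\<Sum>T\<in>TP E. card (W T)) - 15 * int (\<Sum>T\<in>TP E. card (corners 2 T)) - 228 * int (card (TP E))"
    by (simp add: sum_subtractf sum_distrib_left)
  also have "(\<Sum>T\<in>TP E. card (W T)) = 448"
    unfolding sum_walls using sum_mult n2 n3 by (simp flip: sum_distrib_left)
  also have "(\<Sum>T\<in>TP E. card (corners 2 T)) = 192" unfolding sum_corners n2 by simp
  finally show False using F by simp
qed

end

section \<open>Realizations of configurations\<close>

lemma card_le_matroid_rank:
  assumes "finite X" "J \<subseteq> X" "indep J"
  shows "card J \<le> matroid_rank indep X"
  unfolding matroid_rank_def
proof (rule Max_ge)
  have "{J. J \<subseteq> X \<and> indep J} \<subseteq> Pow X" by blast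
  then show "finite (card ` {J. J \<subseteq> X \<and> indep J})"
    using assms(1) by (intro finite_imageI) (rule finite_subset[OF _ finite_Pow_iff[THEN iffD2]])
  show "card J \<in> card ` {J. J \<subseteq> X \<and> indep J}" using assms by blast
qed

section \<open>From flats of the matroid to points of the arrangement\<close>

locale configuration_realization =
  fixes E :: "'a set" and indep :: "'a set \<Rightarrow> bool" and L :: "'a \<Rightarrow> rp2 set"
  assumes config: "configuration_16_4 E indep"
    and arr: "pseudoline_arrangement E L"
    and realizes: "S \<subseteq> E \<Longrightarrow> (\<exists>p. \<forall>e\<in>S. p \<in> L e) \<longleftrightarrow> matroid_rank indep S \<le> 2"
begin

definition thru :: "rp2 \<Rightarrow> 'a set" where "thru p = {e \<in> E. p \<in> L e}"

lemma finE: "finite E"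
  using config by (simp add: configuration_16_4_def simple_matroid_def matroid_def)

lemma finite_thru [simp]: "finite (thru p)" using finE by (simp add: thru_def)

lemma meet: "e \<in> thru p \<Longrightarrow> f \<in> thru p \<Longrightarrow> e \<in> thru q \<Longrightarrow> f \<in> thru q \<Longrightarrow> e \<noteq> f \<Longrightarrow> p = q"
proof -
  assume h: "e \<in> thru p" "f \<in> thru p" "e \<in> thru q" "f \<in> thru q" "e \<noteq> f"
  then have "e \<in> E" "f \<in> E" by (simp_all add: thru_def)
  then obtain r where "L e \<inter> L f = {r}" using arr h(5) unfolding pseudoline_arrangement_def by blast
  moreover have "p \<in> L e \<inter> L f" "q \<in> L e \<inter> L f" using h by (simp_all add: thru_def)
  ultimately show "p = q" by simp
qed

lemma two_thru: assumes "2 \<le> card (thru p)" obtains e f where "e \<in> thru p" "f \<in> thru p" "e \<noteq> f"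
proof -
  have "\<not> card (thru p) \<le> Suc 0" using assms by simp
  then show ?thesis using that card_le_Suc0_iff_eq[OF finite_thru] by blast
qed

lemma thru_determines: "2 \<le> card (thru p) \<Longrightarrow> thru p = thru q \<Longrightarrow> p = q"
  using two_thru meet by metis

text \<open>Rank at most 2 means having a common point. A further element that did not raise the
  rank would share a point with all curves through \<open>p\<close>, but two of these curves meet
  only in \<open>p\<close>.\<close>

lemma line_thru:
  assumes "2 \<le> card (thru p)"
  shows "matroid_line E indep (thru p)"
proof -
  obtain e f where ef: "e \<in> thru p" "f \<in> thru p" "e \<noteq> f" using two_thru[OF assms] by blast
  have E: "e \<in> E" "f \<in> E" using ef by (simp_all add: thru_def)
  have "indep {e, f}" using config E ef(3) by (simp add: configuration_16_4_def simple_matroid_def)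
  then have "card {e, f} \<le> matroid_rank indep (thru p)"
    using ef by (intro card_le_matroid_rank) auto
  moreover have "matroid_rank indep (thru p) \<le> 2"
    using realizes[of "thru p"] by (auto simp: thru_def)
  ultimately have rank: "matroid_rank indep (thru p) = 2" using ef(3) by simp
  have "matroid_rank indep (thru p) < matroid_rank indep (insert g (thru p))" if g: "g \<in> E - thru p" for g
  proof (rule ccontr)
    assume "\<not> ?thesis"
    then have "matroid_rank indep (insert g (thru p)) \<le> 2" using rank by simp
    moreover have "insert g (thru p) \<subseteq> E" using g by (auto simp: thru_def)
    ultimately obtain q where q: "\<forall>h\<in>insert g (thru p). q \<in> L h" using realizes by blast
    then have "e \<in> thru q" "f \<in> thru q" "g \<in> thru q" using ef E g by (auto simp: thru_def)
    then have "p = q" using meet[of e p f q] ef by blast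
    then show False using g \<open>g \<in> thru q\<close> by blast
  qed
  then show ?thesis unfolding matroid_line_def flat_def using rank by (auto simp: thru_def)
qed

lemma thru_line:
  assumes F: "matroid_line E indep F"
  shows "\<exists>p. thru p = F"
proof -
  have FE: "F \<subseteq> E" and rank: "matroid_rank indep F = 2"
    and fl: "\<And>e. e \<in> E - F \<Longrightarrow> matroid_rank indep F < matroid_rank indep (insert e F)"
    using F by (auto simp: matroid_line_def flat_def)
  obtain p where p: "\<forall>e\<in>F. p \<in> L e" using realizes[OF FE] rank by auto
  have "e \<in> F" if e: "e \<in> thru p" for e
  proof (rule ccontr)
    assume "e \<notin> F"
    then have "2 < matroid_rank indep (insert e F)" using fl[of e] e rank by (simp add: thru_def)
    moreover have "insert e F \<subseteq> E" using FE e by (auto simp: thru_def)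
    moreover have "\<forall>h\<in>insert e F. p \<in> L h" using p e by (simp add: thru_def)
    ultimately show False using realizes by (metis not_less)
  qed
  then have "thru p = F" using p FE by (auto simp: thru_def)
  then show ?thesis by blast
qed

lemma card_thru_le: "card (thru p) \<le> 4"
proof (cases "2 \<le> card (thru p)")
  case True
  then show ?thesis using line_thru config by (simp add: configuration_16_4_def)
qed simp

lemma card_fourfold_points:
  assumes e: "e \<in> E"
  shows "card {p. e \<in> thru p \<and> card (thru p) = 4} = 4"
proof -
  have "bij_betw thru {p. e \<in> thru p \<and> card (thru p) = 4} {F. matroid_line E indep F \<and> e \<in> F \<and> card F = 4}"
    unfolding bij_betw_def
  proof
    show "inj_on thru {p. e \<in> thru p \<and> card (thru p) = 4}"
      by (rule inj_onI) (auto intro!: thru_determines)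
    show "thru ` {p. e \<in> thru p \<and> card (thru p) = 4} = {F. matroid_line E indep F \<and> e \<in> F \<and> card F = 4}"
    proof (intro equalityI subsetI)
      fix F assume F: "F \<in> {F. matroid_line E indep F \<and> e \<in> F \<and> card F = 4}"
      then obtain p where "thru p = F" using thru_line by blast
      with F show "F \<in> thru ` {p. e \<in> thru p \<and> card (thru p) = 4}" by (intro image_eqI[of _ _ p]) simp_all
    qed (auto intro!: line_thru)
  qed
  from bij_betw_same_card[OF this] show ?thesis using config e by (simp add: configuration_16_4_def)
qed

lemma card_proj_fibre: "card {x. norm x = 1 \<and> proj x = p} = 2"
proof -
  obtain v where v: "norm v = 1" "proj v = p" using ex_unit_vector_proj by blast
  have "{x. norm x = 1 \<and> proj x = p} = {v, - v}"
  proof (intro equalityI subsetI)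
    fix x assume "x \<in> {x. norm x = 1 \<and> proj x = p}"
    then show "x \<in> {v, - v}" using proj_eq_sphere_iff[OF v(1), of x] v(2) by simp
  qed (use v proj_uminus[OF v(1)] in auto)
  moreover have "v \<noteq> - v"
  proof
    assume "v = - v"
    then have "v \<bullet> v = - (v \<bullet> v)" by (metis inner_minus_left)
    then show False using v(1) by (simp add: norm_eq_1)
  qed
  ultimately show ?thesis by simp
qed

lemma not_realizable: False
proof -
  obtain c \<sigma> \<tau> where lift:
    "\<And>e t. e \<in> E \<Longrightarrow> c e (t + 1) = - c e t"
    "\<And>e s t. e \<in> E \<Longrightarrow> c e s = c e t \<Longrightarrow> \<exists>k::int. s = t + 2 * of_int k"
    "\<And>e. e \<in> E \<Longrightarrow> range (c e) = {x. norm x = 1 \<and> proj x \<in> L e}"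
    "\<And>e f t. e \<in> E \<Longrightarrow> f \<in> E \<Longrightarrow> e \<noteq> f \<Longrightarrow> \<sigma> f (c e t) = sg (t - \<tau> e f)"
    "\<And>e x. e \<in> E \<Longrightarrow> norm x = 1 \<Longrightarrow> \<sigma> e x = 0 \<longleftrightarrow> x \<in> range (c e)"
    by (rule pseudoline_arrangement_lift[OF arr]) blast
  interpret pseudocircles E c \<sigma> \<tau>
  proof
    fix e f t assume ef: "e \<in> E" "f \<in> E" "e \<noteq> f"
    have "norm (c e t) = 1" using rangeI[of "c e" t] unfolding lift(3)[OF ef(1)] by simp
    then have "c e t \<in> range (c f) \<longleftrightarrow> sg (t - \<tau> e f) = 0"
      using lift(5)[OF ef(2), of "c e t"] lift(4)[OF ef, of t] by simp
    then show "c e t \<in> range (c f) \<longleftrightarrow> t - \<tau> e f \<in> \<int>" by (simp add: sg_def)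
  qed (fact finE lift)+
  \<comment> \<open>Vectors of other length lie on no curve, and a unit vector lies on exactly the
    curves whose pseudolines pass through its image, so the bounds on \<open>thru\<close> carry over
    to the sphere.\<close>
  have Z: "Z x = (if norm x = 1 then thru (proj x) else {})" for x
    using lift(3) by (auto simp: Z_def thru_def)
  interpret pseudocircles_16_4 E c \<sigma> \<tau>
  proof
    show "card E = 16" using config by (simp add: configuration_16_4_def)
    show "mult x \<le> 4" for x using card_thru_le by (simp add: mult_def Z)
    fix e assume e: "e \<in> E"
    define Q where "Q = {p. e \<in> thru p \<and> card (thru p) = 4}"
    have Q: "card Q = 4" unfolding Q_def by (rule card_fourfold_points[OF e])
    then have finQ: "finite Q" using card.infinite by fastforce
    have "{x \<in> V. e \<in> Z x \<and> mult x = 4} = (\<Union>p\<in>Q. {x. norm x = 1 \<and> proj x = p})"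
      by (auto simp: V_def mult_def Z Q_def)
    also have "card \<dots> = (\<Sum>p\<in>Q. card {x. norm x = 1 \<and> proj x = p})"
      using finQ card_proj_fibre by (intro card_UN_disjoint) (auto intro: card_ge_0_finite)
    also have "\<dots> = 8" by (simp add: card_proj_fibre Q)
    finally show "card {x \<in> V. e \<in> Z x \<and> mult x = 4} = 8" .
  qed
  show False by (rule contradiction)
qed

end

theorem mainTheorem4:
  "\<not> (\<exists>(E :: 'a set) indep. configuration_16_4 E indep \<and> pl_realizable E indep)"
proof
  assume "\<exists>(E :: 'a set) indep. configuration_16_4 E indep \<and> pl_realizable E indep"
  then obtain E :: "'a set" and indep L where "configuration_16_4 E indep" "pseudoline_arrangement E L"
    "\<And>S. S \<subseteq> E \<Longrightarrow> (\<exists>p. \<forall>e\<in>S. p \<in> L e) \<longleftrightarrow> matroid_rank indep S \<le> 2"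
    unfolding pl_realizable_def by blast
  then interpret configuration_realization E indep L by unfold_locales
  show False by (rule not_realizable)
qed

end
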